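(* Let $X = C \times_1 U^1 \times_2 \cdots \times_d U^d$ be in $\mathcal M\subset\mathcal H=\ell_2(\mathbb N^d)$, with $\mathcal M$ defined as in the context. Then the following statements hold. (i) There exists an open neighborhood $\mathcal O$ of $X$ and a submersion $g$ defined on $\mathcal O$ such that $\mathcal M \cap \mathcal O = g^{-1}(0)$. Consequently, $\mathcal M \cap \mathcal O$ is a smooth submanifold in the Hilbert space $\mathcal H$. The tangent space $T_{X} \mathcal M$ at $X \in \mathcal M \cap \mathcal O$ is the null space of $g'(X)$. (ii) There exists a continuously Fréchet-differentiable homeomorphism $\varphi$ from a neighborhood of zero in $T_{X} \mathcal M$ to $\mathcal M \cap \mathcal O$ satisfying $\varphi(\xi) = X + \xi + o(\| \xi \|_{\mathcal{H}})$ for all $\xi$ in that neighborhood. Moreover, $\varphi$ is also an immersion and hence a local embedding for $\mathcal M$. (iii) The tangent space $T_X\mathcal M$ equals the subspace spanned by elements of the form \[ \xi = \dot{C} \times_1 U^1 \times_2 \dots \times_d U^d + C \times_1 \dot{U}^1 \times_2 \dots \times_d U^d + \dots + C \times_1 U^1 \times_2 \dots \times_d \dot{U}^d \] with $\dot C \in T_C \mathcal{M}_{\mathrm{c}}$ and $\dot U^\mu\in(\ell_2(\mathbb N))^{r_\mu}$ satisfying $(U^\mu)^{\mathsf T} \dot U^\mu = 0_{r_\mu \times r_\mu}$ for $\mu = 1,\dots,d$ (that is, the columns of $\dot U^\mu$ span a subspace orthogonal to the span of the columns of $U^\mu$).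
   Context: Let $d,r_1,\dots,r_d$ be positive integers. $\mathbb R^{r_1\times\dots\times r_d}_*$ denotes the open set of tensors with full multilinear rank $(r_1,\dots,r_d)$ (the $\mu$-th matricization has rank $r_\mu$ for every $\mu$). $\times_\mu$ denotes left multiplication of a matrix (possibly with infinitely many rows) onto the $\mu$-th mode of a tensor. $\mathcal M_{\mathrm c}\subset\mathbb R^{r_1\times\dots\times r_d}_*$ is a smooth (embedded) submanifold satisfying $C\times_1T^1\times_2\cdots\times_dT^d\in\mathcal M_{\mathrm c}$ for all $C\in\mathcal M_{\mathrm c}$ and all invertible matrices $T^\mu\in\mathbb R^{r_\mu\times r_\mu}$; $T_C\mathcal M_{\mathrm c}$ is its tangent space at $C$. An element $U^\mu=[u^\mu_1,\dots,u^\mu_{r_\mu}]\in(\ell_2(\mathbb N))^{r_\mu}$ is treated as a matrix with columns $u^\mu_k\in\ell_2(\mathbb N)$. With $\mathcal H=\ell_2(\mathbb N^d)=\ell_2(\mathbb N)\otimes\dots\otimes\ell_2(\mathbb N)$, \[\mathcal M=\{X=C\times_1U^1\times_2\cdots\times_dU^d:\ C\in\mathcal M_{\mathrm c},\ U^\mu\in(\ell_2(\mathbb N))^{r_\mu},\ (U^\mu)^{\mathsf T}U^\mu\text{ invertible}\}.\] A submersion is a smooth map into a Banach space whose derivative is surjective with complemented null space at every point of its domain. An immersion is a map whose derivative is injective with closed complemented range. The tangent space $T_X\mathcal M$ is the set of derivatives $\varphi'(0)$ of differentiable curves $\varphi$ in $\mathcal M$ with $\varphi(0)=X$. *)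

theory Defs
  imports "HOL-Analysis.Analysis" "HOL-Library.Landau_Symbols"
begin

section \<open>Square-summable families\<close>

typedef 'a ell2 = "{f :: 'a \<Rightarrow> real. (\<lambda>i. (f i)\<^sup>2) summable_on UNIV}"
  morphisms coord Abs_ell2
  by (rule exI[of _ "\<lambda>_. 0"]) simp

setup_lifting type_definition_ell2

lemma summable_on_coord_square: "(\<lambda>i. (coord x i)\<^sup>2) summable_on UNIV"
  using coord by blast

lemma ell2_eqI: "(\<And>i. coord x i = coord y i) \<Longrightarrow> x = y"
  by (simp add: coord_inject[symmetric] fun_eq_iff)

lemma square_summable_mult:
  fixes f g :: "'a \<Rightarrow> real"
  assumes "(\<lambda>i. (f i)\<^sup>2) summable_on A" "(\<lambda>i. (g i)\<^sup>2) summable_on A"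
  shows "(\<lambda>i. f i * g i) summable_on A"
proof -
  have s: "(\<lambda>i. (f i)\<^sup>2 + (g i)\<^sup>2) summable_on A"
    by (intro summable_on_add assms)
  have "norm (f i * g i) \<le> (f i)\<^sup>2 + (g i)\<^sup>2" for i
  proof -
    have "2 * (\<bar>f i\<bar> * \<bar>g i\<bar>) \<le> (f i)\<^sup>2 + (g i)\<^sup>2"
      using sum_squares_bound[of "\<bar>f i\<bar>" "\<bar>g i\<bar>"] by (simp add: mult.assoc)
    moreover have "0 \<le> \<bar>f i\<bar> * \<bar>g i\<bar>"
      by simp
    ultimately have "\<bar>f i\<bar> * \<bar>g i\<bar> \<le> (f i)\<^sup>2 + (g i)\<^sup>2"
      by linarith
    then show ?thesis
      by (simp add: abs_mult)
  qed
  then have "(\<lambda>i. norm (f i * g i)) summable_on A"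
    by (intro summable_on_comparison_test[OF s]) auto
  then show ?thesis
    by (rule abs_summable_summable)
qed

lemma square_summable_add:
  fixes f g :: "'a \<Rightarrow> real"
  assumes "(\<lambda>i. (f i)\<^sup>2) summable_on A" "(\<lambda>i. (g i)\<^sup>2) summable_on A"
  shows "(\<lambda>i. (f i + g i)\<^sup>2) summable_on A"
proof -
  have "(\<lambda>i. (f i)\<^sup>2 + (g i)\<^sup>2 + 2 * (f i * g i)) summable_on A"
    by (intro summable_on_add summable_on_cmult_right square_summable_mult assms)
  then show ?thesis
    by (simp add: power2_sum mult.assoc)
qed

instantiation ell2 :: (type) real_vector
begin

lift_definition zero_ell2 :: "'a ell2" is "\<lambda>_. 0"
  by simp

lift_definition plus_ell2 :: "'a ell2 \<Rightarrow> 'a ell2 \<Rightarrow> 'a ell2" is "\<lambda>f g i. f i + g i"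
  by (rule square_summable_add)

lift_definition uminus_ell2 :: "'a ell2 \<Rightarrow> 'a ell2" is "\<lambda>f i. - f i"
  by simp

lift_definition minus_ell2 :: "'a ell2 \<Rightarrow> 'a ell2 \<Rightarrow> 'a ell2" is "\<lambda>f g i. f i - g i"
proof -
  fix f g :: "'a \<Rightarrow> real"
  assume "(\<lambda>i. (f i)\<^sup>2) summable_on UNIV" "(\<lambda>i. (g i)\<^sup>2) summable_on UNIV"
  then show "(\<lambda>i. (f i - g i)\<^sup>2) summable_on UNIV"
    using square_summable_add[of f UNIV "\<lambda>i. - g i"] by simp
qed

lift_definition scaleR_ell2 :: "real \<Rightarrow> 'a ell2 \<Rightarrow> 'a ell2" is "\<lambda>c f i. c * f i"
  by (simp add: power_mult_distrib summable_on_cmult_right)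

instance
proof
  fix x y z :: "'a ell2" and a b :: real
  show "x + y + z = x + (y + z)" "x + y = y + x" "0 + x = x" "- x + x = 0" "x - y = x + - y"
    by (transfer; simp add: fun_eq_iff)+
  show "a *\<^sub>R (x + y) = a *\<^sub>R x + a *\<^sub>R y" "(a + b) *\<^sub>R x = a *\<^sub>R x + b *\<^sub>R x"
    "a *\<^sub>R b *\<^sub>R x = (a * b) *\<^sub>R x" "1 *\<^sub>R x = x"
    by (transfer; simp add: fun_eq_iff algebra_simps)+
qed

end

instantiation ell2 :: (type) real_inner
begin

definition inner_ell2 :: "'a ell2 \<Rightarrow> 'a ell2 \<Rightarrow> real"
  where "inner_ell2 x y = (\<Sum>\<^sub>\<infinity>i. coord x i * coord y i)"

definition norm_ell2 :: "'a ell2 \<Rightarrow> real"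
  where "norm_ell2 x = sqrt (inner x x)"

definition dist_ell2 :: "'a ell2 \<Rightarrow> 'a ell2 \<Rightarrow> real"
  where "dist_ell2 x y = norm (x - y)"

definition sgn_ell2 :: "'a ell2 \<Rightarrow> 'a ell2"
  where "sgn_ell2 x = x /\<^sub>R norm x"

definition uniformity_ell2 :: "('a ell2 \<times> 'a ell2) filter"
  where "uniformity_ell2 = (INF e\<in>{0<..}. principal {(x, y). dist x y < e})"

definition open_ell2 :: "'a ell2 set \<Rightarrow> bool"
  where "open_ell2 U \<longleftrightarrow> (\<forall>x\<in>U. \<forall>\<^sub>F (x', y) in uniformity. x' = x \<longrightarrow> y \<in> U)"

instance
proof
  fix x y z :: "'a ell2" and a b :: real
  show "dist x y = norm (x - y)"
    by (rule dist_ell2_def)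
  show "sgn x = x /\<^sub>R norm x"
    by (rule sgn_ell2_def)
  show "uniformity = (INF e\<in>{0<..}. principal {(x, y :: 'a ell2). dist x y < e})"
    by (rule uniformity_ell2_def)
  show "open U = (\<forall>x\<in>U. \<forall>\<^sub>F (x', y) in uniformity. x' = x \<longrightarrow> y \<in> U)" for U :: "'a ell2 set"
    by (rule open_ell2_def)
  show "inner x y = inner y x"
    by (simp add: inner_ell2_def mult.commute)
  note s = square_summable_mult[OF summable_on_coord_square summable_on_coord_square]
  show "inner (x + y) z = inner x z + inner y z"
    unfolding inner_ell2_def plus_ell2.rep_eq distrib_right
    by (rule infsum_add[OF s s])
  show "inner (a *\<^sub>R x) y = a * inner x y"
    unfolding inner_ell2_def scaleR_ell2.rep_eq mult.assoc
    by (rule infsum_cmult_right[OF s])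
  show "0 \<le> inner x x"
    unfolding inner_ell2_def by (rule infsum_nonneg) simp
  show "inner x x = 0 \<longleftrightarrow> x = 0"
  proof
    assume "inner x x = 0"
    then have "coord x i * coord x i = 0" for i
      by (intro nonneg_infsum_le_0D[where A = UNIV and f = "\<lambda>i. coord x i * coord x i", OF _ s])
        (auto simp: inner_ell2_def)
    then show "x = 0"
      by (intro ell2_eqI) (simp add: zero_ell2.rep_eq)
  qed (simp add: inner_ell2_def zero_ell2.rep_eq)
  show "norm x = sqrt (inner x x)"
    by (rule norm_ell2_def)
qed

end

lemma norm_ell2_square: "(norm x)\<^sup>2 = (\<Sum>\<^sub>\<infinity>i. (coord x i)\<^sup>2)"
  unfolding power2_norm_eq_inner inner_ell2_def by (simp add: power2_eq_square)

lemma sum_coord_square_le: "finite F \<Longrightarrow> (\<Sum>i\<in>F. (coord x i)\<^sup>2) \<le> (norm x)\<^sup>2"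
  unfolding norm_ell2_square
  by (rule finite_sum_le_infsum[OF summable_on_coord_square]) auto

lemma abs_coord_le: "\<bar>coord x i\<bar> \<le> norm x"
  using sum_coord_square_le[of "{i}" x] abs_le_square_iff[of "coord x i" "norm x"] by simp

instance ell2 :: (type) banach
proof
  fix X :: "nat \<Rightarrow> 'a ell2"
  assume X: "Cauchy X"
  have "Cauchy (\<lambda>n. coord (X n) i)" for i
  proof (rule metric_CauchyI)
    fix e :: real assume "0 < e"
    then obtain N where N: "\<And>m n. m \<ge> N \<Longrightarrow> n \<ge> N \<Longrightarrow> dist (X m) (X n) < e"
      using metric_CauchyD[OF X] by metis
    have "dist (coord (X m) i) (coord (X n) i) < e" if "m \<ge> N" "n \<ge> N" for m n
      using abs_coord_le[of "X m - X n" i] N[OF that]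
      by (simp add: dist_norm minus_ell2.rep_eq)
    then show "\<exists>N. \<forall>m\<ge>N. \<forall>n\<ge>N. dist (coord (X m) i) (coord (X n) i) < e"
      by blast
  qed
  then have "\<forall>i. \<exists>l. (\<lambda>n. coord (X n) i) \<longlonglongrightarrow> l"
    by (auto simp: Cauchy_convergent_iff convergent_def)
  then obtain f where f: "\<And>i. (\<lambda>n. coord (X n) i) \<longlonglongrightarrow> f i"
    by metis
  have tail: "(\<Sum>i\<in>F. (coord (X n) i - f i)\<^sup>2) \<le> e\<^sup>2"
    if N: "\<And>m n. m \<ge> N \<Longrightarrow> n \<ge> N \<Longrightarrow> dist (X m) (X n) < e"
      and "n \<ge> N" "finite F" for e N n F
  proof (rule LIMSEQ_le_const2)
    show "(\<lambda>m. \<Sum>i\<in>F. (coord (X n) i - coord (X m) i)\<^sup>2) \<longlonglongrightarrow> (\<Sum>i\<in>F. (coord (X n) i - f i)\<^sup>2)"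
      by (intro tendsto_intros f)
    have "(\<Sum>i\<in>F. (coord (X n) i - coord (X m) i)\<^sup>2) \<le> e\<^sup>2" if "m \<ge> N" for m
    proof -
      have "(\<Sum>i\<in>F. (coord (X n) i - coord (X m) i)\<^sup>2) \<le> (norm (X n - X m))\<^sup>2"
        using sum_coord_square_le[OF \<open>finite F\<close>, of "X n - X m"] by (simp add: minus_ell2.rep_eq)
      also have "\<dots> \<le> e\<^sup>2"
        using N[OF \<open>n \<ge> N\<close> that] by (intro power_mono) (auto simp: dist_norm)
      finally show ?thesis .
    qed
    then show "\<exists>M. \<forall>m\<ge>M. (\<Sum>i\<in>F. (coord (X n) i - coord (X m) i)\<^sup>2) \<le> e\<^sup>2"
      by blast
  qed
  have summable: "(\<lambda>i. (coord (X n) i - f i)\<^sup>2) summable_on UNIV"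
    if N: "\<And>m n. m \<ge> N \<Longrightarrow> n \<ge> N \<Longrightarrow> dist (X m) (X n) < e" and n: "n \<ge> N" for e N n
    by (rule nonneg_bounded_partial_sums_imp_summable_on[where C = "e\<^sup>2"])
      (auto simp: eventually_finite_subsets_at_top intro!: tail[OF N n] exI[of _ "{}"])
  obtain N where N: "\<And>m n. m \<ge> N \<Longrightarrow> n \<ge> N \<Longrightarrow> dist (X m) (X n) < 1"
    using metric_CauchyD[OF X, of 1] by auto
  have "(\<lambda>i. (- (coord (X N) i - f i))\<^sup>2) summable_on UNIV"
    using summable[OF N order_refl] by (simp add: power2_commute)
  then have "(\<lambda>i. (coord (X N) i + - (coord (X N) i - f i))\<^sup>2) summable_on UNIV"
    by (rule square_summable_add[OF summable_on_coord_square])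
  then have coord_f: "coord (Abs_ell2 f) = f"
    by (simp add: Abs_ell2_inverse)
  have "X \<longlonglongrightarrow> Abs_ell2 f"
  proof (rule metric_LIMSEQ_I)
    fix e :: real assume e: "0 < e"
    then obtain N where N: "\<And>m n. m \<ge> N \<Longrightarrow> n \<ge> N \<Longrightarrow> dist (X m) (X n) < e / 2"
      using metric_CauchyD[OF X, of "e / 2"] by auto
    have "dist (X n) (Abs_ell2 f) < e" if n: "n \<ge> N" for n
    proof -
      have "(norm (X n - Abs_ell2 f))\<^sup>2 = (\<Sum>\<^sub>\<infinity>i. (coord (X n) i - f i)\<^sup>2)"
        by (simp add: norm_ell2_square minus_ell2.rep_eq coord_f)
      also have "\<dots> \<le> (e / 2)\<^sup>2"
        by (rule infsum_le_finite_sums[OF summable[OF N n]]) (auto intro: tail[OF N n])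
      finally have "norm (X n - Abs_ell2 f) \<le> e / 2"
        using e by (auto intro: power2_le_imp_le)
      with e show ?thesis
        by (simp add: dist_norm)
    qed
    then show "\<exists>N. \<forall>n\<ge>N. dist (X n) (Abs_ell2 f) < e"
      by blast
  qed
  then show "convergent X"
    by (auto simp: convergent_def)
qed


section \<open>Smooth maps and submanifolds in Banach spaces\<close>

text \<open>A map on lists of length \<open>n\<close> stands for a map of \<open>n\<close> vector arguments.\<close>

definition bounded_multilinear :: "nat \<Rightarrow> ('a::real_normed_vector list \<Rightarrow> 'b::real_normed_vector) \<Rightarrow> bool"
  where "bounded_multilinear n f \<longleftrightarrow>
    (\<forall>hs i. length hs = n \<and> i < n \<longrightarrow> linear (\<lambda>h. f (hs[i := h]))) \<and>
    (\<exists>K. \<forall>hs. length hs = n \<longrightarrow> norm (f hs) \<le> K * prod_list (map norm hs))"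

text \<open>
  Infinite Frechet differentiability on an open set. \<open>D n x\<close> is the derivative of order \<open>n\<close>
  of \<open>f\<close> at \<open>x\<close>, an element of the space of bounded \<open>n\<close>-linear maps. That space depends on
  \<open>n\<close> and hence is not available as one type for all \<open>n\<close>; the last conjunct spells out, with
  respect to its operator norm, that \<open>D (Suc n) x\<close> is the Frechet derivative of \<open>D n\<close> at \<open>x\<close>.
\<close>

definition smooth_on :: "'a::real_normed_vector set \<Rightarrow> ('a \<Rightarrow> 'b::real_normed_vector) \<Rightarrow> bool"
  where "smooth_on S f \<longleftrightarrow> open S \<and>
    (\<exists>D :: nat \<Rightarrow> 'a \<Rightarrow> 'a list \<Rightarrow> 'b.
      (\<forall>x\<in>S. D 0 x [] = f x) \<and>
      (\<forall>n. \<forall>x\<in>S. bounded_multilinear n (D n x)) \<and>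
      (\<forall>n. \<forall>x\<in>S. \<forall>e>0. \<exists>\<delta>>0. \<forall>h. norm h < \<delta> \<and> x + h \<in> S \<longrightarrow>
        (\<forall>hs. length hs = n \<longrightarrow>
          norm (D n (x + h) hs - D n x hs - D (Suc n) x (h # hs))
            \<le> e * norm h * prod_list (map norm hs))))"

definition complemented :: "'a::real_normed_vector set \<Rightarrow> bool"
  where "complemented N \<longleftrightarrow> subspace N \<and> closed N \<and>
    (\<exists>W. subspace W \<and> closed W \<and> N \<inter> W = {0} \<and> (\<forall>x. \<exists>a\<in>N. \<exists>b\<in>W. x = a + b))"

text \<open>
  The target Banach space of a submersion is a closed subspace \<open>F\<close> of a Banach space \<open>'b\<close>, since
  it is not possible to quantify existentially over types.
\<close>

definition submersion_on :: "'a::banach set \<Rightarrow> 'b::banach set \<Rightarrow> ('a \<Rightarrow> 'b) \<Rightarrow> bool"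
  where "submersion_on S F g \<longleftrightarrow>
    subspace F \<and> closed F \<and> smooth_on S g \<and> g ` S \<subseteq> F \<and>
    (\<forall>x\<in>S. range (frechet_derivative g (at x)) = F \<and>
           complemented {v. frechet_derivative g (at x) v = 0})"

text \<open>
  The domain \<open>V\<close> of an immersion is a relatively open subset of a closed subspace \<open>E\<close>, so the
  derivative within \<open>V\<close> is only determined, and only considered, on \<open>E\<close>.
\<close>

definition C1_on :: "'a::banach set \<Rightarrow> 'a set \<Rightarrow> ('a \<Rightarrow> 'b::banach) \<Rightarrow> bool"
  where "C1_on E V f \<longleftrightarrow>
    (\<exists>f'. (\<forall>x\<in>V. (f has_derivative f' x) (at x within V)) \<and>
      (\<forall>x\<in>V. \<forall>e>0. \<exists>\<delta>>0. \<forall>y\<in>V. dist y x < \<delta> \<longrightarrow>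
        (\<forall>v\<in>E. norm (f' y v - f' x v) \<le> e * norm v)))"

definition immersion_on :: "'a::banach set \<Rightarrow> 'a set \<Rightarrow> ('a \<Rightarrow> 'b::banach) \<Rightarrow> bool"
  where "immersion_on E V f \<longleftrightarrow>
    (\<exists>f'. \<forall>x\<in>V. (f has_derivative f' x) (at x within V) \<and>
      inj_on (f' x) E \<and> complemented (f' x ` E))"

definition embedding_on :: "'a::banach set \<Rightarrow> 'a set \<Rightarrow> ('a \<Rightarrow> 'b::banach) \<Rightarrow> bool"
  where "embedding_on E V f \<longleftrightarrow> immersion_on E V f \<and> (\<exists>k. homeomorphism V (f ` V) f k)"

definition smooth_diffeo_on :: "'a::real_normed_vector set \<Rightarrow> ('a \<Rightarrow> 'a) \<Rightarrow> bool"
  where "smooth_diffeo_on S f \<longleftrightarrow>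
    smooth_on S f \<and> inj_on f S \<and> smooth_on (f ` S) (the_inv_into S f)"

text \<open>
  Embedded submanifolds: near each point, some smooth change of coordinates of the ambient space
  maps \<open>M\<close> onto a closed complemented subspace.
\<close>

definition smooth_submanifold :: "'a::banach set \<Rightarrow> bool"
  where "smooth_submanifold M \<longleftrightarrow>
    (\<forall>x\<in>M. \<exists>S f E. open S \<and> x \<in> S \<and> smooth_diffeo_on S f \<and> complemented E \<and>
      f ` (M \<inter> S) = f ` S \<inter> E)"

definition tangent_space :: "'a::real_normed_vector set \<Rightarrow> 'a \<Rightarrow> 'a set"
  where "tangent_space M x = {v. \<exists>\<epsilon>>0. \<exists>\<gamma> :: real \<Rightarrow> 'a.
    \<gamma> 0 = x \<and> (\<forall>t. \<bar>t\<bar> < \<epsilon> \<longrightarrow> \<gamma> t \<in> M \<and> \<gamma> differentiable (at t)) \<and>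
    (\<gamma> has_vector_derivative v) (at 0)}"


section \<open>Tensors\<close>

text \<open>
  The modes are the elements of a finite type \<open>'d\<close>, and \<open>('d \<Rightarrow> nat) ell2\<close> is the tensor product
  of \<open>CARD('d)\<close> copies of \<open>nat ell2\<close>. A tensor of size \<open>r\<close> is a vector \<open>C :: real ^ 'i\<close> whose
  coordinate \<open>C $ i\<close> is the entry at the multi-index \<open>idx i\<close>, where \<open>idx\<close> enumerates the
  multi-indices below \<open>r\<close>. Indices start at 0. An \<open>m \<times> n\<close> matrix is a function of two natural
  numbers of which only the values at \<open>k < m\<close>, \<open>l < n\<close> matter.
\<close>

definition enumerates_box :: "('d::finite \<Rightarrow> nat) \<Rightarrow> ('i::finite \<Rightarrow> 'd \<Rightarrow> nat) \<Rightarrow> bool"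
  where "enumerates_box r idx \<longleftrightarrow> bij_betw idx UNIV {\<alpha>. \<forall>\<mu>. \<alpha> \<mu> < r \<mu>}"

definition entry :: "('i::finite \<Rightarrow> 'd::finite \<Rightarrow> nat) \<Rightarrow> real ^ 'i \<Rightarrow> ('d \<Rightarrow> nat) \<Rightarrow> real"
  where "entry idx C \<alpha> = C $ inv idx \<alpha>"

definition invertible_upto :: "nat \<Rightarrow> (nat \<Rightarrow> nat \<Rightarrow> real) \<Rightarrow> bool"
  where "invertible_upto n A \<longleftrightarrow>
    (\<exists>B. (\<forall>i<n. \<forall>j<n. (\<Sum>k<n. A i k * B k j) = (if i = j then 1 else 0)) \<and>
         (\<forall>i<n. \<forall>j<n. (\<Sum>k<n. B i k * A k j) = (if i = j then 1 else 0)))"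

text \<open>
  The matricization of mode \<open>\<mu>\<close>, padded with zeros to a square matrix. Row \<open>k\<close> is found at the
  multi-index that is \<open>k\<close> in mode \<open>\<mu>\<close> and 0 in all other modes, and columns at the multi-indices
  that are 0 in mode \<open>\<mu>\<close>.
\<close>

definition matricization :: "('i::finite \<Rightarrow> 'd::finite \<Rightarrow> nat) \<Rightarrow> 'd \<Rightarrow> real ^ 'i \<Rightarrow> real ^ 'i ^ 'i"
  where "matricization idx \<mu> C = (\<chi> i j.
    if (\<forall>\<nu>. \<nu> \<noteq> \<mu> \<longrightarrow> idx i \<nu> = 0) \<and> idx j \<mu> = 0
    then entry idx C ((idx j)(\<mu> := idx i \<mu>)) else 0)"

definition full_multilinear_rank_tensors ::
    "('d::finite \<Rightarrow> nat) \<Rightarrow> ('i::finite \<Rightarrow> 'd \<Rightarrow> nat) \<Rightarrow> (real ^ 'i) set"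
  where "full_multilinear_rank_tensors r idx = {C. \<forall>\<mu>. rank (matricization idx \<mu> C) = r \<mu>}"

definition core_mult ::
    "('i::finite \<Rightarrow> 'd::finite \<Rightarrow> nat) \<Rightarrow> real ^ 'i \<Rightarrow> ('d \<Rightarrow> nat \<Rightarrow> nat \<Rightarrow> real) \<Rightarrow> real ^ 'i"
  where "core_mult idx C T = (\<chi> i. \<Sum>j\<in>UNIV. (\<Prod>\<mu>\<in>UNIV. T \<mu> (idx i \<mu>) (idx j \<mu>)) * C $ j)"

lemma square_summable_tensor_prod:
  fixes f :: "'d::finite \<Rightarrow> 'a \<Rightarrow> real"
  assumes "\<And>\<mu>. (\<lambda>i. (f \<mu> i)\<^sup>2) summable_on UNIV"
  shows "(\<lambda>\<alpha>. (\<Prod>\<mu>\<in>UNIV. f \<mu> (\<alpha> \<mu>))\<^sup>2) summable_on UNIV"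
proof (rule nonneg_bounded_partial_sums_imp_summable_on)
  let ?C = "\<Prod>\<mu>\<in>UNIV. \<Sum>\<^sub>\<infinity>i. (f \<mu> i)\<^sup>2"
  have "(\<Sum>\<alpha>\<in>A. (\<Prod>\<mu>\<in>UNIV. f \<mu> (\<alpha> \<mu>))\<^sup>2) \<le> ?C" if A: "finite A" for A
  proof -
    let ?B = "\<lambda>\<mu>. (\<lambda>\<alpha>. \<alpha> \<mu>) ` A"
    have "(\<Sum>\<alpha>\<in>A. (\<Prod>\<mu>\<in>UNIV. f \<mu> (\<alpha> \<mu>))\<^sup>2) \<le> (\<Sum>\<alpha>\<in>Pi\<^sub>E UNIV ?B. \<Prod>\<mu>\<in>UNIV. (f \<mu> (\<alpha> \<mu>))\<^sup>2)"
      using A by (auto simp: prod_power_distrib intro!: sum_mono2 finite_PiE prod_nonneg)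
    also have "\<dots> = (\<Prod>\<mu>\<in>UNIV. \<Sum>i\<in>?B \<mu>. (f \<mu> i)\<^sup>2)"
      using A by (simp add: prod_sum_PiE)
    also have "\<dots> \<le> ?C"
      using A by (intro prod_mono conjI sum_nonneg finite_sum_le_infsum assms) auto
    finally show ?thesis .
  qed
  then show "\<forall>\<^sub>F A in finite_subsets_at_top UNIV. (\<Sum>\<alpha>\<in>A. (\<Prod>\<mu>\<in>UNIV. f \<mu> (\<alpha> \<mu>))\<^sup>2) \<le> ?C"
    by (auto simp: eventually_finite_subsets_at_top intro!: exI[of _ "{}"])
qed simp

lift_definition elementary_tensor :: "('d::finite \<Rightarrow> 'a ell2) \<Rightarrow> ('d \<Rightarrow> 'a) ell2"
  is "\<lambda>u \<alpha>. \<Prod>\<mu>\<in>UNIV. u \<mu> (\<alpha> \<mu>)"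
  by (rule square_summable_tensor_prod)

text \<open>
  The multiplication of the matrices with columns \<open>U \<mu> k\<close>, \<open>k < r \<mu>\<close>, onto all modes.
\<close>

definition tucker ::
    "('i::finite \<Rightarrow> 'd::finite \<Rightarrow> nat) \<Rightarrow> real ^ 'i \<Rightarrow> ('d \<Rightarrow> nat \<Rightarrow> nat ell2) \<Rightarrow> ('d \<Rightarrow> nat) ell2"
  where "tucker idx C U = (\<Sum>i\<in>UNIV. C $ i *\<^sub>R elementary_tensor (\<lambda>\<mu>. U \<mu> (idx i \<mu>)))"

text \<open>The matrix with entries \<open>\<langle>u k, v l\<rangle>\<close>, that is, the product of the transpose of \<open>u\<close> with \<open>v\<close>.\<close>

definition transpose_mult :: "(nat \<Rightarrow> 'a::real_inner) \<Rightarrow> (nat \<Rightarrow> 'a) \<Rightarrow> nat \<Rightarrow> nat \<Rightarrow> real"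
  where "transpose_mult u v k l = inner (u k) (v l)"

definition tensor_manifold ::
    "('d::finite \<Rightarrow> nat) \<Rightarrow> ('i::finite \<Rightarrow> 'd \<Rightarrow> nat) \<Rightarrow> (real ^ 'i) set \<Rightarrow> ('d \<Rightarrow> nat) ell2 set"
  where "tensor_manifold r idx Mc = {tucker idx C U | C U.
    C \<in> Mc \<and> (\<forall>\<mu>. invertible_upto (r \<mu>) (transpose_mult (U \<mu>) (U \<mu>)))}"

text \<open>
  The closed formulas for \<open>core_mult\<close> and \<open>tucker\<close> agree with successive multiplication onto single modes, in any order.
\<close>

definition mode_mult ::
    "'d \<Rightarrow> nat \<Rightarrow> (nat \<Rightarrow> nat \<Rightarrow> real) \<Rightarrow> (('d \<Rightarrow> nat) \<Rightarrow> real) \<Rightarrow> ('d \<Rightarrow> nat) \<Rightarrow> real"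
  where "mode_mult \<mu> n A Z \<alpha> = (\<Sum>k<n. A (\<alpha> \<mu>) k * Z (\<alpha>(\<mu> := k)))"

lemma fold_mode_mult:
  assumes "distinct ms"
  shows "fold (\<lambda>\<mu>. mode_mult \<mu> (r \<mu>) (A \<mu>)) ms Z \<alpha> =
    (\<Sum>\<beta> | (\<forall>\<mu>\<in>set ms. \<beta> \<mu> < r \<mu>) \<and> (\<forall>\<mu>. \<mu> \<notin> set ms \<longrightarrow> \<beta> \<mu> = \<alpha> \<mu>).
      (\<Prod>\<mu>\<in>set ms. A \<mu> (\<alpha> \<mu>) (\<beta> \<mu>)) * Z \<beta>)"
  using assms
proof (induction ms arbitrary: Z)
  case Nil
  have "{\<beta>. \<forall>\<mu>. \<beta> \<mu> = \<alpha> \<mu>} = {\<alpha>}"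
    by auto
  then show ?case
    by simp
next
  case (Cons m ms)
  let ?B = "\<lambda>M. {\<beta>. (\<forall>\<mu>\<in>M. \<beta> \<mu> < r \<mu>) \<and> (\<forall>\<mu>. \<mu> \<notin> M \<longrightarrow> \<beta> \<mu> = \<alpha> \<mu>)}"
  have "fold (\<lambda>\<mu>. mode_mult \<mu> (r \<mu>) (A \<mu>)) (m # ms) Z \<alpha> =
      (\<Sum>\<beta>\<in>?B (set ms). (\<Prod>\<mu>\<in>set ms. A \<mu> (\<alpha> \<mu>) (\<beta> \<mu>)) *
        (\<Sum>k<r m. A m (\<beta> m) k * Z (\<beta>(m := k))))"
    using Cons.prems by (simp add: Cons.IH) (simp add: mode_mult_def)
  also have "\<dots> = (\<Sum>(\<beta>, k)\<in>?B (set ms) \<times> {..<r m}. (\<Prod>\<mu>\<in>set ms. A \<mu> (\<alpha> \<mu>) (\<beta> \<mu>)) *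
        (A m (\<beta> m) k * Z (\<beta>(m := k))))"
    by (simp add: sum_distrib_left sum.cartesian_product)
  also have "\<dots> = (\<Sum>\<beta>\<in>?B (set (m # ms)). (\<Prod>\<mu>\<in>set (m # ms). A \<mu> (\<alpha> \<mu>) (\<beta> \<mu>)) * Z \<beta>)"
  proof (rule sum.reindex_bij_witness[where j = "\<lambda>(\<beta>, k). \<beta>(m := k)"
        and i = "\<lambda>\<beta>. (\<beta>(m := \<alpha> m), \<beta> m)"], goal_cases)
    case (5 p)
    obtain \<beta> k where p: "p = (\<beta>, k)"
      by fastforce
    have m: "m \<notin> set ms" and "\<beta> m = \<alpha> m"
      using 5 Cons.prems by (auto simp: p)
    moreover have "(\<Prod>\<mu>\<in>set ms. A \<mu> (\<alpha> \<mu>) ((\<beta>(m := k)) \<mu>)) = (\<Prod>\<mu>\<in>set ms. A \<mu> (\<alpha> \<mu>) (\<beta> \<mu>))"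
      using m by (intro prod.cong) auto
    ultimately show ?case
      by (simp add: p mult_ac)
  qed (use Cons.prems in \<open>auto split: if_splits\<close>)
  finally show ?case .
qed

lemma fold_mode_mult_entry:
  assumes idx: "enumerates_box r idx" and ms: "distinct ms" "set ms = UNIV"
  shows "fold (\<lambda>\<mu>. mode_mult \<mu> (r \<mu>) (A \<mu>)) ms (entry idx C) \<alpha> =
    (\<Sum>i\<in>UNIV. (\<Prod>\<mu>\<in>UNIV. A \<mu> (\<alpha> \<mu>) (idx i \<mu>)) * C $ i)"
proof -
  have "inj idx"
    using idx by (simp add: enumerates_box_def bij_betw_def)
  then have "(\<Sum>i\<in>UNIV. (\<Prod>\<mu>\<in>UNIV. A \<mu> (\<alpha> \<mu>) (idx i \<mu>)) * C $ i) =
      (\<Sum>i\<in>UNIV. (\<lambda>\<beta>. (\<Prod>\<mu>\<in>UNIV. A \<mu> (\<alpha> \<mu>) (\<beta> \<mu>)) * entry idx C \<beta>) (idx i))"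
    by (simp add: entry_def)
  also have "\<dots> = (\<Sum>\<beta> | \<forall>\<mu>. \<beta> \<mu> < r \<mu>. (\<Prod>\<mu>\<in>UNIV. A \<mu> (\<alpha> \<mu>) (\<beta> \<mu>)) * entry idx C \<beta>)"
    by (rule sum.reindex_bij_betw) (use idx in \<open>simp add: enumerates_box_def\<close>)
  finally show ?thesis
    using fold_mode_mult[OF ms(1), of r A "entry idx C" \<alpha>] ms(2) by simp
qed

lemma core_mult_eq_mode_mult:
  assumes "enumerates_box r idx" "distinct ms" "set ms = UNIV"
  shows "core_mult idx C T $ i =
    fold (\<lambda>\<mu>. mode_mult \<mu> (r \<mu>) (T \<mu>)) ms (entry idx C) (idx i)"
  by (simp add: fold_mode_mult_entry[OF assms] core_mult_def)

lemma coord_sum: "coord (\<Sum>i\<in>I. f i) j = (\<Sum>i\<in>I. coord (f i) j)"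
  by (induction I rule: infinite_finite_induct) (simp_all add: zero_ell2.rep_eq plus_ell2.rep_eq)

lemma tucker_eq_mode_mult:
  assumes "enumerates_box r idx" "distinct ms" "set ms = UNIV"
  shows "coord (tucker idx C U) =
    fold (\<lambda>\<mu>. mode_mult \<mu> (r \<mu>) (\<lambda>n k. coord (U \<mu> k) n)) ms (entry idx C)"
  by (rule ext) (simp add: fold_mode_mult_entry[OF assms] tucker_def coord_sum
      scaleR_ell2.rep_eq elementary_tensor.rep_eq mult.commute)

end

theory Submission
  imports Defs
begin

text \<open>
  The reason for all three statements is that near \<open>X\<close> the set \<open>M\<close> is a graph over coordinates that
  are \<^emph>\<open>linear\<close> in the tensor, up to a chart of the finite-dimensional manifold \<open>Mc\<close> of cores.

  Let \<open>V \<mu>\<close> be the basis of the span of the columns of \<open>U \<mu>\<close> that is dual to these columns. The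
  multiplication of a tensor \<open>Y\<close> with the transposes of all \<open>V \<mu>\<close> is a tensor \<open>core Y\<close> of size \<open>r\<close>
  that depends linearly on \<open>Y\<close>. An element \<open>Y\<close> of \<open>M\<close> near \<open>X\<close> is, after a change of basis in every
  mode, the product of \<open>core Y\<close> with factors \<open>U \<mu> + K \<mu>\<close> where the columns of \<open>K \<mu>\<close> are orthogonal
  to those of \<open>U \<mu>\<close>, and these factors are unique. To find \<open>K \<mu>\<close>, multiply \<open>Y\<close> with the transposes
  of \<open>V \<nu>\<close> in the other modes, then with a fixed right inverse \<open>B \<mu>\<close> of the \<open>\<mu>\<close>-th matricization of
  \<open>C\<close>, which exists because \<open>C\<close> has full multilinear rank, and drop the component in the span of
  \<open>U \<mu>\<close>. The result \<open>W \<mu>\<close> is again linear in \<open>Y\<close>. On the tensors considered it equals \<open>K \<mu>\<close> times the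
  square matrix \<open>matricization idx \<mu> (core Y) ** B \<mu>\<close>, which is the identity for the core \<open>C\<close> and
  hence invertible for all cores near \<open>C\<close>. So \<open>K \<mu>\<close> is a rational function of \<open>core Y\<close> and \<open>W\<close>, and
  with the resulting map \<open>param\<close> one has, if \<open>core Y\<close> is near \<open>C\<close>,
  \<open>Y \<in> M \<longleftrightarrow> core Y \<in> Mc \<and> Y = param (core Y) Y\<close>, where the right-hand \<open>Y\<close> enters \<open>param\<close> only
  through \<open>W\<close> (\<open>M_param_iff\<close>).

  Subtracting \<open>param\<close> and adding back its two linear coordinates, the core transformed by a chart of
  \<open>Mc\<close>, is a shear of the open set of tensors with core near \<open>C\<close>, and its inverse can be written down. Within this
  set it maps \<open>M\<close> to the fixed space of a bounded projection (\<open>straightened_chart\<close>).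

  For any set straightened in this way, a defining submersion is obtained by projecting the
  straightening map to the complement, and the tangential parametrization by pulling back
  straight lines (\<open>defining_submersion\<close>, \<open>tangential_parametrization\<close>). The formula for the tangent space
  follows by differentiating curves in \<open>M\<close>, which are curves of cores and of factors
  (\<open>tangent_space_param\<close>).

  It remains to see that the straightening map and its inverse are smooth. They are built from
  bounded linear maps, charts of \<open>Mc\<close>, products and matrix inverses, so it suffices that smooth maps are closed
  under bounded bilinear products and under inverses in an algebra. All derivatives of a map
  together form a jet, a function on lists of directions; the Leibniz rule turns jets into an algebra,
  and both closure properties become identities and estimates in this algebra
  (\<open>smooth_on_prod\<close>, \<open>smooth_on_inverse\<close>).
\<close>

section \<open>Jets: derivatives of all orders at once\<close>

text \<open>
  A jet collects the derivatives of all orders of a map at one point: its value at a list of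
  \<open>n\<close> directions is the derivative of order \<open>n\<close> in these directions, and the value at the empty list is
  the value of the map. The constant in the next definition bounds the operator norms up to order \<open>n\<close>.
\<close>

definition jet_bound :: "nat \<Rightarrow> real \<Rightarrow> ('a::real_normed_vector list \<Rightarrow> 'b::real_normed_vector) \<Rightarrow> bool"
  where "jet_bound n K F \<longleftrightarrow> (\<forall>hs. length hs \<le> n \<longrightarrow> norm (F hs) \<le> K * prod_list (map norm hs))"

definition slot_linear :: "nat \<Rightarrow> ('a::real_vector list \<Rightarrow> 'b::real_vector) \<Rightarrow> bool"
  where "slot_linear n F \<longleftrightarrow>
    (\<forall>hs i. length hs \<le> n \<longrightarrow> i < length hs \<longrightarrow> linear (\<lambda>h. F (hs[i := h])))"

text \<open>
  The three growth classes of families of jets indexed by an increment: \<open>o(h)\<close>, \<open>O(h)\<close> and \<open>O(1)\<close>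
  as \<open>h\<close> tends to 0, with respect to the operator norms of all orders up to \<open>n\<close>.
\<close>

definition jet_small :: "nat \<Rightarrow> ('a::real_normed_vector \<Rightarrow> 'a list \<Rightarrow> 'b::real_normed_vector) \<Rightarrow> bool"
  where "jet_small n \<Phi> \<longleftrightarrow> (\<forall>e>0. \<forall>\<^sub>F h in nhds 0. jet_bound n (e * norm h) (\<Phi> h))"

definition jet_Lipschitz :: "nat \<Rightarrow> ('a::real_normed_vector \<Rightarrow> 'a list \<Rightarrow> 'b::real_normed_vector) \<Rightarrow> bool"
  where "jet_Lipschitz n \<Phi> \<longleftrightarrow> (\<exists>K. \<forall>\<^sub>F h in nhds 0. jet_bound n (K * norm h) (\<Phi> h))"

definition jet_bounded :: "nat \<Rightarrow> ('a::real_normed_vector \<Rightarrow> 'a list \<Rightarrow> 'b::real_normed_vector) \<Rightarrow> bool"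
  where "jet_bounded n \<Phi> \<longleftrightarrow> (\<exists>K. \<forall>\<^sub>F h in nhds 0. jet_bound n K (\<Phi> h))"

text \<open>
  The derivative of a jet in the direction \<open>h\<close> is the jet with \<open>h\<close> prepended to all lists. Stating
  the remainder estimate for all orders up to \<open>n\<close> at once, instead of order by order, is what
  allows products of jets to be estimated without splitting them into their terms.
\<close>

definition smooth_jet :: "'a::real_normed_vector set \<Rightarrow> ('a \<Rightarrow> 'a list \<Rightarrow> 'b::real_normed_vector) \<Rightarrow> bool"
  where "smooth_jet S F \<longleftrightarrow>
    (\<forall>x\<in>S. \<forall>n. slot_linear n (F x) \<and> (\<exists>K. jet_bound n K (F x)) \<and>
      jet_small n (\<lambda>h hs. F (x + h) hs - F x hs - F x (h # hs)))"

lemma prod_list_norm_nonneg: "0 \<le> prod_list (map norm hs)"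
  by (induction hs) auto

lemma jet_bound_nonneg: "jet_bound n K F \<Longrightarrow> 0 \<le> K"
  unfolding jet_bound_def using norm_ge_zero[of "F []"] by (auto dest!: spec[of _ "[]"] simp del: norm_ge_zero)

lemma jet_boundD: "jet_bound n K F \<Longrightarrow> length hs \<le> n \<Longrightarrow> norm (F hs) \<le> K * prod_list (map norm hs)"
  by (simp add: jet_bound_def)

lemma jet_bound_mono: "jet_bound n K F \<Longrightarrow> K \<le> K' \<Longrightarrow> m \<le> n \<Longrightarrow> jet_bound m K' F"
  unfolding jet_bound_def by (meson mult_right_mono order_trans prod_list_norm_nonneg)

lemma jet_bound_add: "jet_bound n K F \<Longrightarrow> jet_bound n L G \<Longrightarrow> jet_bound n (K + L) (\<lambda>hs. F hs + G hs)"
  unfolding jet_bound_def distrib_right by (blast intro: norm_triangle_le add_mono)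

lemma jet_bound_Cons: "jet_bound (Suc n) K F \<Longrightarrow> jet_bound n (K * norm h) (\<lambda>hs. F (h # hs))"
  unfolding jet_bound_def by (force dest: spec[of _ "h # _"] simp: mult.assoc)

lemma slot_linear_mono: "slot_linear n F \<Longrightarrow> m \<le> n \<Longrightarrow> slot_linear m F"
  by (auto simp: slot_linear_def)

lemma slot_linear_Cons: "slot_linear (Suc n) F \<Longrightarrow> slot_linear n (\<lambda>hs. F (h # hs))"
  unfolding slot_linear_def
proof (intro allI impI)
  fix hs :: "'a list" and i
  assume F: "\<forall>hs i. length hs \<le> Suc n \<longrightarrow> i < length hs \<longrightarrow> linear (\<lambda>h. F (hs[i := h]))"
    and i: "length hs \<le> n" "i < length hs"
  show "linear (\<lambda>k. F (h # hs[i := k]))"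
    using F[rule_format, of "h # hs" "Suc i"] i by simp
qed

lemma slot_linear_Cons_linear: "slot_linear (Suc n) F \<Longrightarrow> length hs \<le> n \<Longrightarrow> linear (\<lambda>h. F (h # hs))"
  unfolding slot_linear_def by (force dest: spec[of _ "0 # hs"])

lemma jet_small_add: "jet_small n \<Phi> \<Longrightarrow> jet_small n \<Psi> \<Longrightarrow> jet_small n (\<lambda>h hs. \<Phi> h hs + \<Psi> h hs)"
  unfolding jet_small_def
proof (intro allI impI)
  fix e :: real
  assume *: "\<forall>e>0. \<forall>\<^sub>F h in nhds 0. jet_bound n (e * norm h) (\<Phi> h)"
    "\<forall>e>0. \<forall>\<^sub>F h in nhds 0. jet_bound n (e * norm h) (\<Psi> h)" and e: "0 < e"
  from e have "e / 2 > 0" by simp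
  with * have "\<forall>\<^sub>F h in nhds 0. jet_bound n (e / 2 * norm h) (\<Phi> h)"
    "\<forall>\<^sub>F h in nhds 0. jet_bound n (e / 2 * norm h) (\<Psi> h)" by blast+
  then show "\<forall>\<^sub>F h in nhds 0. jet_bound n (e * norm h) (\<lambda>hs. \<Phi> h hs + \<Psi> h hs)"
    by eventually_elim (drule (1) jet_bound_add, simp)
qed

lemma jet_small_minus: "jet_small n \<Phi> \<Longrightarrow> jet_small n (\<lambda>h hs. - \<Phi> h hs)"
  by (simp add: jet_small_def jet_bound_def)

lemma jet_small_eventually_eq:
  assumes "jet_small n \<Psi>" "\<forall>\<^sub>F h in nhds 0. \<Phi> h = \<Psi> h"
  shows "jet_small n \<Phi>"
  unfolding jet_small_def
proof (intro allI impI)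
  fix e :: real assume "e > 0"
  with assms(1) have "\<forall>\<^sub>F h in nhds 0. jet_bound n (e * norm h) (\<Psi> h)" by (simp add: jet_small_def)
  with assms(2) show "\<forall>\<^sub>F h in nhds 0. jet_bound n (e * norm h) (\<Phi> h)" by eventually_elim simp
qed

lemma jet_Lipschitz_add:
  "jet_Lipschitz n \<Phi> \<Longrightarrow> jet_Lipschitz n \<Psi> \<Longrightarrow> jet_Lipschitz n (\<lambda>h hs. \<Phi> h hs + \<Psi> h hs)"
  unfolding jet_Lipschitz_def
proof (elim exE)
  fix K L
  assume "\<forall>\<^sub>F h in nhds 0. jet_bound n (K * norm h) (\<Phi> h)" "\<forall>\<^sub>F h in nhds 0. jet_bound n (L * norm h) (\<Psi> h)"
  then have "\<forall>\<^sub>F h in nhds 0. jet_bound n ((K + L) * norm h) (\<lambda>hs. \<Phi> h hs + \<Psi> h hs)"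
    unfolding distrib_right by eventually_elim (rule jet_bound_add)
  then show "\<exists>K. \<forall>\<^sub>F h in nhds 0. jet_bound n (K * norm h) (\<lambda>hs. \<Phi> h hs + \<Psi> h hs)" ..
qed

lemma jet_small_Lipschitz: "jet_small n \<Phi> \<Longrightarrow> jet_Lipschitz n \<Phi>"
  unfolding jet_small_def jet_Lipschitz_def using zero_less_one by blast

lemma eventually_norm_less: "0 < e \<Longrightarrow> \<forall>\<^sub>F h in nhds (0 :: 'a::real_normed_vector). norm h < e"
  unfolding eventually_nhds_metric by (auto intro: exI[of _ e])

lemma jet_Lipschitz_bounded: "jet_Lipschitz n \<Phi> \<Longrightarrow> jet_bounded n \<Phi>"
  unfolding jet_Lipschitz_def jet_bounded_def
proof (elim exE)
  fix K assume K: "\<forall>\<^sub>F h in nhds 0. jet_bound n (K * norm h) (\<Phi> h)"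
  have "\<forall>\<^sub>F h in nhds (0::'a). norm h < 1" by (rule eventually_norm_less) simp
  with K have "\<forall>\<^sub>F h in nhds 0. jet_bound n \<bar>K\<bar> (\<Phi> h)"
  proof eventually_elim
    case (elim h)
    have "K * norm h \<le> \<bar>K\<bar> * 1" using elim(2) by (intro mult_mono) auto
    with elim(1) show ?case by (simp add: jet_bound_mono)
  qed
  then show "\<exists>K. \<forall>\<^sub>F h in nhds 0. jet_bound n K (\<Phi> h)" ..
qed

lemma jet_bounded_const: "jet_bound n K F \<Longrightarrow> jet_bounded n (\<lambda>_. F)"
  unfolding jet_bounded_def by (auto intro!: exI[of _ K])

lemma jet_bounded_add:
  "jet_bounded n \<Phi> \<Longrightarrow> jet_bounded n \<Psi> \<Longrightarrow> jet_bounded n (\<lambda>h hs. \<Phi> h hs + \<Psi> h hs)"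
  unfolding jet_bounded_def
proof (elim exE)
  fix K L
  assume "\<forall>\<^sub>F h in nhds 0. jet_bound n K (\<Phi> h)" "\<forall>\<^sub>F h in nhds 0. jet_bound n L (\<Psi> h)"
  then have "\<forall>\<^sub>F h in nhds 0. jet_bound n (K + L) (\<lambda>hs. \<Phi> h hs + \<Psi> h hs)"
    by eventually_elim (rule jet_bound_add)
  then show "\<exists>K. \<forall>\<^sub>F h in nhds 0. jet_bound n K (\<lambda>hs. \<Phi> h hs + \<Psi> h hs)" ..
qed

lemma jet_Lipschitz_Cons: "jet_bound (Suc n) K F \<Longrightarrow> jet_Lipschitz n (\<lambda>h hs. F (h # hs))"
  unfolding jet_Lipschitz_def by (auto intro!: exI[of _ K] always_eventually jet_bound_Cons)

context
  fixes S :: "'a::real_normed_vector set" and F :: "'a \<Rightarrow> 'a list \<Rightarrow> 'b::real_normed_vector" and x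
  assumes F: "smooth_jet S F" and x: "x \<in> S"
begin

lemma smooth_jet_slot_linear: "slot_linear n (F x)"
  and smooth_jet_bound: "\<exists>K. jet_bound n K (F x)"
  and smooth_jet_small: "jet_small n (\<lambda>h hs. F (x + h) hs - F x hs - F x (h # hs))"
  using F x by (auto simp: smooth_jet_def)

lemma smooth_jet_Lipschitz_Cons: "jet_Lipschitz n (\<lambda>h hs. F x (h # hs))"
  using smooth_jet_bound[of "Suc n"] jet_Lipschitz_Cons by blast

lemma smooth_jet_Lipschitz_diff: "jet_Lipschitz n (\<lambda>h hs. F (x + h) hs - F x hs)"
  using jet_Lipschitz_add[OF jet_small_Lipschitz[OF smooth_jet_small] smooth_jet_Lipschitz_Cons]
  by simp

lemma smooth_jet_bounded_const: "jet_bounded n (\<lambda>h. F x)"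
  using smooth_jet_bound jet_bounded_const by blast

lemma smooth_jet_bounded: "jet_bounded n (\<lambda>h. F (x + h))"
  using jet_bounded_add[OF jet_Lipschitz_bounded[OF smooth_jet_Lipschitz_diff] smooth_jet_bounded_const]
  by simp

end

lemma bounded_multilinear_jetD:
  assumes "\<And>n. bounded_multilinear n (D n)"
  shows "slot_linear n (\<lambda>hs. D (length hs) hs)" "\<exists>K. jet_bound n K (\<lambda>hs. D (length hs) hs)"
proof -
  show "slot_linear n (\<lambda>hs. D (length hs) hs)"
    using assms by (simp add: slot_linear_def bounded_multilinear_def)
  obtain K where K: "\<And>m hs. length hs = m \<Longrightarrow> norm (D m hs) \<le> K m * prod_list (map norm hs)"
    using assms unfolding bounded_multilinear_def by metis
  have "jet_bound n (\<Sum>m\<le>n. \<bar>K m\<bar>) (\<lambda>hs. D (length hs) hs)"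
    unfolding jet_bound_def
  proof (intro allI impI)
    fix hs :: "'a list" assume hs: "length hs \<le> n"
    have "K (length hs) \<le> \<bar>K (length hs)\<bar>" by simp
    also have "\<dots> \<le> (\<Sum>m\<le>n. \<bar>K m\<bar>)" using hs by (intro member_le_sum) auto
    finally show "norm (D (length hs) hs) \<le> (\<Sum>m\<le>n. \<bar>K m\<bar>) * prod_list (map norm hs)"
      using K[OF refl, of hs] by (meson mult_right_mono order_trans prod_list_norm_nonneg)
  qed
  then show "\<exists>K. jet_bound n K (\<lambda>hs. D (length hs) hs)" ..
qed

text \<open>
  The order of a derivative is the length of its list of directions, so the sequence of all derivatives
  becomes one function on lists. The orders up to \<open>n\<close> are finitely many, so one neighborhood of 0 serves all of them.
\<close>

theorem smooth_on_iff_smooth_jet: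
  "smooth_on S f \<longleftrightarrow> open S \<and> (\<exists>F. smooth_jet S F \<and> (\<forall>x\<in>S. F x [] = f x))"
  (is "?L \<longleftrightarrow> ?R")
proof
  assume f: ?L
  then obtain D where S: "open S" and D0: "\<And>x. x \<in> S \<Longrightarrow> D 0 x [] = f x"
    and Dm: "\<And>n x. x \<in> S \<Longrightarrow> bounded_multilinear n (D n x)"
    and Dd: "\<And>n x e. x \<in> S \<Longrightarrow> 0 < e \<Longrightarrow> \<exists>\<delta>>0. \<forall>h. norm h < \<delta> \<and> x + h \<in> S \<longrightarrow>
        (\<forall>hs. length hs = n \<longrightarrow>
          norm (D n (x + h) hs - D n x hs - D (Suc n) x (h # hs)) \<le> e * norm h * prod_list (map norm hs))"
    unfolding smooth_on_def by metis
  define F where "F = (\<lambda>x hs. D (length hs) x hs)"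
  have "smooth_jet S F"
    unfolding smooth_jet_def
  proof (intro ballI allI conjI)
    fix x n assume x: "x \<in> S"
    show "slot_linear n (F x)" "\<exists>K. jet_bound n K (F x)"
      unfolding F_def using Dm[OF x] by (rule bounded_multilinear_jetD)+
    show "jet_small n (\<lambda>h hs. F (x + h) hs - F x hs - F x (h # hs))"
      unfolding jet_small_def
    proof (intro allI impI)
      fix e :: real assume e: "e > 0"
      have "\<forall>\<^sub>F h in nhds (0 + 0). x + h \<in> S"
        using S x by (intro topological_tendstoD[where l = x]) (auto intro!: tendsto_eq_intros filterlim_ident)
      then have inS: "\<forall>\<^sub>F h in nhds 0. x + h \<in> S" by simp
      have "\<forall>\<^sub>F h in nhds 0. \<forall>m\<in>{..n}. \<forall>hs. length hs = m \<longrightarrow>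
          norm (F (x + h) hs - F x hs - F x (h # hs)) \<le> e * norm h * prod_list (map norm hs)"
      proof (rule eventually_ball_finite, simp, rule ballI)
        fix m
        obtain \<delta> where "\<delta> > 0" and \<delta>: "\<forall>h. norm h < \<delta> \<and> x + h \<in> S \<longrightarrow> (\<forall>hs. length hs = m \<longrightarrow>
          norm (D m (x + h) hs - D m x hs - D (Suc m) x (h # hs)) \<le> e * norm h * prod_list (map norm hs))"
          using Dd[OF x e] by blast
        show "\<forall>\<^sub>F h in nhds 0. \<forall>hs. length hs = m \<longrightarrow>
          norm (F (x + h) hs - F x hs - F x (h # hs)) \<le> e * norm h * prod_list (map norm hs)"
          using inS eventually_norm_less[OF \<open>\<delta> > 0\<close>]
          by eventually_elim (use \<delta> in \<open>auto simp: F_def\<close>)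
      qed
      then show "\<forall>\<^sub>F h in nhds 0. jet_bound n (e * norm h) (\<lambda>hs. F (x + h) hs - F x hs - F x (h # hs))"
        by eventually_elim (auto simp: jet_bound_def)
    qed
  qed
  with S D0 show ?R
    by (auto simp: F_def intro!: exI[of _ F])
next
  assume ?R
  then obtain F where S: "open S" and F: "smooth_jet S F" and f: "\<forall>x\<in>S. F x [] = f x"
    by blast
  show ?L
    unfolding smooth_on_def
  proof (intro conjI exI[of _ "\<lambda>n. F"] S f allI ballI impI)
    fix n x assume x: "x \<in> S"
    show "bounded_multilinear n (F x)"
      using smooth_jet_slot_linear[OF F x, of n] smooth_jet_bound[OF F x, of n]
      unfolding bounded_multilinear_def slot_linear_def jet_bound_def by auto
    fix e :: real assume "e > 0"
    then have "\<forall>\<^sub>F h in nhds 0. jet_bound n (e * norm h) (\<lambda>hs. F (x + h) hs - F x hs - F x (h # hs))"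
      using smooth_jet_small[OF F x] by (simp add: jet_small_def)
    then show "\<exists>\<delta>>0. \<forall>h. norm h < \<delta> \<and> x + h \<in> S \<longrightarrow> (\<forall>hs. length hs = n \<longrightarrow>
          norm (F (x + h) hs - F x hs - F x (h # hs)) \<le> e * norm h * prod_list (map norm hs))"
      unfolding eventually_nhds_metric jet_bound_def by (auto simp: dist_norm)
  qed
qed

lemma smooth_onI: "open S \<Longrightarrow> smooth_jet S F \<Longrightarrow> (\<And>x. x \<in> S \<Longrightarrow> F x [] = f x) \<Longrightarrow> smooth_on S f"
  by (auto simp: smooth_on_iff_smooth_jet)

lemma smooth_onD: "smooth_on S f \<Longrightarrow> \<exists>F. smooth_jet S F \<and> (\<forall>x\<in>S. F x [] = f x)"
  by (simp add: smooth_on_iff_smooth_jet)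


section \<open>Closure properties of smooth maps\<close>

lemma smooth_on_open: "smooth_on S f \<Longrightarrow> open S"
  by (simp add: smooth_on_def)

lemma smooth_on_cong: "(\<And>x. x \<in> S \<Longrightarrow> f x = g x) \<Longrightarrow> smooth_on S f \<longleftrightarrow> smooth_on S g"
  by (auto simp: smooth_on_iff_smooth_jet)

lemma smooth_on_subset: "smooth_on S f \<Longrightarrow> open T \<Longrightarrow> T \<subseteq> S \<Longrightarrow> smooth_on T f"
  unfolding smooth_on_iff_smooth_jet smooth_jet_def by blast

lemma smooth_on_add:
  assumes "smooth_on S f" "smooth_on S g"
  shows "smooth_on S (\<lambda>x. f x + g x)"
proof -
  obtain F where F: "smooth_jet S F" "\<And>x. x \<in> S \<Longrightarrow> F x [] = f x"
    using smooth_onD[OF assms(1)] by blast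
  have S: "open S" using assms(1) by (rule smooth_on_open)
  obtain G where G: "smooth_jet S G" "\<And>x. x \<in> S \<Longrightarrow> G x [] = g x"
    using smooth_onD[OF assms(2)] by blast
  show ?thesis
  proof (rule smooth_onI[OF S, where F = "\<lambda>x hs. F x hs + G x hs"])
    show "smooth_jet S (\<lambda>x hs. F x hs + G x hs)"
      unfolding smooth_jet_def
    proof (intro ballI allI conjI)
      fix x n assume x: "x \<in> S"
      show "slot_linear n (\<lambda>hs. F x hs + G x hs)"
        using smooth_jet_slot_linear[OF F(1) x, of n] smooth_jet_slot_linear[OF G(1) x, of n]
        by (auto simp: slot_linear_def intro: linear_compose_add)
      show "\<exists>K. jet_bound n K (\<lambda>hs. F x hs + G x hs)"
        using smooth_jet_bound[OF F(1) x, of n] smooth_jet_bound[OF G(1) x, of n] jet_bound_add by blast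
      show "jet_small n (\<lambda>h hs. F (x + h) hs + G (x + h) hs - (F x hs + G x hs) - (F x (h # hs) + G x (h # hs)))"
        using jet_small_add[OF smooth_jet_small[OF F(1) x, of n] smooth_jet_small[OF G(1) x, of n]]
        by (simp add: algebra_simps)
    qed
  qed (simp add: F G)
qed

lemma smooth_on_const: "open S \<Longrightarrow> smooth_on S (\<lambda>_. c)"
  by (rule smooth_onI[where F = "\<lambda>_ hs. if hs = [] then c else 0"])
    (auto simp: smooth_jet_def slot_linear_def jet_bound_def jet_small_def linear_zero
      intro!: exI[of _ "norm c"] always_eventually mult_nonneg_nonneg prod_list_norm_nonneg)

lemma smooth_on_sum:
  assumes "open S" "\<And>i. i \<in> I \<Longrightarrow> smooth_on S (f i)"
  shows "smooth_on S (\<lambda>x. \<Sum>i\<in>I. f i x)"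
  using assms by (induction I rule: infinite_finite_induct) (auto intro: smooth_on_const smooth_on_add)

lemma smooth_on_bounded_linear_compose:
  fixes f :: "'a::real_normed_vector \<Rightarrow> 'b::real_normed_vector"
  assumes T: "bounded_linear T" and f: "smooth_on S f"
  shows "smooth_on S (\<lambda>x. T (f x))"
proof -
  interpret T: bounded_linear T by fact
  obtain F where F: "smooth_jet S F" "\<And>x. x \<in> S \<Longrightarrow> F x [] = f x"
    using smooth_onD[OF f] by blast
  have S: "open S" using f by (rule smooth_on_open)
  obtain L where L: "L > 0" "\<And>y. norm (T y) \<le> norm y * L"
    using T.pos_bounded by blast
  have bnd: "jet_bound n (L * K) (\<lambda>hs. T (H hs))" if "jet_bound n K H" for n K and H :: "'a list \<Rightarrow> 'b"
    unfolding jet_bound_def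
  proof (intro allI impI)
    fix hs :: "'a list" assume "length hs \<le> n"
    then have "norm (T (H hs)) \<le> L * (K * prod_list (map norm hs))"
      using jet_boundD[OF that, of hs] L by (metis mult.commute mult_le_cancel_left_pos order_trans)
    then show "norm (T (H hs)) \<le> L * K * prod_list (map norm hs)" by (simp add: mult.assoc)
  qed
  show ?thesis
  proof (rule smooth_onI[OF S, where F = "\<lambda>x hs. T (F x hs)"])
    show "smooth_jet S (\<lambda>x hs. T (F x hs))"
      unfolding smooth_jet_def
    proof (intro ballI allI conjI)
      fix x n assume x: "x \<in> S"
      show "slot_linear n (\<lambda>hs. T (F x hs))"
        using smooth_jet_slot_linear[OF F(1) x, of n] linear_compose[OF _ T.linear]
        by (force simp: slot_linear_def o_def)
      show "\<exists>K. jet_bound n K (\<lambda>hs. T (F x hs))"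
        using smooth_jet_bound[OF F(1) x, of n] bnd by blast
      show "jet_small n (\<lambda>h hs. T (F (x + h) hs) - T (F x hs) - T (F x (h # hs)))"
        unfolding jet_small_def
      proof (intro allI impI)
        fix e :: real assume "e > 0"
        then have "e / L > 0" using L by simp
        then have "\<forall>\<^sub>F h in nhds 0. jet_bound n (e / L * norm h) (\<lambda>hs. F (x + h) hs - F x hs - F x (h # hs))"
          using smooth_jet_small[OF F(1) x, of n] unfolding jet_small_def by blast
        then show "\<forall>\<^sub>F h in nhds 0. jet_bound n (e * norm h)
            (\<lambda>hs. T (F (x + h) hs) - T (F x hs) - T (F x (h # hs)))"
        proof eventually_elim
          case (elim h)
          from bnd[OF this] show ?case using L by (simp add: T.diff)
        qed
      qed
    qed
  qed (simp add: F)
qed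

lemma smooth_on_uminus: "smooth_on S f \<Longrightarrow> smooth_on S (\<lambda>x. - f x)"
  by (rule smooth_on_bounded_linear_compose[OF bounded_linear_minus[OF bounded_linear_ident]])

lemma smooth_on_diff: "smooth_on S f \<Longrightarrow> smooth_on S g \<Longrightarrow> smooth_on S (\<lambda>x. f x - g x)"
  using smooth_on_add[OF _ smooth_on_uminus] by fastforce

lemma smooth_on_ident: "open S \<Longrightarrow> smooth_on S (\<lambda>x. x)"
proof (rule smooth_onI[where F = "\<lambda>x hs. case hs of [] \<Rightarrow> x | [h] \<Rightarrow> h | _ \<Rightarrow> 0"])
  show "smooth_jet S (\<lambda>x hs. case hs of [] \<Rightarrow> x | [h] \<Rightarrow> h | _ \<Rightarrow> 0)"
    unfolding smooth_jet_def
  proof (intro ballI allI conjI)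
    fix x :: 'a and n
    show "slot_linear n (\<lambda>hs. case hs of [] \<Rightarrow> x | [h] \<Rightarrow> h | _ \<Rightarrow> 0)"
      unfolding slot_linear_def
    proof (intro allI impI)
      fix hs :: "'a list" and i assume "i < length hs"
      then consider k where "hs = [k]" "i = 0" | k l t where "hs = k # l # t"
        by (cases hs; cases "tl hs") auto
      then show "linear (\<lambda>h. case hs[i := h] of [] \<Rightarrow> x | [h] \<Rightarrow> h | _ \<Rightarrow> 0)"
      proof cases
        case 2
        then have "length (hs[i := h]) \<ge> 2" for h by (simp only: length_list_update) simp
        then have "(case hs[i := h] of [] \<Rightarrow> x | [h] \<Rightarrow> h | _ \<Rightarrow> 0) = 0" for h
          by (metis (no_types, lifting) One_nat_def Suc_1 Suc_le_length_iff list.simps(5))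
        then show ?thesis by (simp add: linear_zero)
      qed (auto simp: linear_id[unfolded id_def])
    qed
    show "\<exists>K. jet_bound n K (\<lambda>hs. case hs of [] \<Rightarrow> x | [h] \<Rightarrow> h | _ \<Rightarrow> 0)"
      unfolding jet_bound_def
      by (rule exI[of _ "norm x + 1"])
        (auto split: list.split simp: distrib_right intro!: mult_nonneg_nonneg add_nonneg_nonneg prod_list_norm_nonneg)
    show "jet_small n (\<lambda>h hs. (case hs of [] \<Rightarrow> x + h | [h] \<Rightarrow> h | _ \<Rightarrow> 0) -
        (case hs of [] \<Rightarrow> x | [h] \<Rightarrow> h | _ \<Rightarrow> 0) - (case h # hs of [] \<Rightarrow> x | [h] \<Rightarrow> h | _ \<Rightarrow> 0))"
      unfolding jet_small_def jet_bound_def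
      by (auto split: list.split intro!: always_eventually mult_nonneg_nonneg prod_list_norm_nonneg)
  qed
qed auto

lemma smooth_on_bounded_linear: "bounded_linear T \<Longrightarrow> open S \<Longrightarrow> smooth_on S T"
  using smooth_on_bounded_linear_compose[OF _ smooth_on_ident] by blast

text \<open>
  The second derivative of a bounded linear inner map \<open>T\<close> vanishes, so the jet of the composition is
  just evaluated at the images of the directions. Each direction contributes a factor of the norm
  of \<open>T\<close>; replacing the norm by \<open>1 + L\<close> makes the resulting power monotone in the order.
\<close>

lemma smooth_on_compose_bounded_linear:
  fixes T :: "'a::real_normed_vector \<Rightarrow> 'b::real_normed_vector" and f :: "'b \<Rightarrow> 'c::real_normed_vector"
  assumes T: "bounded_linear T" and f: "smooth_on S f"
  shows "smooth_on {x. T x \<in> S} (\<lambda>x. f (T x))"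
proof -
  interpret T: bounded_linear T by fact
  obtain F where F: "smooth_jet S F" "\<And>x. x \<in> S \<Longrightarrow> F x [] = f x"
    using smooth_onD[OF f] by blast
  have S: "open S" using f by (rule smooth_on_open)
  have "open (T -` S)" using S T.continuous_on[OF continuous_on_id] by (intro open_vimage) auto
  then have S': "open {x. T x \<in> S}" by (simp add: vimage_def)
  obtain L where L: "L > 0" "\<And>y. norm (T y) \<le> norm y * L"
    using T.pos_bounded by blast
  have prods: "prod_list (map norm (map T hs)) \<le> L ^ length hs * prod_list (map norm hs)" for hs
  proof (induction hs)
    case (Cons h hs)
    have "norm (T h) * prod_list (map norm (map T hs)) \<le> (norm h * L) * (L ^ length hs * prod_list (map norm hs))"
      using Cons L by (intro mult_mono prod_list_norm_nonneg) auto
    then show ?case by (simp add: mult_ac)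
  qed simp
  have bnd: "jet_bound n ((1 + L) ^ n * K) (\<lambda>hs. H (map T hs))" if "jet_bound n K H" for n K and H :: "'b list \<Rightarrow> 'c"
    unfolding jet_bound_def
  proof (intro allI impI)
    fix hs :: "'a list" assume hs: "length hs \<le> n"
    have "L ^ length hs \<le> (1 + L) ^ length hs" using L by (intro power_mono) auto
    also have "\<dots> \<le> (1 + L) ^ n" using L hs by (intro power_increasing) auto
    finally have p: "prod_list (map norm (map T hs)) \<le> (1 + L) ^ n * prod_list (map norm hs)"
      by (intro order_trans[OF prods] mult_right_mono prod_list_norm_nonneg)
    have "norm (H (map T hs)) \<le> K * prod_list (map norm (map T hs))"
      using jet_boundD[OF that, of "map T hs"] hs by simp
    also have "\<dots> \<le> K * ((1 + L) ^ n * prod_list (map norm hs))"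
      using p jet_bound_nonneg[OF that] by (rule mult_left_mono)
    finally show "norm (H (map T hs)) \<le> (1 + L) ^ n * K * prod_list (map norm hs)" by (simp add: mult_ac)
  qed
  show ?thesis
  proof (rule smooth_onI[OF S', where F = "\<lambda>x hs. F (T x) (map T hs)"])
    show "smooth_jet {x. T x \<in> S} (\<lambda>x hs. F (T x) (map T hs))"
      unfolding smooth_jet_def
    proof (intro ballI allI conjI)
      fix x n assume "x \<in> {x. T x \<in> S}"
      then have x: "T x \<in> S" by simp
      show "slot_linear n (\<lambda>hs. F (T x) (map T hs))"
        unfolding slot_linear_def
      proof (intro allI impI)
        fix hs :: "'a list" and i assume *: "length hs \<le> n" "i < length hs"
        then have "linear (\<lambda>h. F (T x) ((map T hs)[i := h]))"
          using smooth_jet_slot_linear[OF F(1) x, of n] by (simp add: slot_linear_def)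
        from linear_compose[OF T.linear this] show "linear (\<lambda>h. F (T x) (map T (hs[i := h])))"
          by (simp add: o_def map_update)
      qed
      show "\<exists>K. jet_bound n K (\<lambda>hs. F (T x) (map T hs))"
        using smooth_jet_bound[OF F(1) x, of n] bnd by blast
      show "jet_small n (\<lambda>h hs. F (T (x + h)) (map T hs) - F (T x) (map T hs) - F (T x) (map T (h # hs)))"
        unfolding jet_small_def
      proof (intro allI impI)
        fix e :: real assume e: "e > 0"
        define e' where "e' = e / ((1 + L) ^ n * L)"
        have e': "e' > 0" "(1 + L) ^ n * (e' * L) = e" using e L by (simp_all add: e'_def add_pos_pos)
        have ev: "\<forall>\<^sub>F h in nhds 0. jet_bound n (e' * norm h) (\<lambda>hs. F (T x + h) hs - F (T x) hs - F (T x) (h # hs))"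
          using smooth_jet_small[OF F(1) x, of n] e' by (simp add: jet_small_def)
        have "filterlim T (nhds 0) (nhds 0)"
          using T.tendsto[OF tendsto_ident_at, of 0 UNIV] by (metis T.zero tendsto_at_iff_tendsto_nhds)
        from eventually_compose_filterlim[OF ev this]
        show "\<forall>\<^sub>F h in nhds 0. jet_bound n (e * norm h)
            (\<lambda>hs. F (T (x + h)) (map T hs) - F (T x) (map T hs) - F (T x) (map T (h # hs)))"
        proof eventually_elim
          case (elim h)
          have "e' * norm (T h) \<le> e' * (norm h * L)"
            by (rule mult_left_mono[OF L(2) less_imp_le[OF e'(1)]])
          then have "(1 + L) ^ n * (e' * norm (T h)) \<le> (1 + L) ^ n * (e' * (norm h * L))"
            by (rule mult_left_mono) (use L in simp)
          also have "\<dots> = ((1 + L) ^ n * (e' * L)) * norm h" by (simp only: mult_ac)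
          also have "\<dots> = e * norm h" by (simp only: e')
          finally show ?case
            using jet_bound_mono[OF bnd[OF elim] _ order_refl] by (simp add: T.add)
        qed
      qed
    qed
  qed (simp add: F)
qed

section \<open>Products and inverses of smooth maps\<close>

text \<open>
  The Leibniz rule of arbitrary order: the product rule for the first direction of the list, applied
  recursively. Expanded, it is the sum over all ways of distributing the list of directions
  to the two factors.
\<close>

primrec jet_mult ::
    "('b \<Rightarrow> 'c \<Rightarrow> 'd::real_vector) \<Rightarrow> 'a list \<Rightarrow> ('a list \<Rightarrow> 'b) \<Rightarrow> ('a list \<Rightarrow> 'c) \<Rightarrow> 'd"
  where
    "jet_mult B [] F G = B (F []) (G [])"
  | "jet_mult B (h # hs) F G =
      jet_mult B hs (\<lambda>as. F (h # as)) G + jet_mult B hs F (\<lambda>bs. G (h # bs))"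

lemma jet_mult_cong:
  assumes "\<And>as. length as \<le> length hs \<Longrightarrow> F as = F' as" "\<And>as. length as \<le> length hs \<Longrightarrow> G as = G' as"
  shows "jet_mult B hs F G = jet_mult B hs F' G'"
  using assms
proof (induction hs arbitrary: F F' G G')
  case (Cons h hs)
  have "jet_mult B hs (\<lambda>as. F (h # as)) G = jet_mult B hs (\<lambda>as. F' (h # as)) G'"
    "jet_mult B hs F (\<lambda>as. G (h # as)) = jet_mult B hs F' (\<lambda>as. G' (h # as))"
    using Cons.prems by (intro Cons.IH; simp)+
  then show ?case by simp
qed simp

context bounded_bilinear
begin

abbreviation star where "star F G hs \<equiv> jet_mult prod hs F G"

lemma star_add_left: "star (\<lambda>as. F as + F' as) G hs = star F G hs + star F' G hs"
  by (induction hs arbitrary: F F' G) (simp_all add: add_left)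

lemma star_add_right: "star F (\<lambda>as. G as + G' as) hs = star F G hs + star F G' hs"
  by (induction hs arbitrary: F G G') (simp_all add: add_right)

lemma star_minus_left: "star (\<lambda>as. - F as) G hs = - star F G hs"
  by (induction hs arbitrary: F G) (simp_all add: minus_left)

lemma star_minus_right: "star F (\<lambda>as. - G as) hs = - star F G hs"
  by (induction hs arbitrary: F G) (simp_all add: minus_right)

lemma star_diff_left: "star (\<lambda>as. F as - F' as) G hs = star F G hs - star F' G hs"
  using star_add_left[where F' = "\<lambda>as. - F' as"] by (simp add: star_minus_left)

lemma star_diff_right: "star F (\<lambda>as. G as - G' as) hs = star F G hs - star F G' hs"
  using star_add_right[where G' = "\<lambda>as. - G' as"] by (simp add: star_minus_right)

lemma star_scale_left: "star (\<lambda>as. c *\<^sub>R F as) G hs = c *\<^sub>R star F G hs"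
  by (induction hs arbitrary: F G) (simp_all add: scaleR_left algebra_simps)

lemma star_scale_right: "star F (\<lambda>as. c *\<^sub>R G as) hs = c *\<^sub>R star F G hs"
  by (induction hs arbitrary: F G) (simp_all add: scaleR_right algebra_simps)

lemma linear_star_left:
  assumes "\<And>as. length as \<le> length hs \<Longrightarrow> linear (\<lambda>k. F k as)"
  shows "linear (\<lambda>k. star (F k) G hs)"
proof (rule linearI)
  fix k l and c :: real
  have "star (F (k + l)) G hs = star (\<lambda>as. F k as + F l as) G hs"
    by (intro jet_mult_cong linear_add[OF assms]) auto
  then show "star (F (k + l)) G hs = star (F k) G hs + star (F l) G hs"
    by (simp add: star_add_left)
  have "star (F (c *\<^sub>R k)) G hs = star (\<lambda>as. c *\<^sub>R F k as) G hs"
    by (intro jet_mult_cong linear_cmul[OF assms]) auto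
  then show "star (F (c *\<^sub>R k)) G hs = c *\<^sub>R star (F k) G hs"
    by (simp add: star_scale_left)
qed

lemma linear_star_right:
  assumes "\<And>as. length as \<le> length hs \<Longrightarrow> linear (\<lambda>k. G k as)"
  shows "linear (\<lambda>k. star F (G k) hs)"
proof (rule linearI)
  fix k l and c :: real
  have "star F (G (k + l)) hs = star F (\<lambda>as. G k as + G l as) hs"
    by (intro jet_mult_cong linear_add[OF assms]) auto
  then show "star F (G (k + l)) hs = star F (G k) hs + star F (G l) hs"
    by (simp add: star_add_right)
  have "star F (G (c *\<^sub>R k)) hs = star F (\<lambda>as. c *\<^sub>R G k as) hs"
    by (intro jet_mult_cong linear_cmul[OF assms]) auto
  then show "star F (G (c *\<^sub>R k)) hs = c *\<^sub>R star F (G k) hs"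
    by (simp add: star_scale_right)
qed

text \<open>
  In the first slot, linearity is that of the two jets in the prepended direction; the
  other slots are covered by induction, since prepending a direction preserves slot linearity.
\<close>

lemma slot_linear_star:
  fixes F :: "'d::real_vector list \<Rightarrow> 'a" and G :: "'d list \<Rightarrow> 'b"
  assumes "slot_linear n F" "slot_linear n G"
  shows "slot_linear n (star F G)"
proof -
  have "linear (\<lambda>k. star F G (hs[i := k]))"
    if "slot_linear n F" "slot_linear n G" "length hs \<le> n" "i < length hs"
    for n i and F :: "'d list \<Rightarrow> 'a" and G :: "'d list \<Rightarrow> 'b" and hs
    using that
  proof (induction hs arbitrary: n i F G)
    case (Cons h hs)
    obtain m where n: "n = Suc m" and m: "length hs \<le> m" using Cons.prems by (cases n) auto
    note FG = Cons.prems(1,2)[unfolded n]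
    show ?case
    proof (cases i)
      case 0
      have "linear (\<lambda>k. star (\<lambda>as. F (k # as)) G hs)" "linear (\<lambda>k. star F (\<lambda>as. G (k # as)) hs)"
        using m FG by (auto intro!: linear_star_left linear_star_right slot_linear_Cons_linear)
      from linear_compose_add[OF this] 0 show ?thesis by simp
    next
      case (Suc j)
      have j: "j < length hs" using Suc Cons.prems by simp
      have "slot_linear m F" "slot_linear m G" using FG by (auto intro: slot_linear_mono)
      with m j have "linear (\<lambda>k. star (\<lambda>as. F (h # as)) G (hs[j := k]))"
        "linear (\<lambda>k. star F (\<lambda>as. G (h # as)) (hs[j := k]))"
        using FG by (auto intro!: Cons.IH[of m] intro: slot_linear_Cons)
      from linear_compose_add[OF this] Suc show ?thesis by simp
    qed
  qed simp
  with assms show ?thesis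
    by (simp add: slot_linear_def[of n "star F G"])
qed

text \<open>
  Each of the at most \<open>n\<close> directions goes to one of the two factors, which gives at most \<open>2 ^ n\<close> terms.
\<close>

lemma jet_bound_star:
  "\<exists>C\<ge>0. \<forall>(F :: 'd::real_normed_vector list \<Rightarrow> 'a) (G :: 'd list \<Rightarrow> 'b) K L. jet_bound n K F \<longrightarrow> jet_bound n L G \<longrightarrow> jet_bound n (C * K * L) (star F G)"
proof -
  obtain B where B: "0 < B" "\<And>a b. norm (prod a b) \<le> norm a * norm b * B"
    using pos_bounded by blast
  have *: "norm (star F G hs) \<le> B * 2 ^ length hs * K * L * prod_list (map norm hs)"
    if "jet_bound n K F" "jet_bound n L G" "length hs \<le> n"
    for n K L and F :: "'d list \<Rightarrow> 'a" and G :: "'d list \<Rightarrow> 'b" and hs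
    using that
  proof (induction hs arbitrary: n F G K L)
    case Nil
    have "norm (F []) \<le> K" "norm (G []) \<le> L" using Nil by (auto dest: jet_boundD[of _ _ _ "[]"])
    then have "norm (F []) * norm (G []) * B \<le> K * L * B"
      using B jet_bound_nonneg[OF Nil(1)] by (intro mult_right_mono mult_mono) auto
    with B(2)[of "F []" "G []"] show ?case by (simp add: mult_ac)
  next
    case (Cons h hs)
    obtain m where n: "n = Suc m" and m: "length hs \<le> m" using Cons.prems by (cases n) auto
    note F = Cons.prems(1)[unfolded n] and G = Cons.prems(2)[unfolded n]
    have "norm (star (\<lambda>as. F (h # as)) G hs) \<le>
        B * 2 ^ length hs * (K * norm h) * L * prod_list (map norm hs)"
      "norm (star F (\<lambda>as. G (h # as)) hs) \<le>
        B * 2 ^ length hs * K * (L * norm h) * prod_list (map norm hs)"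
      by (intro Cons.IH[of m] jet_bound_Cons jet_bound_mono[OF F] jet_bound_mono[OF G] F G m; simp)+
    from norm_triangle_mono[OF this] show ?case by (simp add: mult_ac)
  qed
  have "jet_bound n (B * 2 ^ n * K * L) (star F G)" if F: "jet_bound n K F" and G: "jet_bound n L G"
    for K L and F :: "'d list \<Rightarrow> 'a" and G :: "'d list \<Rightarrow> 'b"
    unfolding jet_bound_def
  proof (intro allI impI)
    fix hs :: "'d list" assume hs: "length hs \<le> n"
    have "B * 2 ^ length hs * K * L \<le> B * 2 ^ n * K * L"
      using jet_bound_nonneg[OF F] jet_bound_nonneg[OF G] B hs
      by (intro mult_right_mono mult_left_mono power_increasing) auto
    with *[OF F G hs] show "norm (star F G hs) \<le> B * 2 ^ n * K * L * prod_list (map norm hs)"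
      by (meson mult_right_mono order_trans prod_list_norm_nonneg)
  qed
  then show ?thesis using B(1) by (intro exI[of _ "B * 2 ^ n"]) auto
qed

lemma jet_small_star_bounded:
  fixes \<Phi> :: "'d::real_normed_vector \<Rightarrow> 'd list \<Rightarrow> 'a" and \<Psi> :: "'d \<Rightarrow> 'd list \<Rightarrow> 'b"
  assumes "jet_small n \<Phi>" "jet_bounded n \<Psi>"
  shows "jet_small n (\<lambda>h. star (\<Phi> h) (\<Psi> h))"
  unfolding jet_small_def
proof (intro allI impI)
  fix e :: real assume e: "e > 0"
  obtain C where C: "C \<ge> 0" and
    CB: "\<And>(F :: 'd list \<Rightarrow> 'a) (G :: 'd list \<Rightarrow> 'b) K L. jet_bound n K F \<Longrightarrow> jet_bound n L G \<Longrightarrow> jet_bound n (C * K * L) (star F G)"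
    using jet_bound_star by blast
  obtain L where L: "\<forall>\<^sub>F h in nhds 0. jet_bound n L (\<Psi> h)" using assms(2) by (auto simp: jet_bounded_def)
  define D where "D = 1 + C * \<bar>L\<bar>"
  have D: "D > 0" "C * L \<le> D"
    using C mult_left_mono[OF abs_ge_self C, of L] by (simp_all add: D_def add_pos_nonneg)
  then have "e / D > 0" using e by simp
  then have "\<forall>\<^sub>F h in nhds 0. jet_bound n (e / D * norm h) (\<Phi> h)"
    using assms(1) unfolding jet_small_def by blast
  with L show "\<forall>\<^sub>F h in nhds 0. jet_bound n (e * norm h) (star (\<Phi> h) (\<Psi> h))"
  proof eventually_elim
    case (elim h)
    have "C * (e / D * norm h) * L = (C * L) * (e / D * norm h)" by (simp only: mult_ac)
    also have "\<dots> \<le> D * (e / D * norm h)" using D e by (intro mult_right_mono) auto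
    also have "\<dots> = e * norm h" using D by simp
    finally show ?case using jet_bound_mono[OF CB[OF elim(2,1)] _ order_refl] by simp
  qed
qed

lemma jet_small_bounded_star:
  fixes \<Phi> :: "'d::real_normed_vector \<Rightarrow> 'd list \<Rightarrow> 'a" and \<Psi> :: "'d \<Rightarrow> 'd list \<Rightarrow> 'b"
  assumes "jet_bounded n \<Phi>" "jet_small n \<Psi>"
  shows "jet_small n (\<lambda>h. star (\<Phi> h) (\<Psi> h))"
proof -
  interpret flip: bounded_bilinear "\<lambda>y x. prod x y" by (rule flip)
  have "jet_mult (\<lambda>y x. prod x y) hs G F = star F G hs" for hs and F :: "'d list \<Rightarrow> 'a" and G
    by (induction hs arbitrary: F G) (simp_all add: add.commute)
  with flip.jet_small_star_bounded[OF assms(2,1)] show ?thesis by simp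
qed


lemma jet_Lipschitz_bounded_star:
  fixes \<Phi> :: "'d::real_normed_vector \<Rightarrow> 'd list \<Rightarrow> 'a" and \<Psi> :: "'d \<Rightarrow> 'd list \<Rightarrow> 'b"
  assumes "jet_bounded n \<Phi>" "jet_Lipschitz n \<Psi>"
  shows "jet_Lipschitz n (\<lambda>h. star (\<Phi> h) (\<Psi> h))"
proof -
  obtain C where
    CB: "\<And>(F :: 'd list \<Rightarrow> 'a) (G :: 'd list \<Rightarrow> 'b) K L. jet_bound n K F \<Longrightarrow> jet_bound n L G \<Longrightarrow> jet_bound n (C * K * L) (star F G)"
    using jet_bound_star by blast
  obtain K L where "\<forall>\<^sub>F h in nhds 0. jet_bound n K (\<Phi> h)" "\<forall>\<^sub>F h in nhds 0. jet_bound n (L * norm h) (\<Psi> h)"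
    using assms by (auto simp: jet_bounded_def jet_Lipschitz_def)
  then have "\<forall>\<^sub>F h in nhds 0. jet_bound n (C * K * L * norm h) (star (\<Phi> h) (\<Psi> h))"
  proof eventually_elim
    case (elim h)
    from CB[OF this] show ?case by (simp add: mult.assoc)
  qed
  then show ?thesis unfolding jet_Lipschitz_def ..
qed

lemma jet_small_Lipschitz_star:
  fixes \<Phi> :: "'d::real_normed_vector \<Rightarrow> 'd list \<Rightarrow> 'a" and \<Psi> :: "'d \<Rightarrow> 'd list \<Rightarrow> 'b"
  assumes "jet_Lipschitz n \<Phi>" "jet_Lipschitz n \<Psi>"
  shows "jet_small n (\<lambda>h. star (\<Phi> h) (\<Psi> h))"
  unfolding jet_small_def
proof (intro allI impI)
  fix e :: real assume e: "e > 0"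
  obtain C where C: "C \<ge> 0" and
    CB: "\<And>(F :: 'd list \<Rightarrow> 'a) (G :: 'd list \<Rightarrow> 'b) K L. jet_bound n K F \<Longrightarrow> jet_bound n L G \<Longrightarrow> jet_bound n (C * K * L) (star F G)"
    using jet_bound_star by blast
  obtain K L where K: "\<forall>\<^sub>F h in nhds 0. jet_bound n (K * norm h) (\<Phi> h)"
    and L: "\<forall>\<^sub>F h in nhds 0. jet_bound n (L * norm h) (\<Psi> h)"
    using assms by (auto simp: jet_Lipschitz_def)
  define D where "D = 1 + \<bar>C * K * L\<bar>"
  have D: "D > 0" "C * K * L \<le> D" unfolding D_def by linarith+
  have "e / D > 0" using e D by simp
  note eventually_norm_less[OF this]
  with K L show "\<forall>\<^sub>F h in nhds 0. jet_bound n (e * norm h) (star (\<Phi> h) (\<Psi> h))"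
  proof eventually_elim
    case (elim h)
    have "C * (K * norm h) * (L * norm h) = (C * K * L) * (norm h * norm h)" by (simp only: mult_ac)
    also have "\<dots> \<le> D * (norm h * norm h)" using D by (intro mult_right_mono) auto
    also have "\<dots> \<le> D * (e / D * norm h)" using D elim(3) by (intro mult_left_mono mult_right_mono) auto
    also have "\<dots> = e * norm h" using D by simp
    finally show ?case using jet_bound_mono[OF CB[OF elim(1,2)] _ order_refl] by simp
  qed
qed

text \<open>
  The remainder of a product of jets is a sum of three products: the remainder of one factor
  times a bounded jet (twice), and a product of two jets of size \<open>O(h)\<close>.
\<close>

theorem smooth_on_prod:
  fixes f :: "'d::real_normed_vector \<Rightarrow> 'a" and g :: "'d \<Rightarrow> 'b"
  assumes f: "smooth_on S f" and g: "smooth_on S g"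
  shows "smooth_on S (\<lambda>x. prod (f x) (g x))"
proof -
  obtain F where F: "smooth_jet S F" "\<And>x. x \<in> S \<Longrightarrow> F x [] = f x" using smooth_onD[OF f] by blast
  obtain G where G: "smooth_jet S G" "\<And>x. x \<in> S \<Longrightarrow> G x [] = g x" using smooth_onD[OF g] by blast
  show ?thesis
  proof (rule smooth_onI[OF smooth_on_open[OF f], where F = "\<lambda>x. star (F x) (G x)"])
    show "smooth_jet S (\<lambda>x. star (F x) (G x))"
      unfolding smooth_jet_def
    proof (intro ballI allI conjI)
      fix x n assume x: "x \<in> S"
      note Fx = F(1) x and Gx = G(1) x
      show "slot_linear n (star (F x) (G x))"
        by (intro slot_linear_star smooth_jet_slot_linear[OF Fx] smooth_jet_slot_linear[OF Gx])
      show "\<exists>K. jet_bound n K (star (F x) (G x))"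
        using smooth_jet_bound[OF Fx, of n] smooth_jet_bound[OF Gx, of n] jet_bound_star[of n] by blast
      have "jet_small n (\<lambda>h hs.
          star (\<lambda>as. F (x + h) as - F x as - F x (h # as)) (G (x + h)) hs +
          star (\<lambda>as. F x (h # as)) (\<lambda>as. G (x + h) as - G x as) hs +
          star (F x) (\<lambda>as. G (x + h) as - G x as - G x (h # as)) hs)"
        by (intro jet_small_add jet_small_star_bounded jet_small_bounded_star jet_small_Lipschitz_star
            smooth_jet_small[OF Fx] smooth_jet_small[OF Gx] smooth_jet_bounded[OF Gx]
            smooth_jet_bounded_const[OF Fx] smooth_jet_Lipschitz_Cons[OF Fx] smooth_jet_Lipschitz_diff[OF Gx])
      also have "(\<lambda>h hs.
          star (\<lambda>as. F (x + h) as - F x as - F x (h # as)) (G (x + h)) hs +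
          star (\<lambda>as. F x (h # as)) (\<lambda>as. G (x + h) as - G x as) hs +
          star (F x) (\<lambda>as. G (x + h) as - G x as - G x (h # as)) hs) =
        (\<lambda>h hs. star (F (x + h)) (G (x + h)) hs - star (F x) (G x) hs - star (F x) (G x) (h # hs))"
        by (simp add: fun_eq_iff star_diff_left star_diff_right)
      finally show "jet_small n (\<lambda>h hs. star (F (x + h)) (G (x + h)) hs - star (F x) (G x) hs
          - star (F x) (G x) (h # hs))"
        .
    qed
  qed (simp add: F G)
qed

end

text \<open>
  An associative bounded bilinear product with unit on a normed space. This is not stated through the type class of
  normed algebras, because the instance of interest is the multiplication of square matrices.
\<close>

locale unital_product = bounded_bilinear prod
  for prod :: "'b::real_normed_vector \<Rightarrow> 'b \<Rightarrow> 'b" +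
  fixes one :: 'b
  assumes assoc: "prod (prod a b) c = prod a (prod b c)"
    and one_left: "prod one a = a"
    and one_right: "prod a one = a"
begin

definition unit_jet :: "'a list \<Rightarrow> 'b" where "unit_jet hs = (if hs = [] then one else 0)"

lemma star_assoc: "star (star F G) H hs = star F (star G H) hs"
  by (induction hs arbitrary: F G H) (simp_all add: assoc star_add_left star_add_right add.assoc)

lemma star_zero_left: "star (\<lambda>_. 0) G hs = 0"
  by (induction hs arbitrary: G) (simp_all add: zero_left)

lemma star_zero_right: "star F (\<lambda>_. 0) hs = 0"
  by (induction hs arbitrary: F) (simp_all add: zero_right)

lemma star_unit_left: "star unit_jet G hs = G hs"
  by (induction hs arbitrary: G) (simp_all add: unit_jet_def one_left star_zero_left)

lemma star_unit_right: "star F unit_jet hs = F hs"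
  by (induction hs arbitrary: F) (simp_all add: unit_jet_def one_right star_zero_right)

text \<open>
  The inverse of \<open>F\<close> in the algebra of jets has to satisfy \<open>R' = - R F' R\<close> for the derivative in the
  first direction, which determines it recursively in the length of the list. The right-hand
  side uses \<open>R\<close> as a function on all shorter lists, so the recursion is carried out on a bound for the length.
\<close>

primrec inverse_jet_upto :: "nat \<Rightarrow> ('a list \<Rightarrow> 'b) \<Rightarrow> 'b \<Rightarrow> 'a list \<Rightarrow> 'b"
  where
    "inverse_jet_upto 0 F r hs = r"
  | "inverse_jet_upto (Suc n) F r hs = (case hs of [] \<Rightarrow> r | h # t \<Rightarrow>
      - star (inverse_jet_upto n F r) (star (\<lambda>as. F (h # as)) (inverse_jet_upto n F r)) t)"

definition inverse_jet :: "('a list \<Rightarrow> 'b) \<Rightarrow> 'b \<Rightarrow> 'a list \<Rightarrow> 'b"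
  where "inverse_jet F r hs = inverse_jet_upto (length hs) F r hs"

lemma inverse_jet_upto_eq: "length hs \<le> n \<Longrightarrow> inverse_jet_upto n F r hs = inverse_jet F r hs"
proof (induction n arbitrary: hs rule: less_induct)
  case (less n)
  show ?case
  proof (cases hs)
    case Nil
    then show ?thesis by (cases n) (simp_all add: inverse_jet_def)
  next
    case (Cons h t)
    then obtain m where n: "n = Suc m" and m: "length t \<le> m" using less.prems by (cases n) auto
    have "inverse_jet_upto m F r as = inverse_jet_upto (length t) F r as" if "length as \<le> length t" for as
      using less.IH[of m as] less.IH[of "length t" as] n m that by simp
    then have "star (inverse_jet_upto m F r) (star (\<lambda>as. F (h # as)) (inverse_jet_upto m F r)) t =
       star (inverse_jet_upto (length t) F r) (star (\<lambda>as. F (h # as)) (inverse_jet_upto (length t) F r)) t"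
      by (intro jet_mult_cong) auto
    then show ?thesis by (simp add: n Cons inverse_jet_def)
  qed
qed

lemma inverse_jet_Nil: "inverse_jet F r [] = r"
  by (simp add: inverse_jet_def)

lemma inverse_jet_Cons:
  "inverse_jet F r (h # hs) = - star (inverse_jet F r) (star (\<lambda>as. F (h # as)) (inverse_jet F r)) hs"
proof -
  have "star (inverse_jet_upto (length hs) F r) (star (\<lambda>as. F (h # as)) (inverse_jet_upto (length hs) F r)) hs
     = star (inverse_jet F r) (star (\<lambda>as. F (h # as)) (inverse_jet F r)) hs"
    by (intro jet_mult_cong) (auto simp: inverse_jet_upto_eq)
  then show ?thesis by (simp add: inverse_jet_def)
qed

text \<open>
  By the Leibniz rule, the derivative of \<open>F R\<close> in the direction \<open>h\<close> is \<open>F' R - (F R) F' R\<close>, which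
  vanishes if \<open>F R\<close> is already known to be the unit on shorter lists.
\<close>

lemma star_inverse_jet_right:
  assumes "prod (F []) r = one"
  shows "star F (inverse_jet F r) hs = unit_jet hs"
proof (induction hs rule: length_induct)
  case (1 hs)
  let ?R = "inverse_jet F r"
  show ?case
  proof (cases hs)
    case Nil
    then show ?thesis using assms by (simp add: inverse_jet_Nil unit_jet_def)
  next
    case (Cons h t)
    let ?F' = "\<lambda>as. F (h # as)"
    have "star F (\<lambda>bs. ?R (h # bs)) t = - star F (star ?R (star ?F' ?R)) t"
      by (simp add: inverse_jet_Cons star_minus_right)
    also have "star F (star ?R (star ?F' ?R)) t = star (star F ?R) (star ?F' ?R) t"
      by (simp add: star_assoc)
    also have "\<dots> = star unit_jet (star ?F' ?R) t"
      using 1 Cons by (intro jet_mult_cong) auto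
    finally show ?thesis by (simp add: Cons star_unit_left) (simp add: unit_jet_def)
  qed
qed

lemma star_inverse_jet_left:
  assumes "prod r (F []) = one"
  shows "star (inverse_jet F r) F hs = unit_jet hs"
proof (induction hs rule: length_induct)
  case (1 hs)
  let ?R = "inverse_jet F r"
  show ?case
  proof (cases hs)
    case Nil
    then show ?thesis using assms by (simp add: inverse_jet_Nil unit_jet_def)
  next
    case (Cons h t)
    let ?F' = "\<lambda>as. F (h # as)"
    have "star (\<lambda>bs. ?R (h # bs)) F t = - star (star ?R (star ?F' ?R)) F t"
      by (simp add: inverse_jet_Cons star_minus_left)
    also have "star (star ?R (star ?F' ?R)) F t = star (star ?R ?F') (star ?R F) t"
      by (simp add: star_assoc)
    also have "\<dots> = star (star ?R ?F') unit_jet t"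
      using 1 Cons by (intro jet_mult_cong) auto
    finally show ?thesis by (simp add: Cons star_unit_right) (simp add: unit_jet_def)
  qed
qed

lemma slot_linear_inverse_jet:
  fixes F :: "'a::real_vector list \<Rightarrow> 'b"
  assumes F: "\<And>n. slot_linear n F"
  shows "slot_linear n (inverse_jet F r)"
proof (induction n)
  case (Suc n)
  let ?R = "inverse_jet F r"
  show ?case
    unfolding slot_linear_def
  proof (intro allI impI)
    fix hs :: "'a list" and i assume "length hs \<le> Suc n" and i: "i < length hs"
    then obtain h t where hs: "hs = h # t" and t: "length t \<le> n" by (cases hs) auto
    show "linear (\<lambda>k. ?R (hs[i := k]))"
    proof (cases i)
      case 0
      have "linear (\<lambda>k. star ?R (star (\<lambda>as. F (k # as)) ?R) t)"
        by (intro linear_star_right linear_star_left slot_linear_Cons_linear[OF F]) (rule order_refl)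
      then show ?thesis by (simp add: 0 hs inverse_jet_Cons linear_compose_neg)
    next
      case (Suc j)
      have "slot_linear n (star ?R (star (\<lambda>as. F (h # as)) ?R))"
        by (intro slot_linear_star Suc.IH slot_linear_Cons F)
      then have "linear (\<lambda>k. star ?R (star (\<lambda>as. F (h # as)) ?R) (t[j := k]))"
        using t i hs Suc by (auto simp: slot_linear_def)
      then show ?thesis by (simp add: Suc hs inverse_jet_Cons linear_compose_neg)
    qed
  qed
qed (simp add: slot_linear_def)

lemma jet_bound_inverse_jet_Suc:
  fixes F :: "'a::real_normed_vector list \<Rightarrow> 'b"
  assumes C: "C \<ge> 0"
    "\<And>(F :: 'a list \<Rightarrow> 'b) (G :: 'a list \<Rightarrow> 'b) K L.
      jet_bound n K F \<Longrightarrow> jet_bound n L G \<Longrightarrow> jet_bound n (C * K * L) (star F G)"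
    and F: "jet_bound (Suc n) K F" and R: "jet_bound n L (inverse_jet F r)"
  shows "jet_bound (Suc n) (L + C * L * (C * K * L)) (inverse_jet F r)"
  unfolding jet_bound_def
proof (intro allI impI)
  fix hs :: "'a list" assume hs: "length hs \<le> Suc n"
  have KL: "0 \<le> K" "0 \<le> L" using F R by (auto dest: jet_bound_nonneg)
  show "norm (inverse_jet F r hs) \<le> (L + C * L * (C * K * L)) * prod_list (map norm hs)"
  proof (cases hs)
    case Nil
    have "norm (inverse_jet F r []) \<le> L" using jet_boundD[OF R, of "[]"] by simp
    moreover have "0 \<le> C * L * (C * K * L)" using C(1) KL by simp
    ultimately show ?thesis by (simp add: Nil)
  next
    case (Cons h t)
    have "norm (inverse_jet F r hs) \<le> C * L * (C * (K * norm h) * L) * prod_list (map norm t)"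
      unfolding Cons inverse_jet_Cons norm_minus_cancel
      by (rule jet_boundD[OF C(2)[OF R C(2)[OF jet_bound_Cons[OF F] R]]]) (use hs Cons in simp)
    also have "\<dots> = C * L * (C * K * L) * prod_list (map norm hs)"
      by (simp add: Cons mult_ac)
    also have "\<dots> \<le> (L + C * L * (C * K * L)) * prod_list (map norm hs)"
      by (intro mult_right_mono prod_list_norm_nonneg) (use KL in simp)
    finally show ?thesis .
  qed
qed

text \<open>
  A bound for the inverse jet up to some order yields one for the next order, by the recursion. The constants
  depend only on bounds for \<open>F\<close> and for the inverse itself, and thus are uniform in the increment.
\<close>

lemma jet_bounded_inverse_jet:
  fixes \<Phi> :: "'a::real_normed_vector \<Rightarrow> 'a list \<Rightarrow> 'b"
  assumes r: "\<forall>\<^sub>F h in nhds 0. norm (r h) \<le> K0" and F: "\<And>n. jet_bounded n \<Phi>"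
  shows "jet_bounded n (\<lambda>h. inverse_jet (\<Phi> h) (r h))"
proof (induction n)
  case 0
  have "\<forall>\<^sub>F h in nhds 0. jet_bound 0 K0 (inverse_jet (\<Phi> h) (r h))"
    using r by eventually_elim (simp add: jet_bound_def inverse_jet_Nil)
  then show ?case by (auto simp: jet_bounded_def)
next
  case (Suc n)
  obtain C where C: "C \<ge> 0"
    "\<And>(F :: 'a list \<Rightarrow> 'b) (G :: 'a list \<Rightarrow> 'b) K L.
      jet_bound n K F \<Longrightarrow> jet_bound n L G \<Longrightarrow> jet_bound n (C * K * L) (star F G)"
    using jet_bound_star by blast
  obtain K L where "\<forall>\<^sub>F h in nhds 0. jet_bound (Suc n) K (\<Phi> h)"
    "\<forall>\<^sub>F h in nhds 0. jet_bound n L (inverse_jet (\<Phi> h) (r h))"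
    using Suc.IH F[of "Suc n"] by (auto simp: jet_bounded_def)
  then have "\<forall>\<^sub>F h in nhds 0. jet_bound (Suc n) (L + C * L * (C * K * L)) (inverse_jet (\<Phi> h) (r h))"
    by eventually_elim (rule jet_bound_inverse_jet_Suc[OF C])
  then show ?case unfolding jet_bounded_def ..
qed

text \<open>
  With \<open>F\<close> and \<open>R\<close> at the point \<open>x\<close> and \<open>F\<^sub>h\<close> and \<open>R\<^sub>h\<close> at \<open>x + h\<close>, the identity
  \<open>R\<^sub>h - R = - R\<^sub>h (F\<^sub>h - F) R\<close> of the algebra of jets gives, with the derivative \<open>- R F' R\<close> of \<open>R\<close>, the remainder
  \<open>- R\<^sub>h (F\<^sub>h - F - F') R + R\<^sub>h (F\<^sub>h - F) R F' R\<close>. Its first term contains the remainder of \<open>F\<close>, its second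
  one two factors of size \<open>O(h)\<close>. The same identity for the values bounds \<open>R\<^sub>h\<close> locally.
\<close>

theorem smooth_on_inverse:
  fixes f :: "'a::real_normed_vector \<Rightarrow> 'b"
  assumes f: "smooth_on S f"
    and g: "\<And>x. x \<in> S \<Longrightarrow> prod (f x) (g x) = one" "\<And>x. x \<in> S \<Longrightarrow> prod (g x) (f x) = one"
  shows "smooth_on S g"
proof -
  obtain F where F: "smooth_jet S F" "\<And>x. x \<in> S \<Longrightarrow> F x [] = f x" using smooth_onD[OF f] by blast
  have S: "open S" using f by (rule smooth_on_open)
  define R where "R x = inverse_jet (F x) (g x)" for x
  have FR: "star (F x) (R x) = unit_jet" and RF: "star (R x) (F x) = unit_jet" if "x \<in> S" for x
    unfolding R_def using g[OF that] F(2)[OF that]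
    by (auto simp: fun_eq_iff star_inverse_jet_left star_inverse_jet_right)
  show ?thesis
  proof (rule smooth_onI[OF S, where F = R])
    show "smooth_jet S R"
      unfolding smooth_jet_def
    proof (intro ballI allI conjI)
      fix x n assume x: "x \<in> S"
      note Fx = F(1) x
      show "slot_linear n (R x)"
        unfolding R_def by (intro slot_linear_inverse_jet smooth_jet_slot_linear[OF Fx])
      have "\<forall>\<^sub>F h in nhds (0 + 0). x + h \<in> S"
        using S x by (intro topological_tendstoD[where l = x]) (auto intro!: tendsto_eq_intros filterlim_ident)
      then have inS: "\<forall>\<^sub>F h in nhds 0. x + h \<in> S" by simp
      obtain B where B: "0 < B" "\<And>a b. norm (prod a b) \<le> norm a * norm b * B"
        using pos_bounded by blast
      obtain K where K: "\<forall>\<^sub>F h in nhds 0. jet_bound 0 (K * norm h) (\<lambda>hs. F (x + h) hs - F x hs)"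
        using smooth_jet_Lipschitz_diff[OF Fx, of 0] by (auto simp: jet_Lipschitz_def)
      \<comment> \<open>With this radius, the correction term has at most half the norm of the inverse at the shifted point.\<close>
      define D where "D = 1 + 2 * B * B * \<bar>K\<bar> * norm (g x)"
      have D: "D > 0" using B by (simp add: D_def add_pos_nonneg)
      then have "1 / D > 0" by simp
      from inS K eventually_norm_less[OF this]
      have g_bound: "\<forall>\<^sub>F h in nhds 0. norm (g (x + h)) \<le> 2 * norm (g x)"
      proof eventually_elim
        case (elim h)
        have d: "norm (f (x + h) - f x) \<le> \<bar>K\<bar> * norm h"
          using jet_boundD[OF elim(2), of "[]"] elim(1) x F(2) mult_right_mono[OF abs_ge_self[of K] norm_ge_zero[of h]]
          by simp
        let ?y = "g (x + h)"
        have "prod (prod ?y (f (x + h) - f x)) (g x) = g x - ?y"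
          using g[OF elim(1)] g[OF x] by (simp add: diff_left diff_right one_left one_right assoc)
        then have "?y = g x - prod (prod ?y (f (x + h) - f x)) (g x)" by simp
        then have "norm ?y \<le> norm (g x) + norm (prod (prod ?y (f (x + h) - f x)) (g x))"
          by (metis norm_triangle_ineq4)
        also have "norm (prod (prod ?y (f (x + h) - f x)) (g x)) \<le> (norm ?y * (\<bar>K\<bar> * norm h) * B) * norm (g x) * B"
          using B by (intro order_trans[OF B(2)] mult_right_mono order_trans[OF B(2)] mult_left_mono d) auto
        also have "\<dots> = (2 * B * B * \<bar>K\<bar> * norm (g x)) * norm h * (norm ?y / 2)" by simp
        also have "\<dots> \<le> D * norm h * (norm ?y / 2)"
          by (intro mult_right_mono) (auto simp: D_def)
        also have "\<dots> \<le> 1 * (norm ?y / 2)"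
          using elim(3) D by (intro mult_right_mono) (auto simp: field_simps)
        finally show ?case by simp
      qed
      have Rb: "jet_bounded m (\<lambda>h. R (x + h))" for m
        unfolding R_def by (rule jet_bounded_inverse_jet[OF g_bound]) (rule smooth_jet_bounded[OF Fx])
      then obtain K where "\<forall>\<^sub>F h in nhds 0. jet_bound n K (R (x + h))" by (auto simp: jet_bounded_def)
      from eventually_nhds_x_imp_x[OF this] show K: "\<exists>K. jet_bound n K (R x)" by auto
      then have Rc: "jet_bounded n (\<lambda>h. R x)" by (auto intro: jet_bounded_const)
      have diff: "R (x + h) hs - R x hs =
          - star (star (R (x + h)) (\<lambda>as. F (x + h) as - F x as)) (R x) hs" if "x + h \<in> S" for h hs
      proof -
        have "star (star (R (x + h)) (\<lambda>as. F (x + h) as - F x as)) (R x) hs =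
          star (star (R (x + h)) (F (x + h))) (R x) hs - star (R (x + h)) (star (F x) (R x)) hs"
          by (simp add: star_diff_left star_diff_right star_assoc)
        then show ?thesis by (simp add: FR[OF x] RF[OF that] star_unit_left star_unit_right)
      qed
      have "jet_small n (\<lambda>h hs.
          - star (R (x + h)) (star (\<lambda>as. F (x + h) as - F x as - F x (h # as)) (R x)) hs +
          star (R (x + h)) (star (star (\<lambda>as. F (x + h) as - F x as) (star (R x) (\<lambda>as. F x (h # as)))) (R x)) hs)"
        by (intro jet_small_add jet_small_minus jet_small_bounded_star[OF Rb] jet_small_star_bounded[OF _ Rc]
            smooth_jet_small[OF Fx] jet_small_Lipschitz_star smooth_jet_Lipschitz_diff[OF Fx]
            jet_Lipschitz_bounded_star[OF Rc] smooth_jet_Lipschitz_Cons[OF Fx])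
      moreover have "\<forall>\<^sub>F h in nhds 0. (\<lambda>hs. R (x + h) hs - R x hs - R x (h # hs)) = (\<lambda>hs.
          - star (R (x + h)) (star (\<lambda>as. F (x + h) as - F x as - F x (h # as)) (R x)) hs +
          star (R (x + h)) (star (star (\<lambda>as. F (x + h) as - F x as) (star (R x) (\<lambda>as. F x (h # as)))) (R x)) hs)"
        using inS
      proof eventually_elim
        case (elim h)
        let ?D = "\<lambda>as. F (x + h) as - F x as" and ?d = "\<lambda>as. F x (h # as)"
        show ?case
        proof
          fix hs
          have "star (R (x + h)) (star (star ?D (star (R x) ?d)) (R x)) hs =
            star (star (star (R (x + h)) ?D) (R x)) (star ?d (R x)) hs"
            by (simp add: star_assoc)
          also have "\<dots> = star (\<lambda>as. - (R (x + h) as - R x as)) (star ?d (R x)) hs"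
            using diff[OF elim] by simp
          also have "\<dots> = star (R x) (star ?d (R x)) hs - star (R (x + h)) (star ?d (R x)) hs"
            by (simp add: star_minus_left star_diff_left)
          finally have 1: "star (R (x + h)) (star (star ?D (star (R x) ?d)) (R x)) hs = \<dots>" .
          have "star (R (x + h)) (star (\<lambda>as. ?D as - ?d as) (R x)) hs =
            star (R (x + h)) (star ?D (R x)) hs - star (R (x + h)) (star ?d (R x)) hs"
            by (simp only: star_diff_left star_diff_right)
          moreover have "R x (h # hs) = - star (R x) (star ?d (R x)) hs"
            by (simp add: R_def inverse_jet_Cons)
          ultimately show "R (x + h) hs - R x hs - R x (h # hs) =
            - star (R (x + h)) (star (\<lambda>as. ?D as - ?d as) (R x)) hs +
            star (R (x + h)) (star (star ?D (star (R x) ?d)) (R x)) hs"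
            unfolding 1 using diff[OF elim, of hs] by (simp add: star_assoc)
        qed
      qed
      ultimately show "jet_small n (\<lambda>h hs. R (x + h) hs - R x hs - R x (h # hs))"
        by (rule jet_small_eventually_eq)
    qed
  qed (simp add: R_def inverse_jet_Nil)
qed

end

section \<open>Derivatives of smooth maps\<close>

text \<open>
  The orders 0 and 1 of the jet: the first remainder estimate is Frechet differentiability, the
  second one makes the derivative Lipschitz at each point and so continuous.
\<close>

lemma smooth_on_derivative:
  assumes f: "smooth_on S f"
  shows "\<exists>f'. (\<forall>x\<in>S. (f has_derivative f' x) (at x)) \<and>
    (\<forall>x\<in>S. \<forall>e>0. \<exists>\<delta>>0. \<forall>y\<in>S. dist y x < \<delta> \<longrightarrow> (\<forall>v. norm (f' y v - f' x v) \<le> e * norm v))"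
proof -
  obtain F where F: "smooth_jet S F" "\<And>x. x \<in> S \<Longrightarrow> F x [] = f x" using smooth_onD[OF f] by blast
  have bl: "bounded_linear (\<lambda>v. F x [v])" if x: "x \<in> S" for x
  proof -
    have "linear (\<lambda>v. F x [v])"
      using slot_linear_Cons_linear[OF smooth_jet_slot_linear[OF F(1) x, of "Suc 0"], of "[]"] by simp
    moreover obtain K where K: "jet_bound 1 K (F x)" using smooth_jet_bound[OF F(1) x] by blast
    have "norm (F x [v]) \<le> norm v * K" for v
      using jet_boundD[OF K, of "[v]"] by (simp add: mult.commute)
    ultimately show ?thesis by (auto simp: bounded_linear_def bounded_linear_axioms_def)
  qed
  have "(f has_derivative (\<lambda>v. F x [v])) (at x)" if x: "x \<in> S" for x
    unfolding has_derivative_at_alt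
  proof (intro conjI allI impI bl[OF x])
    fix e :: real assume "e > 0"
    then obtain d where d: "d > 0" "\<And>h. norm h < d \<Longrightarrow> jet_bound 0 (e * norm h) (\<lambda>hs. F (x + h) hs - F x hs - F x (h # hs))"
      using smooth_jet_small[OF F(1) x, of 0] by (auto simp: jet_small_def eventually_nhds_metric dist_norm)
    obtain d' where d': "d' > 0" "ball x d' \<subseteq> S"
      using smooth_on_open[OF f] x open_contains_ball by blast
    show "\<exists>d>0. \<forall>y. norm (y - x) < d \<longrightarrow> norm (f y - f x - F x [y - x]) \<le> e * norm (y - x)"
    proof (intro exI[of _ "min d d'"] conjI allI impI)
      fix y assume y: "norm (y - x) < min d d'"
      then have "y \<in> S" using d'(2) by (auto simp: dist_norm norm_minus_commute subset_iff)
      then show "norm (f y - f x - F x [y - x]) \<le> e * norm (y - x)"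
        using jet_boundD[OF d(2)[of "y - x"], of "[]"] y x F(2) by simp
    qed (use d d' in auto)
  qed
  moreover have "\<exists>\<delta>>0. \<forall>y\<in>S. dist y x < \<delta> \<longrightarrow> (\<forall>v. norm (F y [v] - F x [v]) \<le> e * norm v)"
    if x: "x \<in> S" and e: "e > 0" for x e
  proof -
    obtain K where "\<forall>\<^sub>F h in nhds 0. jet_bound 1 (K * norm h) (\<lambda>hs. F (x + h) hs - F x hs)"
      using smooth_jet_Lipschitz_diff[OF F(1) x] by (auto simp: jet_Lipschitz_def)
    then obtain d where d: "d > 0" "\<And>h. norm h < d \<Longrightarrow> jet_bound 1 (K * norm h) (\<lambda>hs. F (x + h) hs - F x hs)"
      by (auto simp: eventually_nhds_metric dist_norm)
    show ?thesis
    proof (intro exI[of _ "min d (e / (1 + \<bar>K\<bar>))"] conjI ballI impI allI)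
      fix y v assume "dist y x < min d (e / (1 + \<bar>K\<bar>))"
      then have y: "norm (y - x) < d" "norm (y - x) * (1 + \<bar>K\<bar>) < e"
        by (auto simp: dist_norm field_simps)
      have "norm (F y [v] - F x [v]) \<le> K * norm (y - x) * norm v"
        using jet_boundD[OF d(2)[OF y(1)], of "[v]"] by simp
      also have "K * norm (y - x) \<le> norm (y - x) * (1 + \<bar>K\<bar>)"
        using mult_right_mono[of K "1 + \<bar>K\<bar>" "norm (y - x)"] by (simp add: mult.commute)
      finally show "norm (F y [v] - F x [v]) \<le> e * norm v"
        using y(2) by (meson less_eq_real_def mult_right_mono norm_ge_zero order_trans)
    qed (use d e in auto)
  qed
  ultimately show ?thesis by (intro exI[of _ "\<lambda>x v. F x [v]"]) blast
qed

lemma smooth_on_continuous_on: "smooth_on S f \<Longrightarrow> continuous_on S f"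
  using smooth_on_derivative[of S f]
  by (meson continuous_at_imp_continuous_on has_derivative_continuous)

lemma smooth_diffeo_on_subset:
  assumes f: "smooth_diffeo_on S f" and T: "open T" "T \<subseteq> S"
  shows "smooth_diffeo_on T f"
proof -
  have inj: "inj_on f S" and fS: "smooth_on S f" and g: "smooth_on (f ` S) (the_inv_into S f)"
    using f by (auto simp: smooth_diffeo_on_def)
  have injT: "inj_on f T" using inj T(2) by (rule inj_on_subset)
  have eq: "f ` T = f ` S \<inter> the_inv_into S f -` T"
    using T(2) by (auto simp: the_inv_into_f_f[OF inj] f_the_inv_into_f[OF inj] subset_iff image_iff)
  have "open (f ` T)"
    unfolding eq using smooth_on_continuous_on[OF g] smooth_on_open[OF g] T(1)
    by (rule continuous_open_preimage)
  then have "smooth_on (f ` T) (the_inv_into S f)"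
    using g T(2) by (auto intro: smooth_on_subset)
  moreover have "the_inv_into S f y = the_inv_into T f y" if "y \<in> f ` T" for y
    using that T(2) by (auto simp: the_inv_into_f_f[OF inj] the_inv_into_f_f[OF injT])
  ultimately show ?thesis
    unfolding smooth_diffeo_on_def using injT smooth_on_subset[OF fS T] by (simp cong: smooth_on_cong)
qed


section \<open>Sets straightened by a diffeomorphism\<close>

text \<open>
  The linear isomorphism \<open>A\<close> pulls back the decomposition of the space into the range and the
  null space of the projection \<open>R\<close>.
\<close>

lemma complemented_preimage_range_of_projection:
  assumes A: "bounded_linear A" and R: "bounded_linear R" and RR: "\<And>z. R (R z) = R z"
    and surj: "surj A" and inj: "inj A"
  shows "complemented {v. R (A v) = A v}"
proof -
  interpret A: bounded_linear A by fact
  interpret R: bounded_linear R by fact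
  have cont: "continuous_on UNIV A" "continuous_on UNIV (\<lambda>v. R (A v))"
    by (intro A.continuous_on R.continuous_on continuous_on_id)+
  show ?thesis
    unfolding complemented_def
  proof (intro conjI exI[of _ "{v. R (A v) = 0}"] allI)
    show "subspace {v. R (A v) = A v}" "subspace {v. R (A v) = 0}"
      by (auto simp: subspace_def A.add A.scale R.add R.scale A.zero R.zero)
    show "closed {v. R (A v) = A v}" "closed {v. R (A v) = 0}"
      by (intro closed_Collect_eq cont continuous_on_const)+
    show "{v. R (A v) = A v} \<inter> {v. R (A v) = 0} = {0}"
      using inj by (auto simp: A.zero R.zero dest: injD[of A _ 0])
    fix x
    obtain a where a: "A a = R (A x)" using surj by (metis surjD)
    show "\<exists>a\<in>{v. R (A v) = A v}. \<exists>b\<in>{v. R (A v) = 0}. x = a + b"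
      by (rule bexI[of _ a], rule bexI[of _ "x - a"]) (auto simp: A.diff R.diff a RR)
  qed
qed

lemma tangent_spaceI:
  assumes "\<epsilon> > 0" "\<gamma> 0 = x" "\<And>t. \<bar>t\<bar> < \<epsilon> \<Longrightarrow> \<gamma> t \<in> M" "\<And>t. \<bar>t\<bar> < \<epsilon> \<Longrightarrow> \<gamma> differentiable (at t)"
    and "(\<gamma> has_vector_derivative v) (at 0)"
  shows "v \<in> tangent_space M x"
  using assms by (auto simp: tangent_space_def)

lemma isCont_real_stays_in_open:
  fixes \<gamma> :: "real \<Rightarrow> 'a::topological_space"
  assumes "isCont \<gamma> 0" "open N" "\<gamma> 0 \<in> N"
  obtains d where "d > 0" "\<And>t. \<bar>t\<bar> < d \<Longrightarrow> \<gamma> t \<in> N"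
proof -
  have "(\<gamma> \<longlongrightarrow> \<gamma> 0) (nhds 0)"
    using assms(1) by (simp add: isCont_def tendsto_at_iff_tendsto_nhds)
  then have "\<forall>\<^sub>F t in nhds 0. \<gamma> t \<in> N" using assms(2,3) by (rule topological_tendstoD)
  then show thesis by (auto simp: eventually_nhds_metric dist_norm intro: that)
qed

lemma tangent_spaceE:
  assumes "v \<in> tangent_space M x" "open N" "x \<in> N"
  obtains \<epsilon> \<gamma> where "\<epsilon> > 0" "\<gamma> 0 = x" "\<And>t. \<bar>t\<bar> < \<epsilon> \<Longrightarrow> \<gamma> t \<in> M \<inter> N"
    "\<And>t. \<bar>t\<bar> < \<epsilon> \<Longrightarrow> \<gamma> differentiable (at t)" "(\<gamma> has_vector_derivative v) (at 0)"
proof -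
  obtain \<epsilon> \<gamma> where \<gamma>: "\<epsilon> > 0" "\<gamma> 0 = x" "\<And>t. \<bar>t\<bar> < \<epsilon> \<Longrightarrow> \<gamma> t \<in> M"
    "\<And>t. \<bar>t\<bar> < \<epsilon> \<Longrightarrow> \<gamma> differentiable (at t)" "(\<gamma> has_vector_derivative v) (at (0::real))"
    using assms(1) unfolding tangent_space_def by blast
  have "isCont \<gamma> 0" using \<gamma>(5) has_vector_derivative_continuous by blast
  from this assms(2) obtain d where d: "d > 0" "\<And>t. \<bar>t\<bar> < d \<Longrightarrow> \<gamma> t \<in> N"
    by (rule isCont_real_stays_in_open) (use assms(3) \<gamma>(2) in auto)
  show ?thesis
    by (rule that[of "min \<epsilon> d" \<gamma>]) (use \<gamma> d in auto)
qed

text \<open>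
  The diffeomorphism \<open>G\<close> of \<open>N\<close> onto an open set maps the part of \<open>M\<close> in \<open>N\<close> onto the part of that open set
  in the range of the bounded projection \<open>R\<close>. Being a fixed point of \<open>R\<close> is membership in its range.
\<close>

locale straightened =
  fixes M N :: "'a::banach set" and G R :: "'a \<Rightarrow> 'a"
  assumes diffeo: "smooth_diffeo_on N G"
    and R: "bounded_linear R" and RR: "R (R z) = R z"
    and M_iff: "M \<inter> N = {Y \<in> N. R (G Y) = G Y}"
begin

sublocale R: bounded_linear R by (rule R)

definition H where "H = the_inv_into N G"

text \<open>
  Derivatives of \<open>G\<close> and \<open>H\<close> are fixed once and for all, including their continuity in the operator norm.
\<close>

definition G' where "G' = (SOME f'. (\<forall>x\<in>N. (G has_derivative f' x) (at x)) \<and>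
    (\<forall>x\<in>N. \<forall>e>0. \<exists>\<delta>>0. \<forall>y\<in>N. dist y x < \<delta> \<longrightarrow> (\<forall>v. norm (f' y v - f' x v) \<le> e * norm v)))"

definition H' where "H' = (SOME f'. (\<forall>x\<in>G ` N. (H has_derivative f' x) (at x)) \<and>
    (\<forall>x\<in>G ` N. \<forall>e>0. \<exists>\<delta>>0. \<forall>y\<in>G ` N. dist y x < \<delta> \<longrightarrow> (\<forall>v. norm (f' y v - f' x v) \<le> e * norm v)))"

lemma smooth_G: "smooth_on N G" and smooth_H: "smooth_on (G ` N) H"
  using diffeo by (simp_all add: smooth_diffeo_on_def H_def)

lemma open_N: "open N" and open_GN: "open (G ` N)"
  using smooth_G smooth_H by (auto intro: smooth_on_open)

lemma H_G: "Y \<in> N \<Longrightarrow> H (G Y) = Y"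
  using diffeo by (simp add: smooth_diffeo_on_def H_def the_inv_into_f_f)

lemma G_H: "Z \<in> G ` N \<Longrightarrow> G (H Z) = Z"
  using H_G by auto

lemma H_mem: "Z \<in> G ` N \<Longrightarrow> H Z \<in> N"
  using H_G by auto

lemma G_derivative: "Y \<in> N \<Longrightarrow> (G has_derivative G' Y) (at Y)"
  using someI_ex[OF smooth_on_derivative[OF smooth_G]] by (simp add: G'_def)

lemma H_derivative: "Z \<in> G ` N \<Longrightarrow> (H has_derivative H' Z) (at Z)"
  and H'_continuous: "Z \<in> G ` N \<Longrightarrow> 0 < e \<Longrightarrow>
    \<exists>\<delta>>0. \<forall>y\<in>G ` N. dist y Z < \<delta> \<longrightarrow> (\<forall>v. norm (H' y v - H' Z v) \<le> e * norm v)"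
  using someI_ex[OF smooth_on_derivative[OF smooth_H]] unfolding H'_def by blast+

lemma H'_G': "Y \<in> N \<Longrightarrow> H' (G Y) (G' Y v) = v"
proof -
  assume Y: "Y \<in> N"
  have "((\<lambda>Y. H (G Y)) has_derivative (\<lambda>v. H' (G Y) (G' Y v))) (at Y)"
    using G_derivative[OF Y] by (rule has_derivative_compose) (use Y H_derivative in auto)
  moreover have "((\<lambda>Y. H (G Y)) has_derivative (\<lambda>v. v)) (at Y)"
    by (rule has_derivative_transform_within_open[OF has_derivative_ident open_N Y]) (simp add: H_G)
  ultimately show ?thesis using has_derivative_unique by (metis (no_types, lifting))
qed

lemma G'_H': "Y \<in> N \<Longrightarrow> G' Y (H' (G Y) v) = v"
proof -
  assume Y: "Y \<in> N"
  have "((\<lambda>Y. G (H Y)) has_derivative (\<lambda>v. G' Y (H' (G Y) v))) (at (G Y))"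
    by (rule has_derivative_compose[where g' = "G' Y"]) (use Y H_derivative G_derivative H_G in auto)
  moreover have "((\<lambda>Y. G (H Y)) has_derivative (\<lambda>v. v)) (at (G Y))"
    by (rule has_derivative_transform_within_open[OF has_derivative_ident open_GN]) (use Y in \<open>auto simp: G_H\<close>)
  ultimately show ?thesis using has_derivative_unique by (metis (no_types, lifting))
qed

lemma bounded_linear_G': "Y \<in> N \<Longrightarrow> bounded_linear (G' Y)"
  and bounded_linear_H': "Z \<in> G ` N \<Longrightarrow> bounded_linear (H' Z)"
  using G_derivative H_derivative by (auto dest: has_derivative_bounded_linear)

lemma bij_G': "Y \<in> N \<Longrightarrow> surj (G' Y)" "Y \<in> N \<Longrightarrow> inj (G' Y)"
  by (metis G'_H' surjI, metis H'_G' injI)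

text \<open>
  Along a curve in \<open>M\<close> the equation \<open>R (G Y) = G Y\<close> can be differentiated. Conversely, a straight
  line in the range of \<open>R\<close> is pulled back by \<open>G\<close> to a curve in \<open>M\<close> with the prescribed velocity.
\<close>

lemma tangent_space_eq:
  assumes Y: "Y \<in> M \<inter> N"
  shows "tangent_space M Y = {v. R (G' Y v) = G' Y v}"
proof -
  have YN: "Y \<in> N" and RY: "R (G Y) = G Y" using Y M_iff by auto
  have "R (G' Y v) = G' Y v" if "v \<in> tangent_space M Y" for v
  proof -
    obtain \<epsilon> \<gamma> where \<gamma>: "\<epsilon> > 0" "\<gamma> 0 = Y" "\<And>t. \<bar>t\<bar> < \<epsilon> \<Longrightarrow> \<gamma> t \<in> M \<inter> N"
      "(\<gamma> has_vector_derivative v) (at (0::real))"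
      using tangent_spaceE[OF \<open>v \<in> tangent_space M Y\<close> open_N YN] by metis
    have d: "((\<lambda>t. G (\<gamma> t)) has_vector_derivative G' Y v) (at 0)"
      using has_derivative_compose[OF \<gamma>(4)[unfolded has_vector_derivative_def], of G "G' Y"]
        G_derivative[OF YN]
      unfolding \<gamma>(2) has_vector_derivative_def
        linear_cmul[OF bounded_linear.linear[OF bounded_linear_G'[OF YN]]] by blast
    have "((\<lambda>t. R (G (\<gamma> t))) has_vector_derivative R (G' Y v)) (at 0)"
      by (rule bounded_linear.has_vector_derivative[OF R d])
    then have "((\<lambda>t. G (\<gamma> t)) has_vector_derivative R (G' Y v)) (at 0)"
      by (rule has_vector_derivative_transform_within_open[where S = "{-\<epsilon><..<\<epsilon>}"])
        (use \<gamma>(1,3) M_iff in \<open>auto simp: abs_less_iff\<close>)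
    with d show ?thesis using vector_derivative_unique_at by blast
  qed
  moreover have "v \<in> tangent_space M Y" if v: "R (G' Y v) = G' Y v" for v
  proof -
    let ?l = "\<lambda>t. G Y + t *\<^sub>R G' Y v"
    have "isCont ?l 0" by (intro continuous_intros)
    from this open_GN obtain d where d: "d > 0" "\<And>t. \<bar>t\<bar> < d \<Longrightarrow> ?l t \<in> G ` N"
      by (rule isCont_real_stays_in_open) (use YN in auto)
    have der: "((\<lambda>t. H (?l t)) has_vector_derivative H' (?l t) (G' Y v)) (at t)" if t: "\<bar>t\<bar> < d" for t
    proof -
      have l: "(?l has_derivative (\<lambda>s. s *\<^sub>R G' Y v)) (at t)" by (auto intro!: derivative_eq_intros)
      show ?thesis
        using has_derivative_compose[OF l H_derivative[OF d(2)[OF t]]]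
        unfolding has_vector_derivative_def
          linear_cmul[OF bounded_linear.linear[OF bounded_linear_H'[OF d(2)[OF t]]]] .
    qed
    show ?thesis
    proof (rule tangent_spaceI[where \<gamma> = "\<lambda>t. H (?l t)", OF d(1)])
      fix t :: real assume t: "\<bar>t\<bar> < d"
      show "H (?l t) \<in> M"
      proof -
        have "R (?l t) = ?l t" by (simp only: R.add R.scale v RY)
        then have "H (?l t) \<in> {Y \<in> N. R (G Y) = G Y}"
          using H_mem[OF d(2)[OF t]] by (simp only: mem_Collect_eq G_H[OF d(2)[OF t]])
        then show ?thesis using M_iff by blast
      qed
      show "(\<lambda>t. H (?l t)) differentiable at t"
        using der[OF t] by (auto simp: has_vector_derivative_def differentiable_def)
    next
      show "((\<lambda>t. H (?l t)) has_vector_derivative v) (at 0)"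
        using der[of 0] d(1) by (simp only: abs_zero scaleR_zero_left add_0_right H'_G'[OF YN])
      show "H (?l 0) = Y" by (simp only: scaleR_zero_left add_0_right H_G YN)
    qed
  qed
  ultimately show ?thesis by blast
qed

lemma R_fixed_iff: "R z = z \<longleftrightarrow> z - R z = 0"
  by (metis eq_iff_diff_eq_0)

lemma complemented_range_R: "complemented {z. R z = z}"
  using complemented_preimage_range_of_projection[OF bounded_linear_ident R RR] by (simp add: inj_def surj_def)

theorem smooth_submanifold_straightened: "smooth_submanifold (M \<inter> N)"
  unfolding smooth_submanifold_def
proof
  fix x assume "x \<in> M \<inter> N"
  then have "open N \<and> x \<in> N \<and> smooth_diffeo_on N G \<and> complemented {z. R z = z} \<and>
      G ` (M \<inter> N \<inter> N) = G ` N \<inter> {z. R z = z}"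
    using M_iff open_N diffeo complemented_range_R by auto
  then show "\<exists>S f E. open S \<and> x \<in> S \<and> smooth_diffeo_on S f \<and> complemented E \<and>
      f ` (M \<inter> N \<inter> S) = f ` S \<inter> E" by blast
qed

text \<open>
  The submersion is \<open>G\<close> followed by the complementary projection. Since the derivative of \<open>G\<close> is an
  isomorphism, the derivative of the submersion has the null space of \<open>R\<close> as its range everywhere.
\<close>

theorem defining_submersion:
  defines "g \<equiv> \<lambda>Y. G Y - R (G Y)"
  shows "submersion_on N {z. R z = 0} g" "M \<inter> N = {Y \<in> N. g Y = 0}"
    "\<And>Y. Y \<in> M \<inter> N \<Longrightarrow> tangent_space M Y = {\<xi>. frechet_derivative g (at Y) \<xi> = 0}"
proof -
  have fd: "frechet_derivative g (at Y) = (\<lambda>v. G' Y v - R (G' Y v))" if "Y \<in> N" for Y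
    using has_derivative_diff[OF G_derivative[OF that] bounded_linear.has_derivative[OF R G_derivative[OF that]]]
    unfolding g_def by (rule frechet_derivative_at[symmetric])
  have cR: "continuous_on UNIV R" by (intro R.continuous_on continuous_on_id)
  show "submersion_on N {z. R z = 0} g"
    unfolding submersion_on_def
  proof (intro conjI ballI)
    show "subspace {z. R z = 0}" by (auto simp: subspace_def R.add R.scale R.zero)
    show "closed {z. R z = 0}" by (intro closed_Collect_eq cR continuous_on_const)
    show "smooth_on N g"
      unfolding g_def by (intro smooth_on_diff smooth_G smooth_on_bounded_linear_compose[OF R])
    show "g ` N \<subseteq> {z. R z = 0}" by (auto simp: g_def R.diff RR)
    fix Y assume Y: "Y \<in> N"
    show "range (frechet_derivative g (at Y)) = {z. R z = 0}"
    proof (intro set_eqI iffI)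
      fix z assume "z \<in> {z. R z = 0}"
      then have "frechet_derivative g (at Y) (H' (G Y) z) = z" by (simp add: fd[OF Y] G'_H'[OF Y])
      then show "z \<in> range (frechet_derivative g (at Y))" by (metis rangeI)
    qed (auto simp: fd[OF Y] R.diff RR)
    have "{v. frechet_derivative g (at Y) v = 0} = {v. R (G' Y v) = G' Y v}"
      by (simp only: fd[OF Y] R_fixed_iff)
    then show "complemented {v. frechet_derivative g (at Y) v = 0}"
      using complemented_preimage_range_of_projection[OF bounded_linear_G'[OF Y] R RR bij_G'[OF Y]]
      by simp
  qed
  show "M \<inter> N = {Y \<in> N. g Y = 0}" unfolding M_iff g_def R_fixed_iff ..
  show "tangent_space M Y = {\<xi>. frechet_derivative g (at Y) \<xi> = 0}" if "Y \<in> M \<inter> N" for Y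
    using that by (simp only: tangent_space_eq[OF that] fd R_fixed_iff IntD2)
qed

text \<open>
  A tangent vector \<open>\<xi>\<close> is mapped to the point of \<open>M\<close> with straightened coordinate \<open>G X + G' X \<xi>\<close>. The
  derivative at 0 is the identity of the tangent space. Because \<open>G' X\<close> maps the tangent space
  onto the range of \<open>R\<close>, all of \<open>M \<inter> N\<close> is reached.
\<close>

theorem tangential_parametrization:
  assumes X: "X \<in> M \<inter> N"
  shows "\<exists>V \<phi> \<psi>. openin (top_of_set (tangent_space M X)) V \<and> 0 \<in> V \<and>
    homeomorphism V (M \<inter> N) \<phi> \<psi> \<and> C1_on (tangent_space M X) V \<phi> \<and> \<phi> 0 = X \<and>
    (\<lambda>\<xi>. norm (\<phi> \<xi> - X - \<xi>)) \<in> o[at 0 within V](\<lambda>\<xi>. norm \<xi>) \<and>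
    immersion_on (tangent_space M X) V \<phi> \<and> embedding_on (tangent_space M X) V \<phi>"
proof -
  have XN: "X \<in> N" and RX: "R (G X) = G X" using X M_iff by auto
  let ?T = "tangent_space M X"
  note T = tangent_space_eq[OF X]
  interpret A: bounded_linear "G' X" by (rule bounded_linear_G'[OF XN])
  interpret B: bounded_linear "H' (G X)" by (rule bounded_linear_H') (use XN in simp)
  define a where "a \<xi> = G X + G' X \<xi>" for \<xi>
  define V where "V = ?T \<inter> {\<xi>. a \<xi> \<in> G ` N}"
  define \<phi> where "\<phi> \<xi> = H (a \<xi>)" for \<xi>
  define \<psi> where "\<psi> Y = H' (G X) (G Y - G X)" for Y
  define \<phi>' where "\<phi>' \<xi> v = H' (a \<xi>) (G' X v)" for \<xi> v
  have ca: "continuous_on S a" for S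
    unfolding a_def by (intro continuous_intros A.continuous_on)
  have aGN: "a \<xi> \<in> G ` N" if "\<xi> \<in> V" for \<xi> using that by (simp add: V_def)
  have a0: "a 0 = G X" by (simp add: a_def A.zero)
  have zero: "0 \<in> V" using XN by (simp add: V_def a0 T A.zero R.zero)
  have openin: "openin (top_of_set ?T) V"
    unfolding V_def using continuous_open_preimage[OF ca open_UNIV open_GN]
    by (intro openin_open_Int) (simp add: vimage_def)
  have \<phi>0: "\<phi> 0 = X" by (simp add: \<phi>_def a0 H_G XN)
  have da: "(a has_derivative G' X) (at \<xi>)" for \<xi>
    unfolding a_def by (auto intro!: derivative_eq_intros A.has_derivative)
  have d\<phi>: "(\<phi> has_derivative \<phi>' \<xi>) (at \<xi>)" if "\<xi> \<in> V" for \<xi>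
    unfolding \<phi>_def[abs_def] \<phi>'_def[abs_def]
    by (rule has_derivative_compose[OF da H_derivative[OF aGN[OF that]]])
  have \<phi>N: "\<phi> \<xi> \<in> N" "G (\<phi> \<xi>) = a \<xi>" if "\<xi> \<in> V" for \<xi>
    using aGN[OF that] by (simp_all add: \<phi>_def H_mem G_H)
  have \<phi>M: "\<phi> \<xi> \<in> M \<inter> N" if "\<xi> \<in> V" for \<xi>
    using \<phi>N[OF that] RX that unfolding M_iff by (simp add: V_def T a_def R.add)
  have \<psi>\<phi>: "\<psi> (\<phi> \<xi>) = \<xi>" if "\<xi> \<in> V" for \<xi>
    using \<phi>N(2)[OF that] by (simp add: \<psi>_def a_def H'_G' XN)
  have a\<psi>: "a (\<psi> Y) = G Y" for Y
    by (simp add: \<psi>_def a_def G'_H' XN)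
  have \<psi>V: "\<psi> Y \<in> V" if "Y \<in> M \<inter> N" for Y
    using that RX unfolding M_iff by (auto simp: V_def a\<psi> T) (simp add: \<psi>_def G'_H' XN R.diff)
  have \<phi>\<psi>: "\<phi> (\<psi> Y) = Y" if "Y \<in> M \<inter> N" for Y
    using that by (simp add: \<phi>_def a\<psi> H_G)
  have homeo: "homeomorphism V (M \<inter> N) \<phi> \<psi>"
  proof (rule homeomorphismI)
    show "continuous_on V \<phi>"
      using d\<phi> by (meson continuous_at_imp_continuous_on has_derivative_continuous)
    show "continuous_on (M \<inter> N) \<psi>"
      unfolding \<psi>_def using smooth_on_continuous_on[OF smooth_G]
      by (intro B.continuous_on continuous_intros) (auto intro: continuous_on_subset)
  qed (use \<phi>M \<psi>\<phi> \<psi>V \<phi>\<psi> in auto)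
  have C1: "C1_on ?T V \<phi>"
    unfolding C1_on_def
  proof (intro exI[of _ \<phi>'] conjI ballI allI impI)
    fix \<xi> assume \<xi>: "\<xi> \<in> V"
    show "(\<phi> has_derivative \<phi>' \<xi>) (at \<xi> within V)" using d\<phi>[OF \<xi>] by (rule has_derivative_at_withinI)
    fix e :: real assume e: "e > 0"
    obtain K where K: "K > 0" "\<And>v. norm (G' X v) \<le> norm v * K" using A.pos_bounded by blast
    then have eK: "e / K > 0" using e by simp
    obtain \<delta> where \<delta>: "\<delta> > 0" "\<And>y v. y \<in> G ` N \<Longrightarrow> dist y (a \<xi>) < \<delta> \<Longrightarrow> norm (H' y v - H' (a \<xi>) v) \<le> e / K * norm v"
      using H'_continuous[OF aGN[OF \<xi>] eK] by blast
    obtain d where d: "d > 0" "\<And>\<eta>. dist \<eta> \<xi> < d \<Longrightarrow> dist (a \<eta>) (a \<xi>) < \<delta>"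
      using ca[of UNIV] \<delta>(1) unfolding continuous_on_iff by (metis UNIV_I)
    show "\<exists>\<delta>>0. \<forall>y\<in>V. dist y \<xi> < \<delta> \<longrightarrow> (\<forall>v\<in>?T. norm (\<phi>' y v - \<phi>' \<xi> v) \<le> e * norm v)"
    proof (intro exI[of _ d] conjI ballI impI d(1))
      fix y v assume "y \<in> V" "dist y \<xi> < d"
      then have "norm (\<phi>' y v - \<phi>' \<xi> v) \<le> e / K * norm (G' X v)"
        unfolding \<phi>'_def by (intro \<delta>(2) d(2) aGN)
      also have "\<dots> \<le> e / K * (norm v * K)" using eK by (intro mult_left_mono K(2)) simp
      finally show "norm (\<phi>' y v - \<phi>' \<xi> v) \<le> e * norm v" using K(1) by simp
    qed
  qed
  have small: "(\<lambda>\<xi>. norm (\<phi> \<xi> - X - \<xi>)) \<in> o[at 0 within V](\<lambda>\<xi>. norm \<xi>)"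
  proof (rule landau_o.smallI)
    fix c :: real assume "c > 0"
    then obtain d where d: "d > 0" "\<And>y. norm y < d \<Longrightarrow> norm (\<phi> y - \<phi> 0 - \<phi>' 0 y) \<le> c * norm y"
      using d\<phi>[OF zero] unfolding has_derivative_at_alt by auto
    have "\<phi>' 0 y = y" for y by (simp add: \<phi>'_def a0 H'_G' XN)
    with d show "\<forall>\<^sub>F \<xi> in at 0 within V. norm (norm (\<phi> \<xi> - X - \<xi>)) \<le> c * norm (norm \<xi>)"
      unfolding eventually_at by (auto intro!: exI[of _ d] simp: \<phi>0)
  qed
  have imm: "immersion_on ?T V \<phi>"
    unfolding immersion_on_def
  proof (intro exI[of _ \<phi>'] ballI conjI)
    fix \<xi> assume \<xi>: "\<xi> \<in> V"
    note Y = \<phi>N[OF \<xi>]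
    show "(\<phi> has_derivative \<phi>' \<xi>) (at \<xi> within V)" using d\<phi>[OF \<xi>] by (rule has_derivative_at_withinI)
    show "inj_on (\<phi>' \<xi>) ?T"
    proof (rule inj_onI)
      fix v w assume "\<phi>' \<xi> v = \<phi>' \<xi> w"
      then have "G' (\<phi> \<xi>) (\<phi>' \<xi> v) = G' (\<phi> \<xi>) (\<phi>' \<xi> w)" by simp
      then have "G' X v = G' X w" using G'_H'[OF Y(1)] by (simp add: \<phi>'_def Y(2))
      then show "v = w" using H'_G'[OF XN] by metis
    qed
    have "\<phi>' \<xi> ` ?T = {w. R (G' (\<phi> \<xi>) w) = G' (\<phi> \<xi>) w}"
    proof (intro set_eqI iffI)
      fix w assume "w \<in> \<phi>' \<xi> ` ?T"
      then show "w \<in> {w. R (G' (\<phi> \<xi>) w) = G' (\<phi> \<xi>) w}"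
        using G'_H'[OF Y(1)] by (auto simp: \<phi>'_def Y(2) T)
    next
      fix w assume w: "w \<in> {w. R (G' (\<phi> \<xi>) w) = G' (\<phi> \<xi>) w}"
      let ?v = "H' (G X) (G' (\<phi> \<xi>) w)"
      have "\<phi>' \<xi> ?v = w" using H'_G'[OF Y(1)] by (simp add: \<phi>'_def G'_H' XN Y(2))
      moreover have "?v \<in> ?T" using w by (simp add: T G'_H' XN)
      ultimately show "w \<in> \<phi>' \<xi> ` ?T" by (metis imageI)
    qed
    then show "complemented (\<phi>' \<xi> ` ?T)"
      using complemented_preimage_range_of_projection[OF bounded_linear_G'[OF Y(1)] R RR bij_G'[OF Y(1)]] by simp
  qed
  have "\<phi> ` V = M \<inter> N" using homeo by (simp add: homeomorphism_def)
  with homeo imm have "embedding_on ?T V \<phi>" by (auto simp: embedding_on_def)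
  with openin zero homeo C1 \<phi>0 small imm show ?thesis by blast
qed

end

section \<open>Elementary tensors\<close>

lemma inner_elementary_tensor:
  fixes u v :: "'d::finite \<Rightarrow> 'a ell2"
  shows "inner (elementary_tensor u) (elementary_tensor v) = (\<Prod>\<mu>\<in>UNIV. inner (u \<mu>) (v \<mu>))"
proof -
  have "(\<lambda>n. norm (coord (u \<mu>) n * coord (v \<mu>) n)) summable_on UNIV" for \<mu>
    using square_summable_mult[of "\<lambda>n. \<bar>coord (u \<mu>) n\<bar>" UNIV "\<lambda>n. \<bar>coord (v \<mu>) n\<bar>"]
    by (simp add: abs_mult summable_on_coord_square)
  from infsum_prod_PiE_abs[OF finite[of "UNIV :: 'd set"] this] show ?thesis
    by (simp add: inner_ell2_def elementary_tensor.rep_eq prod.distrib PiE_UNIV_domain)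
qed

lemma norm_elementary_tensor: "norm (elementary_tensor u) = (\<Prod>\<mu>\<in>UNIV. norm (u \<mu>))"
proof -
  have "(norm (elementary_tensor u))\<^sup>2 = (\<Prod>\<mu>\<in>UNIV. norm (u \<mu>))\<^sup>2"
    by (simp add: power2_norm_eq_inner inner_elementary_tensor prod_power_distrib)
  then show ?thesis by (simp add: prod_nonneg power2_eq_iff_nonneg)
qed

lemma elementary_tensor_update_coord:
  "coord (elementary_tensor (u(\<mu> := a))) \<alpha> = coord a (\<alpha> \<mu>) * (\<Prod>\<nu>\<in>- {\<mu>}. coord (u \<nu>) (\<alpha> \<nu>))"
proof -
  have "(\<Prod>\<nu>\<in>- {\<mu>}. coord ((u(\<mu> := a)) \<nu>) (\<alpha> \<nu>)) = (\<Prod>\<nu>\<in>- {\<mu>}. coord (u \<nu>) (\<alpha> \<nu>))"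
    by (rule prod.cong) auto
  then show ?thesis
    by (simp add: elementary_tensor.rep_eq prod.remove[of UNIV \<mu>] Compl_eq_Diff_UNIV[symmetric])
qed

lemma prod_update:
  fixes f :: "'d::finite \<Rightarrow> 'a \<Rightarrow> 'b::comm_monoid_mult"
  shows "(\<Prod>\<nu>\<in>UNIV. f \<nu> ((u(\<mu> := a)) \<nu>)) = f \<mu> a * (\<Prod>\<nu>\<in>- {\<mu>}. f \<nu> (u \<nu>))"
proof -
  have "(\<Prod>\<nu>\<in>- {\<mu>}. f \<nu> ((u(\<mu> := a)) \<nu>)) = (\<Prod>\<nu>\<in>- {\<mu>}. f \<nu> (u \<nu>))"
    by (rule prod.cong) auto
  then show ?thesis
    by (simp add: prod.remove[of UNIV \<mu>] Compl_eq_Diff_UNIV[symmetric])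
qed

lemma bounded_linear_elementary_tensor_slot: "bounded_linear (\<lambda>a. elementary_tensor (u(\<mu> := a)))"
proof
  fix a b and c :: real
  show "elementary_tensor (u(\<mu> := a + b)) = elementary_tensor (u(\<mu> := a)) + elementary_tensor (u(\<mu> := b))"
    by (rule ell2_eqI) (simp only: elementary_tensor_update_coord plus_ell2.rep_eq distrib_right)
  show "elementary_tensor (u(\<mu> := c *\<^sub>R a)) = c *\<^sub>R elementary_tensor (u(\<mu> := a))"
    by (rule ell2_eqI) (simp only: elementary_tensor_update_coord scaleR_ell2.rep_eq mult.assoc)
  have "norm (elementary_tensor (u(\<mu> := a))) \<le> norm a * (\<Prod>\<nu>\<in>- {\<mu>}. norm (u \<nu>))" for a
    unfolding norm_elementary_tensor by (simp only: prod_update[of "\<lambda>_. norm"])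
  then show "\<exists>K. \<forall>a. norm (elementary_tensor (u(\<mu> := a))) \<le> norm a * K" by blast
qed

lift_definition unit_ell2 :: "'a \<Rightarrow> 'a ell2" is "\<lambda>n i. if i = n then 1 else 0"
proof -
  fix n :: 'a
  have "(\<lambda>i. (if i = n then 1 else 0 :: real)\<^sup>2) summable_on {n}" by simp
  then show "(\<lambda>i. (if i = n then 1 else 0 :: real)\<^sup>2) summable_on UNIV"
    by (rule summable_on_cong_neutral[THEN iffD1, rotated -1]) auto
qed

lemma inner_unit_ell2: "inner x (unit_ell2 n) = coord x n"
proof -
  have "inner x (unit_ell2 n) = (\<Sum>\<^sub>\<infinity>i\<in>{n}. coord x i)"
    unfolding inner_ell2_def by (rule infsum_cong_neutral) (auto simp: unit_ell2.rep_eq)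
  then show ?thesis by simp
qed

text \<open>
  Duality: if \<open>u\<close> has the finitely many entries under consideration as its coordinates, then
  the sum is the inner product of \<open>Y\<close> with the elementary tensor that has \<open>u\<close> in mode \<open>\<mu>\<close>, whose norm is
  the norm of \<open>u\<close> times a constant. Dividing by the norm of \<open>u\<close> gives the bound.
\<close>

lemma contraction_square_sum_le:
  fixes v :: "'d::finite \<Rightarrow> 'a ell2"
  assumes F: "finite F"
  shows "(\<Sum>n\<in>F. (inner Y (elementary_tensor (v(\<mu> := unit_ell2 n))))\<^sup>2) \<le>
    (norm Y * (\<Prod>\<nu>\<in>- {\<mu>}. norm (v \<nu>)))\<^sup>2"
proof -
  interpret T: bounded_linear "\<lambda>a. elementary_tensor (v(\<mu> := a))"
    by (rule bounded_linear_elementary_tensor_slot)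
  define q where "q n = inner Y (elementary_tensor (v(\<mu> := unit_ell2 n)))" for n
  define u where "u = (\<Sum>n\<in>F. q n *\<^sub>R unit_ell2 n)"
  define A where "A = norm Y * (\<Prod>\<nu>\<in>- {\<mu>}. norm (v \<nu>))"
  have A: "0 \<le> A" by (simp add: A_def prod_nonneg)
  have cu: "coord u n = (if n \<in> F then q n else 0)" for n
  proof -
    have "coord u n = (\<Sum>m\<in>F. q m * (if n = m then 1 else 0))"
      by (simp add: u_def coord_sum scaleR_ell2.rep_eq unit_ell2.rep_eq)
    then show ?thesis using F by (simp add: if_distrib cong: if_cong)
  qed
  have nu: "(norm u)\<^sup>2 = (\<Sum>n\<in>F. (q n)\<^sup>2)"
  proof -
    have "(norm u)\<^sup>2 = (\<Sum>\<^sub>\<infinity>n\<in>F. (q n)\<^sup>2)"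
      unfolding norm_ell2_square by (rule infsum_cong_neutral) (auto simp: cu)
    then show ?thesis using F by simp
  qed
  have "inner Y (elementary_tensor (v(\<mu> := u))) = (\<Sum>n\<in>F. (q n)\<^sup>2)"
    unfolding u_def T.sum T.scaleR inner_sum_right inner_scaleR_right
    by (simp add: q_def power2_eq_square)
  then have "(norm u)\<^sup>2 = inner Y (elementary_tensor (v(\<mu> := u)))" by (simp only: nu)
  also have "\<dots> \<le> norm Y * norm (elementary_tensor (v(\<mu> := u)))" by (rule norm_cauchy_schwarz)
  also have "\<dots> = A * norm u"
    unfolding norm_elementary_tensor by (simp only: prod_update[of "\<lambda>_. norm"] A_def mult_ac)
  finally have "norm u * norm u \<le> A * norm u" by (simp add: power2_eq_square)
  then have "norm u \<le> A" using A by (cases "norm u = 0") auto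
  then have "(norm u)\<^sup>2 \<le> A\<^sup>2" by (intro power_mono) auto
  then show ?thesis by (simp add: nu q_def A_def)
qed

text \<open>
  The product of \<open>Y\<close> with the transposes of \<open>v \<nu>\<close> in all modes except \<open>\<mu>\<close>: the adjoint of the bounded
  linear map that inserts a vector in mode \<open>\<mu>\<close> of an elementary tensor.
\<close>

lift_definition contract :: "'d::finite \<Rightarrow> ('d \<Rightarrow> 'a ell2) \<Rightarrow> ('d \<Rightarrow> 'a) ell2 \<Rightarrow> 'a ell2"
  is "\<lambda>\<mu> v Y n. inner Y (elementary_tensor (v(\<mu> := unit_ell2 n)))"
  by (rule nonneg_bounded_partial_sums_imp_summable_on)
    (auto simp: eventually_finite_subsets_at_top intro!: contraction_square_sum_le exI[of _ "{}"])

lemma bounded_linear_contract: "bounded_linear (contract \<mu> v)"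
proof
  fix Y Z and c :: real
  show "contract \<mu> v (Y + Z) = contract \<mu> v Y + contract \<mu> v Z"
    by (rule ell2_eqI) (simp add: contract.rep_eq plus_ell2.rep_eq inner_add_left)
  show "contract \<mu> v (c *\<^sub>R Y) = c *\<^sub>R contract \<mu> v Y"
    by (rule ell2_eqI) (simp add: contract.rep_eq scaleR_ell2.rep_eq)
  let ?A = "\<Prod>\<nu>\<in>- {\<mu>}. norm (v \<nu>)"
  have "norm (contract \<mu> v Y) \<le> norm Y * ?A" for Y
  proof -
    have "(norm (contract \<mu> v Y))\<^sup>2 \<le> (norm Y * ?A)\<^sup>2"
      unfolding norm_ell2_square
      by (rule infsum_le_finite_sums[OF summable_on_coord_square])
        (simp add: contract.rep_eq contraction_square_sum_le)
    then show ?thesis by (rule power2_le_imp_le) (simp add: prod_nonneg)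
  qed
  then show "\<exists>K. \<forall>Y. norm (contract \<mu> v Y) \<le> norm Y * K" by blast
qed

lemma contract_elementary_tensor:
  "contract \<mu> v (elementary_tensor w) = (\<Prod>\<nu>\<in>- {\<mu>}. inner (w \<nu>) (v \<nu>)) *\<^sub>R w \<mu>"
proof (rule ell2_eqI)
  fix n
  have "coord (contract \<mu> v (elementary_tensor w)) n =
      (\<Prod>\<nu>\<in>UNIV. inner (w \<nu>) ((v(\<mu> := unit_ell2 n)) \<nu>))"
    by (simp only: contract.rep_eq inner_elementary_tensor)
  also have "\<dots> = inner (w \<mu>) (unit_ell2 n) * (\<Prod>\<nu>\<in>- {\<mu>}. inner (w \<nu>) (v \<nu>))"
    by (rule prod_update[of "\<lambda>\<nu>. inner (w \<nu>)"])
  finally show "coord (contract \<mu> v (elementary_tensor w)) n =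
      coord ((\<Prod>\<nu>\<in>- {\<mu>}. inner (w \<nu>) (v \<nu>)) *\<^sub>R w \<mu>) n"
    by (simp add: inner_unit_ell2 scaleR_ell2.rep_eq mult.commute)
qed

lemma insert_mode_square_sum_le:
  fixes u :: "nat ell2" and Y :: "('d::finite \<Rightarrow> nat) ell2"
  assumes A: "finite A"
  shows "(\<Sum>\<alpha>\<in>A. (coord u (\<alpha> \<nu>) * coord Y (\<alpha>(\<nu> := 0)))\<^sup>2) \<le> (norm u * norm Y)\<^sup>2"
proof -
  let ?j = "\<lambda>\<alpha>. (\<alpha> \<nu>, \<alpha>(\<nu> := 0::nat))"
  have inj: "inj_on ?j A"
    by (rule inj_onI) (metis Pair_inject fun_upd_triv fun_upd_upd)
  have "(\<Sum>\<alpha>\<in>A. (coord u (\<alpha> \<nu>) * coord Y (\<alpha>(\<nu> := 0)))\<^sup>2) =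
      (\<Sum>(n, \<beta>)\<in>?j ` A. (coord u n)\<^sup>2 * (coord Y \<beta>)\<^sup>2)"
    using inj by (simp add: sum.reindex power_mult_distrib)
  also have "\<dots> \<le> (\<Sum>(n, \<beta>)\<in>(\<lambda>\<alpha>. \<alpha> \<nu>) ` A \<times> (\<lambda>\<alpha>. \<alpha>(\<nu> := 0)) ` A. (coord u n)\<^sup>2 * (coord Y \<beta>)\<^sup>2)"
    using A by (intro sum_mono2) auto
  also have "\<dots> = (\<Sum>n\<in>(\<lambda>\<alpha>. \<alpha> \<nu>) ` A. (coord u n)\<^sup>2) * (\<Sum>\<beta>\<in>(\<lambda>\<alpha>. \<alpha>(\<nu> := 0)) ` A. (coord Y \<beta>)\<^sup>2)"
    by (simp add: sum_product sum.cartesian_product)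
  also have "\<dots> \<le> (norm u)\<^sup>2 * (norm Y)\<^sup>2"
    using A by (intro mult_mono sum_coord_square_le) (auto intro: sum_nonneg)
  finally show ?thesis by (simp add: power_mult_distrib)
qed

text \<open>
  An elementary tensor depends multilinearly on one vector per mode. To reduce its differentiability to
  that of bilinear maps within one space, modes are filled one after the other: a tensor that is
  concentrated at 0 in mode \<open>\<nu>\<close> is multiplied with a vector in this mode. Of an
  arbitrary tensor the slice at 0 is used, which makes the operation bilinear.
\<close>

lift_definition insert_mode :: "'d::finite \<Rightarrow> nat ell2 \<Rightarrow> ('d \<Rightarrow> nat) ell2 \<Rightarrow> ('d \<Rightarrow> nat) ell2"
  is "\<lambda>\<nu> u Y \<alpha>. u (\<alpha> \<nu>) * Y (\<alpha>(\<nu> := 0))"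
proof -
  fix \<nu> :: 'd and u :: "nat \<Rightarrow> real" and Y :: "('d \<Rightarrow> nat) \<Rightarrow> real"
  assume u: "(\<lambda>i. (u i)\<^sup>2) summable_on UNIV" and Y: "(\<lambda>i. (Y i)\<^sup>2) summable_on UNIV"
  have "(\<Sum>\<alpha>\<in>A. (u (\<alpha> \<nu>) * Y (\<alpha>(\<nu> := 0)))\<^sup>2) \<le> (norm (Abs_ell2 u) * norm (Abs_ell2 Y))\<^sup>2"
    if "finite A" for A
    using insert_mode_square_sum_le[OF that, of "Abs_ell2 u" \<nu> "Abs_ell2 Y"] u Y by (simp add: Abs_ell2_inverse)
  then show "(\<lambda>\<alpha>. (u (\<alpha> \<nu>) * Y (\<alpha>(\<nu> := 0)))\<^sup>2) summable_on UNIV"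
    by (intro nonneg_bounded_partial_sums_imp_summable_on)
      (auto simp: eventually_finite_subsets_at_top intro!: exI[of _ "{}"])
qed

lemma bounded_bilinear_insert_mode: "bounded_bilinear (insert_mode \<nu>)"
proof
  fix u u' Y Y' and c :: real
  show "insert_mode \<nu> (u + u') Y = insert_mode \<nu> u Y + insert_mode \<nu> u' Y"
    "insert_mode \<nu> u (Y + Y') = insert_mode \<nu> u Y + insert_mode \<nu> u Y'"
    "insert_mode \<nu> (c *\<^sub>R u) Y = c *\<^sub>R insert_mode \<nu> u Y"
    "insert_mode \<nu> u (c *\<^sub>R Y) = c *\<^sub>R insert_mode \<nu> u Y"
    by (rule ell2_eqI; simp add: insert_mode.rep_eq plus_ell2.rep_eq scaleR_ell2.rep_eq algebra_simps)+
  have "norm (insert_mode \<nu> u Y) \<le> norm u * norm Y * 1" for u Y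
  proof -
    have "(norm (insert_mode \<nu> u Y))\<^sup>2 \<le> (norm u * norm Y)\<^sup>2"
      unfolding norm_ell2_square
      by (rule infsum_le_finite_sums[OF summable_on_coord_square])
        (simp add: insert_mode.rep_eq insert_mode_square_sum_le)
    then have "norm (insert_mode \<nu> u Y) \<le> norm u * norm Y" by (rule power2_le_imp_le) simp
    then show ?thesis by simp
  qed
  then show "\<exists>K. \<forall>u Y. norm (insert_mode \<nu> u Y) \<le> norm u * norm Y * K" by blast
qed

lemma insert_mode_elementary_tensor:
  assumes "w \<nu> = unit_ell2 0"
  shows "insert_mode \<nu> u (elementary_tensor w) = elementary_tensor (w(\<nu> := u))"
proof (rule ell2_eqI)
  fix \<alpha>
  have "coord (elementary_tensor w) (\<alpha>(\<nu> := 0)) = (\<Prod>\<mu>\<in>UNIV. coord (w \<mu>) ((\<alpha>(\<nu> := 0)) \<mu>))"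
    by (simp add: elementary_tensor.rep_eq)
  also have "\<dots> = coord (w \<nu>) 0 * (\<Prod>\<mu>\<in>- {\<nu>}. coord (w \<mu>) (\<alpha> \<mu>))"
    by (rule prod_update[of "\<lambda>\<mu>. coord (w \<mu>)"])
  finally show "coord (insert_mode \<nu> u (elementary_tensor w)) \<alpha> = coord (elementary_tensor (w(\<nu> := u))) \<alpha>"
    using assms by (simp add: insert_mode.rep_eq elementary_tensor_update_coord unit_ell2.rep_eq)
qed

definition fill_modes :: "'d set \<Rightarrow> ('d \<Rightarrow> nat ell2) \<Rightarrow> 'd \<Rightarrow> nat ell2"
  where "fill_modes I w \<mu> = (if \<mu> \<in> I then w \<mu> else unit_ell2 0)"

lemma elementary_tensor_fill_insert:
  assumes "\<nu> \<notin> I"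
  shows "elementary_tensor (fill_modes (insert \<nu> I) w) = insert_mode \<nu> (w \<nu>) (elementary_tensor (fill_modes I w))"
proof -
  have "fill_modes (insert \<nu> I) w = (fill_modes I w)(\<nu> := w \<nu>)" by (auto simp: fill_modes_def)
  then show ?thesis using assms by (simp add: insert_mode_elementary_tensor fill_modes_def)
qed

lemma fill_modes_UNIV: "fill_modes UNIV w = w"
  by (simp add: fun_eq_iff fill_modes_def)

text \<open>
  The product rule, by induction on the set of modes that are filled.
\<close>

lemma has_vector_derivative_elementary_tensor:
  fixes w :: "'d::finite \<Rightarrow> real \<Rightarrow> nat ell2"
  assumes w: "\<And>\<mu>. (w \<mu> has_vector_derivative w' \<mu>) (at (t::real))"
  shows "((\<lambda>t. elementary_tensor (\<lambda>\<mu>. w \<mu> t)) has_vector_derivative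
    (\<Sum>\<mu>\<in>UNIV. elementary_tensor ((\<lambda>\<nu>. w \<nu> t)(\<mu> := w' \<mu>)))) (at t)"
proof -
  have "((\<lambda>t. elementary_tensor (fill_modes I (\<lambda>\<mu>. w \<mu> t))) has_vector_derivative
    (\<Sum>\<mu>\<in>I. elementary_tensor (fill_modes I ((\<lambda>\<nu>. w \<nu> t)(\<mu> := w' \<mu>))))) (at t)" for I
    using finite[of I]
  proof (induction I)
    case empty
    have "fill_modes {} w = (\<lambda>_. unit_ell2 0)" for w :: "'d \<Rightarrow> nat ell2"
      by (simp add: fun_eq_iff fill_modes_def)
    then show ?case by (simp only: sum.empty has_vector_derivative_const)
  next
    case (insert \<nu> I)
    interpret bounded_bilinear "insert_mode \<nu>" by (rule bounded_bilinear_insert_mode)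
    have nu: "elementary_tensor (fill_modes (insert \<nu> I) ((\<lambda>\<mu>. w \<mu> t)(\<nu> := w' \<nu>))) =
      insert_mode \<nu> (w' \<nu>) (elementary_tensor (fill_modes I (\<lambda>\<mu>. w \<mu> t)))"
    proof -
      have "fill_modes I ((\<lambda>\<mu>. w \<mu> t)(\<nu> := w' \<nu>)) = fill_modes I (\<lambda>\<mu>. w \<mu> t)"
        using insert.hyps(2) by (simp add: fun_eq_iff fill_modes_def)
      then show ?thesis by (simp only: elementary_tensor_fill_insert[OF insert.hyps(2)] fun_upd_same)
    qed
    have rest: "elementary_tensor (fill_modes (insert \<nu> I) ((\<lambda>\<mu>. w \<mu> t)(\<mu> := w' \<mu>))) =
      insert_mode \<nu> (w \<nu> t) (elementary_tensor (fill_modes I ((\<lambda>\<mu>. w \<mu> t)(\<mu> := w' \<mu>))))"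
      if "\<mu> \<in> I" for \<mu>
    proof -
      have "((\<lambda>\<mu>. w \<mu> t)(\<mu> := w' \<mu>)) \<nu> = w \<nu> t" using that insert.hyps(2) by auto
      then show ?thesis by (simp only: elementary_tensor_fill_insert[OF insert.hyps(2)])
    qed
    have sum: "(\<Sum>\<mu>\<in>insert \<nu> I. elementary_tensor (fill_modes (insert \<nu> I) ((\<lambda>\<nu>. w \<nu> t)(\<mu> := w' \<mu>)))) =
      insert_mode \<nu> (w \<nu> t) (\<Sum>\<mu>\<in>I. elementary_tensor (fill_modes I ((\<lambda>\<nu>. w \<nu> t)(\<mu> := w' \<mu>)))) +
      insert_mode \<nu> (w' \<nu>) (elementary_tensor (fill_modes I (\<lambda>\<mu>. w \<mu> t)))"
      unfolding sum.insert[OF insert.hyps] nu sum_right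
      by (subst add.commute, rule arg_cong2[where f = "(+)", OF sum.cong[OF refl rest] refl])
    show ?case
      unfolding sum unfolding elementary_tensor_fill_insert[OF insert.hyps(2)]
      by (rule has_vector_derivative[OF w insert.IH])
  qed
  from this[of UNIV] show ?thesis by (simp only: fill_modes_UNIV)
qed


section \<open>Invertible matrices of variable size\<close>

text \<open>
  Square matrices of the variable size \<open>n\<close> are studied as blocks of matrices indexed by a finite
  type, at the positions \<open>a k\<close> with \<open>k < n\<close>. If the block is not coupled to the other positions, then inverting
  the whole matrix inverts the block.
\<close>

lemma invertible_upto_of_embedding:
  fixes a :: "nat \<Rightarrow> 'i::finite" and P Q :: "real ^ 'i ^ 'i"
  assumes inj: "inj_on a {..<n}"
    and PQ: "P ** Q = mat 1" "Q ** P = mat 1"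
    and rows: "\<And>k j. k < n \<Longrightarrow> j \<notin> a ` {..<n} \<Longrightarrow> P $ a k $ j = 0"
    and columns: "\<And>k j. k < n \<Longrightarrow> j \<notin> a ` {..<n} \<Longrightarrow> P $ j $ a k = 0"
    and kl: "k < n" "l < n"
  shows "(\<Sum>m<n. P $ a k $ a m * Q $ a m $ a l) = (if k = l then 1 else 0)"
    "(\<Sum>m<n. Q $ a k $ a m * P $ a m $ a l) = (if k = l then 1 else 0)"
proof -
  have reindex: "(\<Sum>m<n. f (a m)) = (\<Sum>j\<in>UNIV. f j)"
    if f: "\<And>j. j \<notin> a ` {..<n} \<Longrightarrow> f j = 0" for f :: "'i \<Rightarrow> real"
  proof -
    have "(\<Sum>m<n. f (a m)) = (\<Sum>j\<in>a ` {..<n}. f j)" by (simp only: sum.reindex[OF inj] o_def)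
    also have "\<dots> = (\<Sum>j\<in>UNIV. f j)" by (rule sum.mono_neutral_left) (simp_all add: f)
    finally show ?thesis .
  qed
  have akl: "a k = a l \<longleftrightarrow> k = l" using inj kl by (auto simp: inj_on_eq_iff)
  have "(\<Sum>m<n. P $ a k $ a m * Q $ a m $ a l) = (\<Sum>j\<in>UNIV. P $ a k $ j * Q $ j $ a l)"
    by (rule reindex, subst rows[OF kl(1)]) auto
  also have "\<dots> = (P ** Q) $ a k $ a l" by (simp add: matrix_matrix_mult_def)
  finally show "(\<Sum>m<n. P $ a k $ a m * Q $ a m $ a l) = (if k = l then 1 else 0)"
    using akl by (simp add: PQ mat_def)
  have "(\<Sum>m<n. Q $ a k $ a m * P $ a m $ a l) = (\<Sum>j\<in>UNIV. Q $ a k $ j * P $ j $ a l)"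
    by (rule reindex, subst columns[OF kl(2)]) auto
  also have "\<dots> = (Q ** P) $ a k $ a l" by (simp add: matrix_matrix_mult_def)
  finally show "(\<Sum>m<n. Q $ a k $ a m * P $ a m $ a l) = (if k = l then 1 else 0)"
    using akl by (simp add: PQ mat_def)
qed

text \<open>
  The matrix is completed by the identity outside the block.
\<close>

lemma invertible_uptoI_injective:
  fixes a :: "nat \<Rightarrow> 'i::finite"
  assumes inj: "inj_on a {..<n}"
    and T: "\<And>x l. (\<And>k. k < n \<Longrightarrow> (\<Sum>l<n. T k l * x l) = 0) \<Longrightarrow> l < n \<Longrightarrow> x l = 0"
  shows "invertible_upto n T"
proof -
  let ?S = "a ` {..<n}" and ?b = "the_inv_into {..<n} a"
  have ba: "?b (a k) = k" if "k < n" for k using that inj by (simp add: the_inv_into_f_f)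
  define P :: "real ^ 'i ^ 'i" where "P = (\<chi> i j. if i \<in> ?S \<and> j \<in> ?S then T (?b i) (?b j) else if i = j then 1 else 0)"
  have Pa: "P $ a k $ a l = T k l" if "k < n" "l < n" for k l
    using that by (simp add: P_def ba)
  have rows: "P $ a k $ j = 0" and columns: "P $ j $ a k = 0" if "k < n" "j \<notin> ?S" for k j
    using that by (auto simp: P_def)
  have "x = 0" if x: "P *v x = 0" for x
  proof -
    have sum: "(\<Sum>j\<in>UNIV. P $ i $ j * x $ j) = 0" for i
      using x by (simp add: matrix_vector_mult_def vec_eq_iff)
    have "x $ a l = 0" if "l < n" for l
    proof (rule T[of "\<lambda>l. x $ a l", OF _ that])
      fix k assume k: "k < n"
      have "(\<Sum>l<n. T k l * x $ a l) = (\<Sum>j\<in>?S. P $ a k $ j * x $ j)"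
        using inj k by (simp add: sum.reindex Pa)
      also have "\<dots> = (\<Sum>j\<in>UNIV. P $ a k $ j * x $ j)"
        using k by (intro sum.mono_neutral_left) (auto simp: rows)
      finally show "(\<Sum>l<n. T k l * x $ a l) = 0" using sum by simp
    qed
    moreover have "x $ i = 0" if i: "i \<notin> ?S" for i
    proof -
      have "(\<Sum>j\<in>UNIV. P $ i $ j * x $ j) = (\<Sum>j\<in>UNIV. if j = i then x $ j else 0)"
        using i by (intro sum.cong) (auto simp: P_def)
      then show ?thesis using sum[of i] by simp
    qed
    ultimately have "x $ i = 0" for i by (cases "i \<in> ?S") auto
    then show "x = 0" by (simp add: vec_eq_iff)
  qed
  then have "inj ((*v) P)"
    by (simp add: linear_injective_0 matrix_vector_mul_linear)
  then obtain Q where Q: "Q ** P = mat 1" using matrix_left_invertible_injective by blast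
  then have Q': "P ** Q = mat 1" using matrix_left_right_inverse by blast
  show ?thesis
    unfolding invertible_upto_def
  proof (intro exI[of _ "\<lambda>k l. Q $ a k $ a l"] conjI allI impI)
    fix k l assume kl: "k < n" "l < n"
    have "(\<Sum>m<n. P $ a k $ a m * Q $ a m $ a l) = (if k = l then 1 else 0)"
      by (rule invertible_upto_of_embedding(1)[OF inj Q' Q]) (use rows columns kl in auto)
    then show "(\<Sum>m<n. T k m * Q $ a m $ a l) = (if k = l then 1 else 0)"
      using kl by (simp add: Pa)
    have "(\<Sum>m<n. Q $ a k $ a m * P $ a m $ a l) = (if k = l then 1 else 0)"
      by (rule invertible_upto_of_embedding(2)[OF inj Q' Q]) (use rows columns kl in auto)
    then show "(\<Sum>m<n. Q $ a k $ a m * T m l) = (if k = l then 1 else 0)"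
      using kl by (simp add: Pa)
  qed
qed

lemma invertible_uptoI_right_inverse:
  fixes a :: "nat \<Rightarrow> 'i::finite"
  assumes inj: "inj_on a {..<n}"
    and TZ: "\<And>k l. k < n \<Longrightarrow> l < n \<Longrightarrow> (\<Sum>m<n. T k m * Z m l) = (if k = l then 1 else 0)"
  shows "invertible_upto n T"
proof -
  have "invertible_upto n (\<lambda>k l. T l k)"
  proof (rule invertible_uptoI_injective[OF inj])
    fix x l assume x: "\<And>k. k < n \<Longrightarrow> (\<Sum>l<n. T l k * x l) = 0" and l: "l < n"
    have "x l = (\<Sum>k<n. x k * (if k = l then 1 else 0))"
      using l by (simp add: if_distrib cong: if_cong)
    also have "\<dots> = (\<Sum>k<n. x k * (\<Sum>m<n. T k m * Z m l))" using l by (intro sum.cong refl) (simp add: TZ)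
    also have "\<dots> = (\<Sum>m<n. (\<Sum>k<n. T k m * x k) * Z m l)"
      unfolding sum_distrib_left sum_distrib_right by (subst sum.swap) (simp add: mult_ac)
    also have "\<dots> = 0" by (simp add: x)
    finally show "x l = 0" .
  qed
  then obtain B where
    B: "\<And>i j. i < n \<Longrightarrow> j < n \<Longrightarrow> (\<Sum>k<n. T k i * B k j) = (if i = j then 1 else 0)"
    "\<And>i j. i < n \<Longrightarrow> j < n \<Longrightarrow> (\<Sum>k<n. B i k * T j k) = (if i = j then 1 else 0)"
    unfolding invertible_upto_def by blast
  show ?thesis
    unfolding invertible_upto_def
  proof (intro exI[of _ "\<lambda>i j. B j i"] conjI allI impI)
    fix i j assume ij: "i < n" "j < n"
    show "(\<Sum>k<n. T i k * B j k) = (if i = j then 1 else 0)"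
      using B(2)[OF ij(2,1)] by (auto simp: mult.commute split: if_splits)
    show "(\<Sum>k<n. B k i * T k j) = (if i = j then 1 else 0)"
      using B(1)[OF ij(2,1)] by (auto simp: mult.commute split: if_splits)
  qed
qed

section \<open>The core and the factors of a tensor\<close>

text \<open>
  The position of row \<open>k\<close> in the padded \<open>\<mu>\<close>-th matricization.
\<close>

definition mode_index :: "('i::finite \<Rightarrow> 'd::finite \<Rightarrow> nat) \<Rightarrow> 'd \<Rightarrow> nat \<Rightarrow> 'i"
  where "mode_index idx \<mu> k = inv idx (\<lambda>\<nu>. if \<nu> = \<mu> then k else 0)"

locale index_box =
  fixes r :: "'d::finite \<Rightarrow> nat" and idx :: "'i::finite \<Rightarrow> 'd \<Rightarrow> nat"
  assumes r_pos: "0 < r \<mu>" and idx: "enumerates_box r idx"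
begin

lemma inj_idx: "inj idx" and range_idx: "range idx = {\<alpha>. \<forall>\<mu>. \<alpha> \<mu> < r \<mu>}"
  using idx by (simp_all add: enumerates_box_def bij_betw_def)

lemma idx_less: "idx i \<mu> < r \<mu>"
  using range_idx by (metis (mono_tags) mem_Collect_eq rangeI)

lemma idx_inv: "(\<And>\<mu>. \<alpha> \<mu> < r \<mu>) \<Longrightarrow> idx (inv idx \<alpha>) = \<alpha>"
  using range_idx by (intro f_inv_into_f) auto

lemma inv_idx: "inv idx (idx i) = i"
  using inj_idx by simp

abbreviation ax where "ax \<equiv> mode_index idx"

lemma idx_ax: "k < r \<mu> \<Longrightarrow> idx (ax \<mu> k) = (\<lambda>\<nu>. if \<nu> = \<mu> then k else 0)"
  unfolding mode_index_def by (rule idx_inv) (simp add: r_pos)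

lemma inj_ax: "inj_on (ax \<mu>) {..<r \<mu>}"
  by (rule inj_onI) (metis idx_ax lessThan_iff)

lemma ax_eq_iff: "k < r \<mu> \<Longrightarrow> l < r \<mu> \<Longrightarrow> ax \<mu> k = ax \<mu> l \<longleftrightarrow> k = l"
  by (simp add: inj_on_eq_iff[OF inj_ax])

lemma matricization_ax:
  assumes "k < r \<mu>"
  shows "matricization idx \<mu> e $ ax \<mu> k $ j =
    (if idx j \<mu> = 0 then e $ inv idx ((idx j)(\<mu> := k)) else 0)"
  using assms by (simp add: matricization_def idx_ax entry_def)

lemma matricization_zero_row:
  assumes "i \<notin> ax \<mu> ` {..<r \<mu>}"
  shows "matricization idx \<mu> e $ i = 0"
proof -
  have "\<not> (\<forall>\<nu>. \<nu> \<noteq> \<mu> \<longrightarrow> idx i \<nu> = 0)"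
  proof
    assume *: "\<forall>\<nu>. \<nu> \<noteq> \<mu> \<longrightarrow> idx i \<nu> = 0"
    have "idx i = (\<lambda>\<nu>. if \<nu> = \<mu> then idx i \<mu> else 0)" using * by auto
    then have "i = ax \<mu> (idx i \<mu>)" unfolding mode_index_def by (metis inv_idx)
    with assms idx_less show False by blast
  qed
  then show ?thesis by (auto simp: matricization_def vec_eq_iff)
qed

lemma sum_fibre:
  fixes f :: "'i \<Rightarrow> 'b::comm_monoid_add"
  shows "(\<Sum>i | \<forall>\<nu>\<in>- {\<mu>}. idx i \<nu> = idx j \<nu>. f i) = (\<Sum>m<r \<mu>. f (inv idx ((idx j)(\<mu> := m))))"
proof (rule sum.reindex_bij_witness[where i = "\<lambda>m. inv idx ((idx j)(\<mu> := m))" and j = "\<lambda>i. idx i \<mu>"])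
  fix m assume "m \<in> {..<r \<mu>}"
  then have "idx (inv idx ((idx j)(\<mu> := m))) = (idx j)(\<mu> := m)"
    by (intro idx_inv) (auto simp: idx_less)
  then show "inv idx ((idx j)(\<mu> := m)) \<in> {i. \<forall>\<nu>\<in>- {\<mu>}. idx i \<nu> = idx j \<nu>}"
    "idx (inv idx ((idx j)(\<mu> := m))) \<mu> = m" by auto
next
  fix i assume i: "i \<in> {i. \<forall>\<nu>\<in>- {\<mu>}. idx i \<nu> = idx j \<nu>}"
  then have "(idx j)(\<mu> := idx i \<mu>) = idx i" by (auto simp: fun_eq_iff)
  then show "inv idx ((idx j)(\<mu> := idx i \<mu>)) = i" "f (inv idx ((idx j)(\<mu> := idx i \<mu>))) = f i"
    by (simp_all add: inv_idx)
  show "idx i \<mu> \<in> {..<r \<mu>}" by (simp add: idx_less)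
qed

lemma tucker_cong:
  assumes "\<And>\<mu> k. k < r \<mu> \<Longrightarrow> w \<mu> k = w' \<mu> k"
  shows "tucker idx e w = tucker idx e w'"
  using assms by (simp add: tucker_def idx_less)

lemma core_mult_cong:
  assumes "\<And>\<mu> k l. k < r \<mu> \<Longrightarrow> l < r \<mu> \<Longrightarrow> T \<mu> k l = T' \<mu> k l"
  shows "core_mult idx e T = core_mult idx e T'"
  using assms by (simp add: core_mult_def idx_less)

lemma core_mult_id: "core_mult idx e (\<lambda>\<mu> k l. if k = l then 1 else 0) = e"
proof -
  have P: "(\<Prod>\<mu>\<in>UNIV. if idx i \<mu> = idx j \<mu> then 1 else (0::real)) = (if i = j then 1 else 0)" for i j
  proof (cases "i = j")
    case False
    then obtain \<mu> where "idx i \<mu> \<noteq> idx j \<mu>" using inj_idx by (auto simp: inj_def fun_eq_iff)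
    then show ?thesis using False by (auto intro!: prod_zero)
  qed simp
  show ?thesis
    unfolding core_mult_def P by (simp add: vec_eq_iff if_distrib[of "\<lambda>c. c * _"] cong: if_cong)
qed

text \<open>
  Change of basis: a transformation of the core can be shifted to the factors.
\<close>

lemma tucker_core_mult:
  "tucker idx (core_mult idx e T) w = tucker idx e (\<lambda>\<mu> k. \<Sum>l<r \<mu>. T \<mu> l k *\<^sub>R w \<mu> l)"
proof (rule ell2_eqI)
  fix \<alpha>
  have "coord (tucker idx e (\<lambda>\<mu> k. \<Sum>l<r \<mu>. T \<mu> l k *\<^sub>R w \<mu> l)) \<alpha> =
     (\<Sum>i\<in>UNIV. e $ i * (\<Prod>\<mu>\<in>UNIV. \<Sum>l<r \<mu>. T \<mu> l (idx i \<mu>) * coord (w \<mu> l) (\<alpha> \<mu>)))"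
    by (simp add: tucker_def coord_sum scaleR_ell2.rep_eq elementary_tensor.rep_eq)
  also have "\<dots> = (\<Sum>i\<in>UNIV. e $ i * (\<Sum>j\<in>UNIV. \<Prod>\<mu>\<in>UNIV. T \<mu> (idx j \<mu>) (idx i \<mu>) * coord (w \<mu> (idx j \<mu>)) (\<alpha> \<mu>)))"
  proof (intro sum.cong refl arg_cong2[where f = "(*)"])
    fix i
    have "(\<Prod>\<mu>\<in>UNIV. \<Sum>l<r \<mu>. T \<mu> l (idx i \<mu>) * coord (w \<mu> l) (\<alpha> \<mu>)) =
      (\<Sum>\<beta>\<in>range idx. \<Prod>\<mu>\<in>UNIV. T \<mu> (\<beta> \<mu>) (idx i \<mu>) * coord (w \<mu> (\<beta> \<mu>)) (\<alpha> \<mu>))"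
      unfolding range_idx by (subst prod_sum_PiE) (auto intro!: sum.cong simp: PiE_iff)
    also have "\<dots> = (\<Sum>j\<in>UNIV. \<Prod>\<mu>\<in>UNIV. T \<mu> (idx j \<mu>) (idx i \<mu>) * coord (w \<mu> (idx j \<mu>)) (\<alpha> \<mu>))"
      by (simp only: sum.reindex[OF inj_idx] o_def)
    finally show "(\<Prod>\<mu>\<in>UNIV. \<Sum>l<r \<mu>. T \<mu> l (idx i \<mu>) * coord (w \<mu> l) (\<alpha> \<mu>)) = \<dots>" .
  qed
  also have "\<dots> = (\<Sum>j\<in>UNIV. (\<Sum>i\<in>UNIV. (\<Prod>\<mu>\<in>UNIV. T \<mu> (idx j \<mu>) (idx i \<mu>)) * e $ i) *
      (\<Prod>\<mu>\<in>UNIV. coord (w \<mu> (idx j \<mu>)) (\<alpha> \<mu>)))"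
    unfolding prod.distrib sum_distrib_left sum_distrib_right
    by (subst sum.swap) (simp add: mult_ac)
  also have "\<dots> = coord (tucker idx (core_mult idx e T) w) \<alpha>"
    by (simp add: tucker_def core_mult_def coord_sum scaleR_ell2.rep_eq elementary_tensor.rep_eq)
  finally show "coord (tucker idx (core_mult idx e T) w) \<alpha> =
      coord (tucker idx e (\<lambda>\<mu> k. \<Sum>l<r \<mu>. T \<mu> l k *\<^sub>R w \<mu> l)) \<alpha>" ..
qed

text \<open>
  All rows other than the \<open>r \<mu>\<close> rows at the positions \<open>ax \<mu> k\<close> vanish, so rank \<open>r \<mu>\<close> forces
  these to be distinct and linearly independent. A linear map that sends them to different unit vectors provides the columns of a right inverse.
\<close>

lemma full_rank_right_inverse:
  assumes "rank (matricization idx \<mu> e) = r \<mu>"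
  shows "\<exists>B :: real ^ 'i ^ 'i. (\<forall>j i. i \<notin> ax \<mu> ` {..<r \<mu>} \<longrightarrow> B $ j $ i = 0) \<and>
    (\<forall>k<r \<mu>. \<forall>l<r \<mu>. (matricization idx \<mu> e ** B) $ ax \<mu> k $ ax \<mu> l = (if k = l then 1 else 0))"
proof -
  let ?A = "matricization idx \<mu> e" and ?I = "ax \<mu> ` {..<r \<mu>}"
  define row where "row k = ?A $ ax \<mu> k" for k
  let ?S = "row ` {..<r \<mu>}"
  have "rows ?A \<subseteq> span ?S"
  proof
    fix x assume "x \<in> rows ?A"
    then obtain i where x: "x = ?A $ i" by (auto simp: rows_def Finite_Cartesian_Product.row_def vec_nth_inverse)
    show "x \<in> span ?S"
    proof (cases "i \<in> ?I")
      case True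
      then show ?thesis by (auto simp: x row_def intro!: span_base)
    next
      case False
      then show ?thesis by (simp add: x matricization_zero_row span_zero)
    qed
  qed
  then have "r \<mu> \<le> dim ?S"
    using assms unfolding row_rank_def by (metis dim_span dim_subset)
  moreover have "dim ?S \<le> card ?S" by (simp add: dim_le_card')
  moreover have card: "card ?S \<le> r \<mu>" using card_image_le[of "{..<r \<mu>}" row] by simp
  ultimately have "card ?S \<le> dim ?S" and cardS: "card ?S = card {..<r \<mu>}" by auto
  then have ind: "independent ?S" by (intro card_le_dim_spanning[of ?S ?S]) (auto intro: span_base)
  have inj: "inj_on row {..<r \<mu>}" using cardS by (simp add: eq_card_imp_inj_on)
  obtain g where g: "linear g" "\<And>x. x \<in> ?S \<Longrightarrow> g x = (axis (ax \<mu> (the_inv_into {..<r \<mu>} row x)) 1 :: real ^ 'i)"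
    using linear_independent_extend[OF ind, of "\<lambda>x. axis (ax \<mu> (the_inv_into {..<r \<mu>} row x)) 1"] by blast
  have grow: "g (row k) = axis (ax \<mu> k) 1" if "k < r \<mu>" for k
    using g(2)[of "row k"] that inj by (simp add: the_inv_into_f_f)
  define B :: "real ^ 'i ^ 'i" where "B = (\<chi> j i. if i \<in> ?I then g (axis j 1) $ i else 0)"
  have "(?A ** B) $ ax \<mu> k $ ax \<mu> l = (if k = l then 1 else 0)" if kl: "k < r \<mu>" "l < r \<mu>" for k l
  proof -
    have "(?A ** B) $ ax \<mu> k $ ax \<mu> l = (\<Sum>j\<in>UNIV. row k $ j * g (axis j 1) $ ax \<mu> l)"
      using kl by (simp add: matrix_matrix_mult_def B_def row_def)
    also have "\<dots> = g (\<Sum>j\<in>UNIV. row k $ j *\<^sub>R axis j 1) $ ax \<mu> l"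
      by (simp add: linear_sum[OF g(1)] linear_cmul[OF g(1)] sum_component)
    also have "(\<Sum>j\<in>UNIV. row k $ j *\<^sub>R axis j 1) = row k"
      using basis_expansion[of "row k"] by (simp add: scalar_mult_eq_scaleR)
    finally show ?thesis using kl by (simp add: grow axis_def ax_eq_iff)
  qed
  then show ?thesis by (intro exI[of _ B]) (auto simp: B_def)
qed

end

text \<open>
  The columns of \<open>V \<mu>\<close> are dual to those of \<open>U \<mu>\<close>, and \<open>B \<mu>\<close> is a right inverse of the matricization of \<open>C\<close>
  at the positions of its rows. Columns of \<open>B \<mu>\<close> at other positions are required to vanish in order
  that products with \<open>B \<mu>\<close> are supported on the block of these positions.
\<close>

locale tucker_chart = index_box r idx
  for r :: "'d::finite \<Rightarrow> nat" and idx :: "'i::finite \<Rightarrow> 'd \<Rightarrow> nat" +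
  fixes C :: "real ^ 'i" and U V :: "'d \<Rightarrow> nat \<Rightarrow> nat ell2" and B :: "'d \<Rightarrow> real ^ 'i ^ 'i"
  assumes VU: "k < r \<mu> \<Longrightarrow> l < r \<mu> \<Longrightarrow> inner (V \<mu> k) (U \<mu> l) = (if k = l then 1 else 0)"
    and B_zero: "i \<notin> mode_index idx \<mu> ` {..<r \<mu>} \<Longrightarrow> B \<mu> $ j $ i = 0"
    and B_inverse: "k < r \<mu> \<Longrightarrow> l < r \<mu> \<Longrightarrow>
      (matricization idx \<mu> C ** B \<mu>) $ mode_index idx \<mu> k $ mode_index idx \<mu> l = (if k = l then 1 else 0)"
begin

definition core :: "('d \<Rightarrow> nat) ell2 \<Rightarrow> real ^ 'i"
  where "core Y = (\<chi> i. inner Y (elementary_tensor (\<lambda>\<mu>. V \<mu> (idx i \<mu>))))"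

text \<open>
  The oblique projection along the span of \<open>U \<mu>\<close> onto the vectors annihilated by \<open>V \<mu>\<close>.
\<close>

definition perp :: "'d \<Rightarrow> nat ell2 \<Rightarrow> nat ell2"
  where "perp \<mu> x = x - (\<Sum>l<r \<mu>. inner (V \<mu> l) x *\<^sub>R U \<mu> l)"

text \<open>
  The second linear coordinate of a tensor, besides its core: for \<open>Y = tucker idx e (U + K)\<close> with
  \<open>V\<close>-orthogonal \<open>K\<close>, the matrix \<open>W \<mu>\<close> is \<open>K \<mu>\<close> times the matrix \<open>block \<mu> e\<close> below. Columns
  from \<open>r \<mu>\<close> on are set to 0 so that they agree for all tensors.
\<close>

definition W :: "'d \<Rightarrow> nat \<Rightarrow> ('d \<Rightarrow> nat) ell2 \<Rightarrow> nat ell2"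
  where "W \<mu> k Y = (if k < r \<mu> then
    \<Sum>j | idx j \<mu> = 0. B \<mu> $ j $ ax \<mu> k *\<^sub>R perp \<mu> (contract \<mu> (\<lambda>\<nu>. V \<nu> (idx j \<nu>)) Y) else 0)"

definition off_block :: "'d \<Rightarrow> real ^ 'i ^ 'i"
  where "off_block \<mu> = (\<chi> i j. if i = j \<and> i \<notin> ax \<mu> ` {..<r \<mu>} then 1 else 0)"

text \<open>
  The matrix that relates \<open>W \<mu>\<close> to the factor \<open>K \<mu>\<close> if the core is \<open>e\<close>, completed by the identity to a
  matrix on the whole index type.
\<close>

definition block :: "'d \<Rightarrow> real ^ 'i \<Rightarrow> real ^ 'i ^ 'i"
  where "block \<mu> e = matricization idx \<mu> e ** B \<mu> + off_block \<mu>"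

text \<open>
  The deviation of the factors from \<open>U\<close>, recovered from \<open>W\<close> by inverting \<open>block\<close>.
\<close>

definition K :: "real ^ 'i \<Rightarrow> ('d \<Rightarrow> nat) ell2 \<Rightarrow> 'd \<Rightarrow> nat \<Rightarrow> nat ell2"
  where "K e Y \<mu> k = (\<Sum>l<r \<mu>. matrix_inv (block \<mu> e) $ ax \<mu> l $ ax \<mu> k *\<^sub>R W \<mu> l Y)"

text \<open>
  The tensor with core \<open>e\<close> whose coordinates \<open>W\<close> are those of \<open>Y\<close>; nothing else of \<open>Y\<close> enters.
\<close>

definition param :: "real ^ 'i \<Rightarrow> ('d \<Rightarrow> nat) ell2 \<Rightarrow> ('d \<Rightarrow> nat) ell2"
  where "param e Y = tucker idx e (\<lambda>\<mu> k. U \<mu> k + K e Y \<mu> k)"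

text \<open>
  The linearization of \<open>param\<close> at \<open>C\<close> in the direction of the coordinates \<open>W\<close>. It is a linear right inverse of
  these coordinates, with values of core 0.
\<close>

definition lift :: "('d \<Rightarrow> nat) ell2 \<Rightarrow> ('d \<Rightarrow> nat) ell2"
  where "lift Y = (\<Sum>\<mu>\<in>UNIV. tucker idx C (U(\<mu> := \<lambda>k. W \<mu> k Y)))"

definition regular :: "(real ^ 'i) set"
  where "regular = {e. \<forall>\<mu>. det (block \<mu> e) \<noteq> 0}"

text \<open>
  The normalization of the factors that makes the representation of a tensor unique: then the core
  of \<open>tucker idx e w\<close> is \<open>e\<close> itself.
\<close>

definition dual_frame :: "('d \<Rightarrow> nat \<Rightarrow> nat ell2) \<Rightarrow> bool"
  where "dual_frame w \<longleftrightarrow>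
    (\<forall>\<mu>. \<forall>k<r \<mu>. \<forall>l<r \<mu>. inner (V \<mu> k) (w \<mu> l) = (if k = l then 1 else 0))"

lemma block_ax: "k < r \<mu> \<Longrightarrow> block \<mu> e $ ax \<mu> k $ j = (matricization idx \<mu> e ** B \<mu>) $ ax \<mu> k $ j"
  by (simp add: block_def off_block_def)

lemma block_row_zero: "k < r \<mu> \<Longrightarrow> j \<notin> ax \<mu> ` {..<r \<mu>} \<Longrightarrow> block \<mu> e $ ax \<mu> k $ j = 0"
  by (simp add: block_ax matrix_matrix_mult_def B_zero)

lemma block_column_zero: "k < r \<mu> \<Longrightarrow> j \<notin> ax \<mu> ` {..<r \<mu>} \<Longrightarrow> block \<mu> e $ j $ ax \<mu> k = 0"
  by (auto simp: block_def off_block_def matrix_matrix_mult_def matricization_zero_row)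

lemma block_C: "block \<mu> C = mat 1"
proof -
  have "block \<mu> C $ i $ j = (if i = j then 1 else 0)" for i j
  proof (cases "i \<in> ax \<mu> ` {..<r \<mu>}")
    case True
    then obtain k where k: "k < r \<mu>" "i = ax \<mu> k" by auto
    show ?thesis
    proof (cases "j \<in> ax \<mu> ` {..<r \<mu>}")
      case True
      then obtain l where "l < r \<mu>" "j = ax \<mu> l" by auto
      with k show ?thesis by (simp add: block_ax B_inverse ax_eq_iff)
    next
      case False
      with k show ?thesis by (auto simp: block_row_zero)
    qed
  next
    case False
    then show ?thesis by (auto simp: block_def off_block_def matrix_matrix_mult_def matricization_zero_row)
  qed
  then show ?thesis by (simp add: vec_eq_iff mat_def)
qed

lemma C_regular: "C \<in> regular"
  by (simp add: regular_def block_C)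

lemma matrix_inv_block:
  assumes "e \<in> regular"
  shows "block \<mu> e ** matrix_inv (block \<mu> e) = mat 1" "matrix_inv (block \<mu> e) ** block \<mu> e = mat 1"
proof -
  have "invertible (block \<mu> e)" using assms by (simp add: regular_def invertible_det_nz)
  then have "\<exists>A'. block \<mu> e ** A' = mat 1 \<and> A' ** block \<mu> e = mat 1" by (simp add: invertible_def)
  from someI_ex[OF this]
  show "block \<mu> e ** matrix_inv (block \<mu> e) = mat 1" "matrix_inv (block \<mu> e) ** block \<mu> e = mat 1"
    by (simp_all add: matrix_inv_def)
qed

lemma block_inverse_sums:
  assumes e: "e \<in> regular" and kl: "k < r \<mu>" "l < r \<mu>"
  shows "(\<Sum>m<r \<mu>. block \<mu> e $ ax \<mu> k $ ax \<mu> m * matrix_inv (block \<mu> e) $ ax \<mu> m $ ax \<mu> l) = (if k = l then 1 else 0)"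
    "(\<Sum>m<r \<mu>. matrix_inv (block \<mu> e) $ ax \<mu> k $ ax \<mu> m * block \<mu> e $ ax \<mu> m $ ax \<mu> l) = (if k = l then 1 else 0)"
  by (rule invertible_upto_of_embedding[OF inj_ax matrix_inv_block[OF e] _ _ kl];
      simp add: block_row_zero block_column_zero)+

lemma perp_frame: "k < r \<mu> \<Longrightarrow> inner (V \<mu> k) (perp \<mu> x) = 0"
  by (simp add: perp_def inner_diff_right inner_sum_right VU if_distrib cong: if_cong)

lemma perp_id: "(\<And>k. k < r \<mu> \<Longrightarrow> inner (V \<mu> k) x = 0) \<Longrightarrow> perp \<mu> x = x"
  by (simp add: perp_def)

lemma perp_U: "k < r \<mu> \<Longrightarrow> perp \<mu> (U \<mu> k) = 0"
  by (simp add: perp_def VU if_distrib[of "\<lambda>c. c *\<^sub>R _"] cong: if_cong)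

lemma bounded_linear_perp: "bounded_linear (perp \<mu>)"
  unfolding perp_def
  by (intro bounded_linear_sub bounded_linear_ident bounded_linear_sum
      bounded_linear_compose[OF bounded_linear_scaleR_left] bounded_linear_inner_right)

lemma bounded_linear_W: "bounded_linear (W \<mu> k)"
proof (cases "k < r \<mu>")
  case True
  have "bounded_linear (\<lambda>Y. \<Sum>j | idx j \<mu> = 0. B \<mu> $ j $ ax \<mu> k *\<^sub>R perp \<mu> (contract \<mu> (\<lambda>\<nu>. V \<nu> (idx j \<nu>)) Y))"
    by (intro bounded_linear_sum bounded_linear_compose[OF bounded_linear_scaleR_right]
        bounded_linear_compose[OF bounded_linear_perp] bounded_linear_contract)
  then show ?thesis using True by (simp add: W_def[abs_def])
qed (simp add: W_def[abs_def])

lemma bounded_linear_core: "bounded_linear core"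
proof (subst bounded_linear_componentwise_iff, rule ballI)
  fix b :: "real ^ 'i" assume "b \<in> Basis"
  then obtain i where "b = axis i 1" by (auto simp: Basis_vec_def)
  then have "(\<lambda>Y. inner (core Y) b) = (\<lambda>Y. inner Y (elementary_tensor (\<lambda>\<mu>. V \<mu> (idx i \<mu>))))"
    by (simp add: core_def inner_axis)
  then show "bounded_linear (\<lambda>Y. inner (core Y) b)" by (simp add: bounded_linear_inner_left)
qed

lemma core_tucker:
  "core (tucker idx e w) = core_mult idx e (\<lambda>\<mu> k l. inner (V \<mu> k) (w \<mu> l))"
  by (simp add: core_def tucker_def core_mult_def vec_eq_iff inner_sum_left inner_elementary_tensor
      inner_commute[of "w _ _"] mult.commute)

lemma core_tucker_frame:
  assumes "dual_frame w"
  shows "core (tucker idx e w) = e"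
proof -
  have "core_mult idx e (\<lambda>\<mu> k l. inner (V \<mu> k) (w \<mu> l)) = core_mult idx e (\<lambda>\<mu> k l. if k = l then 1 else 0)"
    using assms by (intro core_mult_cong) (simp add: dual_frame_def)
  then show ?thesis by (simp add: core_tucker core_mult_id)
qed

lemma core_tucker_zero:
  assumes "\<And>k l. k < r \<mu> \<Longrightarrow> l < r \<mu> \<Longrightarrow> inner (V \<mu> k) (w \<mu> l) = 0"
  shows "core (tucker idx e w) = 0"
proof -
  have "(\<Prod>\<nu>\<in>UNIV. inner (V \<nu> (idx i \<nu>)) (w \<nu> (idx j \<nu>))) = 0" for i j
    using assms by (intro prod_zero bexI[of _ \<mu>]) (auto simp: idx_less)
  then show ?thesis
    by (simp only: core_tucker core_mult_def vec_eq_iff vec_lambda_beta mult_zero_left sum.neutral_const zero_index) simp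
qed

lemma contract_tucker:
  "contract \<mu> v (tucker idx e w) =
    (\<Sum>i\<in>UNIV. (e $ i * (\<Prod>\<nu>\<in>- {\<mu>}. inner (w \<nu> (idx i \<nu>)) (v \<nu>))) *\<^sub>R w \<mu> (idx i \<mu>))"
proof -
  interpret bounded_linear "contract \<mu> v" by (rule bounded_linear_contract)
  show ?thesis by (simp add: tucker_def sum scaleR contract_elementary_tensor)
qed

lemma W_tucker_zero:
  assumes "\<And>k l. k < r \<nu> \<Longrightarrow> l < r \<nu> \<Longrightarrow> inner (V \<nu> k) (w \<nu> l) = 0" and "\<nu> \<noteq> \<mu>"
  shows "W \<mu> k (tucker idx e w) = 0"
proof -
  interpret bounded_linear "perp \<mu>" by (rule bounded_linear_perp)
  have "(\<Prod>\<nu>\<in>- {\<mu>}. inner (w \<nu> (idx i \<nu>)) (V \<nu> (idx j \<nu>))) = 0" for i j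
    using assms by (intro prod_zero bexI[of _ \<nu>]) (auto simp: idx_less inner_commute[of "w _ _"])
  then show ?thesis
    by (simp only: W_def contract_tucker mult_zero_right scaleR_zero_left scaleR_zero_right sum.neutral_const zero if_cancel)
qed

text \<open>
  If all factors other than \<open>w \<mu>\<close> are normalized, contracting with \<open>V\<close> in the other modes leaves
  the matricization of \<open>e\<close> applied to the columns of \<open>w \<mu>\<close>.
\<close>

lemma W_tucker:
  assumes w: "\<And>\<nu> k l. \<nu> \<noteq> \<mu> \<Longrightarrow> k < r \<nu> \<Longrightarrow> l < r \<nu> \<Longrightarrow> inner (V \<nu> k) (w \<nu> l) = (if k = l then 1 else 0)"
    and k: "k < r \<mu>"
  shows "W \<mu> k (tucker idx e w) = (\<Sum>m<r \<mu>. block \<mu> e $ ax \<mu> m $ ax \<mu> k *\<^sub>R perp \<mu> (w \<mu> m))"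
proof -
  interpret P: bounded_linear "perp \<mu>" by (rule bounded_linear_perp)
  have contr: "contract \<mu> (\<lambda>\<nu>. V \<nu> (idx j \<nu>)) (tucker idx e w) =
      (\<Sum>m<r \<mu>. matricization idx \<mu> e $ ax \<mu> m $ j *\<^sub>R w \<mu> m)" if j: "idx j \<mu> = 0" for j
  proof -
    have "(\<Prod>\<nu>\<in>- {\<mu>}. inner (w \<nu> (idx i \<nu>)) (V \<nu> (idx j \<nu>))) =
        (if \<forall>\<nu>\<in>- {\<mu>}. idx i \<nu> = idx j \<nu> then 1 else 0)" for i
    proof -
      have "(\<Prod>\<nu>\<in>- {\<mu>}. inner (w \<nu> (idx i \<nu>)) (V \<nu> (idx j \<nu>))) =
        (\<Prod>\<nu>\<in>- {\<mu>}. if idx i \<nu> = idx j \<nu> then 1 else (0::real))"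
        using w by (intro prod.cong) (auto simp: idx_less inner_commute)
      then show ?thesis by (auto intro!: prod_zero)
    qed
    then have "contract \<mu> (\<lambda>\<nu>. V \<nu> (idx j \<nu>)) (tucker idx e w) =
      (\<Sum>i\<in>UNIV. if \<forall>\<nu>\<in>- {\<mu>}. idx i \<nu> = idx j \<nu> then e $ i *\<^sub>R w \<mu> (idx i \<mu>) else 0)"
      unfolding contract_tucker by (intro sum.cong) auto
    also have "\<dots> = (\<Sum>i | \<forall>\<nu>\<in>- {\<mu>}. idx i \<nu> = idx j \<nu>. e $ i *\<^sub>R w \<mu> (idx i \<mu>))"
      by (simp add: sum.inter_filter[symmetric])
    also have "\<dots> = (\<Sum>m<r \<mu>. e $ inv idx ((idx j)(\<mu> := m)) *\<^sub>R w \<mu> (idx (inv idx ((idx j)(\<mu> := m))) \<mu>))"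
      by (rule sum_fibre)
    also have "\<dots> = (\<Sum>m<r \<mu>. matricization idx \<mu> e $ ax \<mu> m $ j *\<^sub>R w \<mu> m)"
    proof (rule sum.cong[OF refl])
      fix m assume "m \<in> {..<r \<mu>}"
      then have m: "m < r \<mu>" by simp
      then have "idx (inv idx ((idx j)(\<mu> := m))) = (idx j)(\<mu> := m)"
        by (intro idx_inv) (auto simp: idx_less)
      then show "e $ inv idx ((idx j)(\<mu> := m)) *\<^sub>R w \<mu> (idx (inv idx ((idx j)(\<mu> := m))) \<mu>) =
          matricization idx \<mu> e $ ax \<mu> m $ j *\<^sub>R w \<mu> m"
        by (simp add: matricization_ax[OF m] j)
    qed
    finally show ?thesis .
  qed
  have "W \<mu> k (tucker idx e w) =
      (\<Sum>j | idx j \<mu> = 0. \<Sum>m<r \<mu>. (matricization idx \<mu> e $ ax \<mu> m $ j * B \<mu> $ j $ ax \<mu> k) *\<^sub>R perp \<mu> (w \<mu> m))"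
    using k by (simp add: W_def contr P.sum P.scaleR scaleR_sum_right mult.commute)
  also have "\<dots> = (\<Sum>m<r \<mu>. (\<Sum>j | idx j \<mu> = 0. matricization idx \<mu> e $ ax \<mu> m $ j * B \<mu> $ j $ ax \<mu> k) *\<^sub>R perp \<mu> (w \<mu> m))"
    unfolding scaleR_sum_left by (rule sum.swap)
  also have "\<dots> = (\<Sum>m<r \<mu>. block \<mu> e $ ax \<mu> m $ ax \<mu> k *\<^sub>R perp \<mu> (w \<mu> m))"
  proof (rule sum.cong[OF refl])
    fix m assume "m \<in> {..<r \<mu>}"
    then have m: "m < r \<mu>" by simp
    have "(\<Sum>j | idx j \<mu> = 0. matricization idx \<mu> e $ ax \<mu> m $ j * B \<mu> $ j $ ax \<mu> k) =
      (\<Sum>j\<in>UNIV. matricization idx \<mu> e $ ax \<mu> m $ j * B \<mu> $ j $ ax \<mu> k)"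
      by (intro sum.mono_neutral_left) (auto simp: matricization_ax[OF m])
    then show "(\<Sum>j | idx j \<mu> = 0. matricization idx \<mu> e $ ax \<mu> m $ j * B \<mu> $ j $ ax \<mu> k) *\<^sub>R perp \<mu> (w \<mu> m) =
      block \<mu> e $ ax \<mu> m $ ax \<mu> k *\<^sub>R perp \<mu> (w \<mu> m)"
      by (simp add: block_ax[OF m] matrix_matrix_mult_def)
  qed
  finally show ?thesis .
qed

lemma frame_W: "k < r \<mu> \<Longrightarrow> inner (V \<mu> k) (W \<mu> l Y) = 0"
  by (simp add: W_def inner_sum_right perp_frame)

lemma frame_K: "k < r \<mu> \<Longrightarrow> inner (V \<mu> k) (K e Y \<mu> l) = 0"
  by (simp add: K_def inner_sum_right frame_W)

lemma dual_frame_U: "dual_frame U"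
  by (simp add: dual_frame_def VU)

lemma dual_frame_add:
  "(\<And>\<mu> k l. k < r \<mu> \<Longrightarrow> l < r \<mu> \<Longrightarrow> inner (V \<mu> k) (w \<mu> l) = 0) \<Longrightarrow> dual_frame (\<lambda>\<mu> k. U \<mu> k + w \<mu> k)"
  by (simp add: dual_frame_def inner_add_right VU)

lemma dual_frame_K: "dual_frame (\<lambda>\<mu> k. U \<mu> k + K e Y \<mu> k)"
  by (intro dual_frame_add frame_K)

lemma core_U: "core (tucker idx e U) = e"
  by (rule core_tucker_frame[OF dual_frame_U])

lemma core_param: "core (param e Y) = e"
  unfolding param_def by (rule core_tucker_frame[OF dual_frame_K])

lemma W_tucker_dual_frame:
  assumes w: "\<And>\<mu> k l. k < r \<mu> \<Longrightarrow> l < r \<mu> \<Longrightarrow> inner (V \<mu> k) (w \<mu> l) = 0" and k: "k < r \<mu>"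
  shows "W \<mu> k (tucker idx e (\<lambda>\<mu> k. U \<mu> k + w \<mu> k)) = (\<Sum>m<r \<mu>. block \<mu> e $ ax \<mu> m $ ax \<mu> k *\<^sub>R w \<mu> m)"
proof -
  interpret P: bounded_linear "perp \<mu>" by (rule bounded_linear_perp)
  have "perp \<mu> (U \<mu> m + w \<mu> m) = w \<mu> m" if "m < r \<mu>" for m
    using w that by (simp add: P.add perp_U perp_id)
  then show ?thesis
    by (subst W_tucker[OF _ k]) (auto simp: inner_add_right VU w)
qed

lemma W_U: "W \<mu> k (tucker idx e U) = 0"
proof (cases "k < r \<mu>")
  case True
  then show ?thesis using W_tucker_dual_frame[of "\<lambda>_ _. 0" k \<mu> e] by simp
qed (simp add: W_def)

lemma W_param:
  assumes "e \<in> regular"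
  shows "W \<mu> k (param e Y) = W \<mu> k Y"
proof (cases "k < r \<mu>")
  case k: True
  have "W \<mu> k (param e Y) = (\<Sum>m<r \<mu>. block \<mu> e $ ax \<mu> m $ ax \<mu> k *\<^sub>R K e Y \<mu> m)"
    unfolding param_def by (rule W_tucker_dual_frame[OF frame_K k])
  also have "\<dots> = (\<Sum>l<r \<mu>. (\<Sum>m<r \<mu>. matrix_inv (block \<mu> e) $ ax \<mu> l $ ax \<mu> m * block \<mu> e $ ax \<mu> m $ ax \<mu> k) *\<^sub>R W \<mu> l Y)"
    unfolding K_def scaleR_sum_right scaleR_sum_left by (subst sum.swap) (simp add: mult.commute)
  also have "\<dots> = (\<Sum>l<r \<mu>. if l = k then W \<mu> l Y else 0)"
    using k by (intro sum.cong) (auto simp: block_inverse_sums(2)[OF assms])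
  finally show ?thesis using k by simp
qed (simp add: W_def)

lemma core_lift: "core (lift Y) = 0"
proof -
  interpret bounded_linear core by (rule bounded_linear_core)
  have "core (tucker idx C (U(\<mu> := \<lambda>k. W \<mu> k Y))) = 0" for \<mu>
    by (rule core_tucker_zero[of \<mu>]) (simp add: frame_W)
  then show ?thesis by (simp add: lift_def sum)
qed

lemma W_lift: "W \<mu> k (lift Y) = W \<mu> k Y"
proof (cases "k < r \<mu>")
  case k: True
  interpret W: bounded_linear "W \<mu> k" by (rule bounded_linear_W)
  have other: "W \<mu> k (tucker idx C (U(\<nu> := \<lambda>k. W \<nu> k Y))) = 0" if "\<nu> \<noteq> \<mu>" for \<nu>
    by (rule W_tucker_zero[of \<nu>]) (use that in \<open>simp_all add: frame_W\<close>)
  have "W \<mu> k (tucker idx C (U(\<mu> := \<lambda>k. W \<mu> k Y))) = (\<Sum>m<r \<mu>. block \<mu> C $ ax \<mu> m $ ax \<mu> k *\<^sub>R perp \<mu> (W \<mu> m Y))"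
    by (subst W_tucker[OF _ k]) (auto simp: VU)
  also have "\<dots> = (\<Sum>m<r \<mu>. if m = k then W \<mu> m Y else 0)"
    using k by (intro sum.cong) (auto simp: block_C mat_def ax_eq_iff perp_id frame_W)
  finally have "W \<mu> k (tucker idx C (U(\<mu> := \<lambda>k. W \<mu> k Y))) = W \<mu> k Y" using k by simp
  then have "W \<mu> k (tucker idx C (U(\<nu> := \<lambda>k. W \<nu> k Y))) = (if \<nu> = \<mu> then W \<mu> k Y else 0)" for \<nu>
    using other[of \<nu>] by auto
  then show ?thesis by (simp add: lift_def W.sum)
qed (simp add: W_def)

lemma param_cong: "(\<And>\<mu> k. W \<mu> k Y = W \<mu> k Z) \<Longrightarrow> param e Y = param e Z"
  by (simp add: param_def K_def)

lemma lift_cong: "(\<And>\<mu> k. W \<mu> k Y = W \<mu> k Z) \<Longrightarrow> lift Y = lift Z"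
  by (simp add: lift_def)

text \<open>
  Columns with a dual family are linearly independent: a null vector \<open>x\<close> of the Gram matrix gives a
  combination of the columns of norm 0, whose inner products with \<open>V \<mu>\<close> are the entries of \<open>x\<close>.
\<close>

lemma gram_invertible:
  assumes "dual_frame w"
  shows "invertible_upto (r \<mu>) (transpose_mult (w \<mu>) (w \<mu>))"
proof (rule invertible_uptoI_injective[OF inj_ax[of \<mu>]])
  fix x l assume x: "\<And>k. k < r \<mu> \<Longrightarrow> (\<Sum>l<r \<mu>. transpose_mult (w \<mu>) (w \<mu>) k l * x l) = 0" and l: "l < r \<mu>"
  let ?y = "\<Sum>l<r \<mu>. x l *\<^sub>R w \<mu> l"
  have "inner (w \<mu> k) ?y = 0" if "k < r \<mu>" for k
    using x[OF that] by (simp add: transpose_mult_def inner_sum_right mult.commute)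
  then have "inner ?y ?y = 0" by (simp add: inner_sum_left)
  then have "inner (V \<mu> l) ?y = 0" by simp
  moreover have "inner (V \<mu> l) ?y = (\<Sum>m<r \<mu>. if m = l then x m else 0)"
    unfolding inner_sum_right using assms l by (intro sum.cong) (auto simp: dual_frame_def)
  ultimately show "x l = 0" using l by simp
qed

text \<open>
  If the core of \<open>tucker idx e w\<close> is regular, the matrices \<open>T \<mu>\<close> with entries \<open>inner (V \<mu> k) (w \<mu> l)\<close> are
  invertible, because the core is \<open>e\<close> multiplied with all \<open>T \<mu>\<close>, so \<open>T \<mu>\<close> is a left factor of the
  invertible matrix \<open>block\<close> of the core. Multiplying the factors with the inverses of \<open>T \<mu>\<close>
  normalizes them, and \<open>W\<close> determines normalized factors.
\<close>

lemma param_of_regular_core: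
  assumes reg: "core (tucker idx e w) \<in> regular"
  shows "tucker idx e w = param (core (tucker idx e w)) (tucker idx e w)"
    "invertible_upto (r \<mu>) (\<lambda>k l. inner (V \<mu> k) (w \<mu> l))"
proof -
  define T where "T \<mu> k l = inner (V \<mu> k) (w \<mu> l)" for \<mu> k l
  define e' where "e' = core (tucker idx e w)"
  have e': "e' = core_mult idx e T" by (simp add: e'_def core_tucker T_def[abs_def])
  have reg': "e' \<in> regular" using reg by (simp add: e'_def)
  have inv: "invertible_upto (r \<mu>) (T \<mu>)" for \<mu>
  proof -
    \<comment> \<open>The matricization of the core with the factor \<open>T \<mu>\<close> split off.\<close>
    define q where "q l j = (\<Sum>i | idx i \<mu> = l. (\<Prod>\<nu>\<in>- {\<mu>}. T \<nu> (idx j \<nu>) (idx i \<nu>)) * e $ i)" for l j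
    have mat: "matricization idx \<mu> e' $ ax \<mu> m $ j = (\<Sum>l<r \<mu>. T \<mu> m l * (if idx j \<mu> = 0 then q l j else 0))"
      if m: "m < r \<mu>" for m j
    proof (cases "idx j \<mu> = 0")
      case True
      have "idx (inv idx ((idx j)(\<mu> := m))) = (idx j)(\<mu> := m)"
        using m by (intro idx_inv) (auto simp: idx_less)
      then have "matricization idx \<mu> e' $ ax \<mu> m $ j =
          (\<Sum>i\<in>UNIV. (\<Prod>\<nu>\<in>UNIV. T \<nu> (((idx j)(\<mu> := m)) \<nu>) (idx i \<nu>)) * e $ i)"
        by (simp add: matricization_ax[OF m] True e' core_mult_def)
      also have "\<dots> = (\<Sum>i\<in>UNIV. T \<mu> m (idx i \<mu>) * ((\<Prod>\<nu>\<in>- {\<mu>}. T \<nu> (idx j \<nu>) (idx i \<nu>)) * e $ i))"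
        by (simp only: prod_update[of "\<lambda>\<nu> k. T \<nu> k (idx _ \<nu>)"] mult.assoc)
      also have "\<dots> = (\<Sum>l<r \<mu>. \<Sum>i | i \<in> UNIV \<and> idx i \<mu> = l. T \<mu> m (idx i \<mu>) * ((\<Prod>\<nu>\<in>- {\<mu>}. T \<nu> (idx j \<nu>) (idx i \<nu>)) * e $ i))"
        by (rule sum.group[symmetric]) (auto simp: idx_less)
      also have "\<dots> = (\<Sum>l<r \<mu>. T \<mu> m l * q l j)"
        by (simp add: q_def sum_distrib_left)
      finally show ?thesis using True by simp
    qed (simp add: matricization_ax[OF m])
    define c where "c l k = (\<Sum>j\<in>UNIV. (if idx j \<mu> = 0 then q l j else 0) * B \<mu> $ j $ ax \<mu> k)" for l k
    define Z where "Z l n = (\<Sum>k<r \<mu>. c l k * matrix_inv (block \<mu> e') $ ax \<mu> k $ ax \<mu> n)" for l n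
    have "(\<Sum>l<r \<mu>. T \<mu> m l * Z l n) = (if m = n then 1 else 0)" if mn: "m < r \<mu>" "n < r \<mu>" for m n
    proof -
      have "block \<mu> e' $ ax \<mu> m $ ax \<mu> k = (\<Sum>l<r \<mu>. T \<mu> m l * c l k)" for k
      proof -
        have "block \<mu> e' $ ax \<mu> m $ ax \<mu> k =
            (\<Sum>j\<in>UNIV. (\<Sum>l<r \<mu>. T \<mu> m l * (if idx j \<mu> = 0 then q l j else 0)) * B \<mu> $ j $ ax \<mu> k)"
          by (simp only: block_ax[OF mn(1)] matrix_matrix_mult_def vec_lambda_beta mat[OF mn(1)])
        also have "\<dots> = (\<Sum>l<r \<mu>. T \<mu> m l * c l k)"
          unfolding c_def sum_distrib_left sum_distrib_right mult.assoc by (rule sum.swap)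
        finally show ?thesis .
      qed
      then have "(\<Sum>k<r \<mu>. block \<mu> e' $ ax \<mu> m $ ax \<mu> k * matrix_inv (block \<mu> e') $ ax \<mu> k $ ax \<mu> n) =
          (\<Sum>k<r \<mu>. (\<Sum>l<r \<mu>. T \<mu> m l * c l k) * matrix_inv (block \<mu> e') $ ax \<mu> k $ ax \<mu> n)"
        by (simp only:)
      also have "\<dots> = (\<Sum>l<r \<mu>. T \<mu> m l * Z l n)"
        unfolding Z_def sum_distrib_left sum_distrib_right mult.assoc by (rule sum.swap)
      finally show ?thesis using block_inverse_sums(1)[OF reg' mn] by simp
    qed
    then show ?thesis by (rule invertible_uptoI_right_inverse[OF inj_ax])
  qed
  then show "invertible_upto (r \<mu>) (\<lambda>k l. inner (V \<mu> k) (w \<mu> l))" by (simp add: T_def[abs_def])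
  have "\<forall>\<mu>. \<exists>S. (\<forall>k<r \<mu>. \<forall>l<r \<mu>. (\<Sum>m<r \<mu>. T \<mu> k m * S m l) = (if k = l then 1 else 0)) \<and>
      (\<forall>k<r \<mu>. \<forall>l<r \<mu>. (\<Sum>m<r \<mu>. S k m * T \<mu> m l) = (if k = l then 1 else 0))"
    using inv unfolding invertible_upto_def by blast
  from choice[OF this] obtain S where S:
    "\<And>\<mu> k l. k < r \<mu> \<Longrightarrow> l < r \<mu> \<Longrightarrow> (\<Sum>m<r \<mu>. T \<mu> k m * S \<mu> m l) = (if k = l then 1 else 0)"
    "\<And>\<mu> k l. k < r \<mu> \<Longrightarrow> l < r \<mu> \<Longrightarrow> (\<Sum>m<r \<mu>. S \<mu> k m * T \<mu> m l) = (if k = l then 1 else 0)"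
    by blast
  define w' where "w' \<mu> k = (\<Sum>l<r \<mu>. S \<mu> l k *\<^sub>R w \<mu> l)" for \<mu> k
  have Vw': "inner (V \<mu> k) (w' \<mu> l) = (if k = l then 1 else 0)" if "k < r \<mu>" "l < r \<mu>" for \<mu> k l
    using S(1)[OF that] by (simp add: w'_def inner_sum_right T_def mult.commute)
  define h where "h \<mu> k = w' \<mu> k - U \<mu> k" for \<mu> k
  have Vh: "inner (V \<mu> k) (h \<mu> l) = 0" if "k < r \<mu>" "l < r \<mu>" for \<mu> k l
    using that by (simp add: h_def inner_diff_right Vw' VU)
  have eq: "tucker idx e w = tucker idx e' (\<lambda>\<mu> k. U \<mu> k + h \<mu> k)"
  proof -
    have "(\<Sum>l<r \<mu>. T \<mu> l k *\<^sub>R w' \<mu> l) = w \<mu> k" if k: "k < r \<mu>" for \<mu> k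
    proof -
      have "(\<Sum>l<r \<mu>. T \<mu> l k *\<^sub>R w' \<mu> l) = (\<Sum>m<r \<mu>. (\<Sum>l<r \<mu>. S \<mu> m l * T \<mu> l k) *\<^sub>R w \<mu> m)"
        unfolding w'_def scaleR_sum_right scaleR_sum_left by (subst sum.swap) (simp add: mult.commute)
      also have "\<dots> = (\<Sum>m<r \<mu>. if m = k then w \<mu> m else 0)"
        using k by (intro sum.cong) (auto simp: S(2))
      finally show ?thesis using k by simp
    qed
    then have "tucker idx e w = tucker idx e (\<lambda>\<mu> k. \<Sum>l<r \<mu>. T \<mu> l k *\<^sub>R w' \<mu> l)"
      by (intro tucker_cong) simp
    also have "\<dots> = tucker idx e' w'" by (simp add: e' tucker_core_mult)
    finally show ?thesis by (simp add: h_def)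
  qed
  have "K e' (tucker idx e w) \<mu> k = h \<mu> k" if k: "k < r \<mu>" for \<mu> k
  proof -
    have "K e' (tucker idx e w) \<mu> k =
      (\<Sum>l<r \<mu>. matrix_inv (block \<mu> e') $ ax \<mu> l $ ax \<mu> k *\<^sub>R (\<Sum>m<r \<mu>. block \<mu> e' $ ax \<mu> m $ ax \<mu> l *\<^sub>R h \<mu> m))"
      unfolding K_def eq by (intro sum.cong refl arg_cong2[where f = scaleR] W_tucker_dual_frame Vh) auto
    also have "\<dots> = (\<Sum>m<r \<mu>. (\<Sum>l<r \<mu>. block \<mu> e' $ ax \<mu> m $ ax \<mu> l * matrix_inv (block \<mu> e') $ ax \<mu> l $ ax \<mu> k) *\<^sub>R h \<mu> m)"
      unfolding scaleR_sum_right scaleR_sum_left by (subst sum.swap) (simp add: mult.commute)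
    also have "\<dots> = (\<Sum>m<r \<mu>. if m = k then h \<mu> m else 0)"
      using k by (intro sum.cong) (auto simp: block_inverse_sums(1)[OF reg'])
    finally show ?thesis using k by simp
  qed
  then have "param e' (tucker idx e w) = tucker idx e' (\<lambda>\<mu> k. U \<mu> k + h \<mu> k)"
    unfolding param_def by (intro tucker_cong) simp
  then have "param e' (tucker idx e w) = tucker idx e w" by (rule trans[OF _ eq[symmetric]])
  then show "tucker idx e w = param (core (tucker idx e w)) (tucker idx e w)"
    unfolding e'_def by (rule sym)
qed

end

section \<open>Smoothness of the tensor maps\<close>

lemma smooth_on_elementary_tensor:
  fixes w :: "'d::finite \<Rightarrow> 'x::real_normed_vector \<Rightarrow> nat ell2"
  assumes S: "open S" and w: "\<And>\<mu>. smooth_on S (w \<mu>)"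
  shows "smooth_on S (\<lambda>x. elementary_tensor (\<lambda>\<mu>. w \<mu> x))"
proof -
  have "smooth_on S (\<lambda>x. elementary_tensor (fill_modes I (\<lambda>\<mu>. w \<mu> x)))" for I
    using finite[of I]
  proof (induction I)
    case empty
    have "fill_modes {} w = (\<lambda>_. unit_ell2 0)" for w :: "'d \<Rightarrow> nat ell2"
      by (simp add: fun_eq_iff fill_modes_def)
    then show ?case by (simp only: smooth_on_const[OF S])
  next
    case (insert \<nu> I)
    show ?case
      unfolding elementary_tensor_fill_insert[OF insert.hyps(2)]
      by (rule bounded_bilinear.smooth_on_prod[OF bounded_bilinear_insert_mode w insert.IH])
  qed
  from this[of UNIV] show ?thesis by (simp only: fill_modes_UNIV)
qed

lemma smooth_on_scaleR: "smooth_on S f \<Longrightarrow> smooth_on S g \<Longrightarrow> smooth_on S (\<lambda>x. f x *\<^sub>R g x)"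
  by (rule bounded_bilinear.smooth_on_prod[OF bounded_bilinear_scaleR])

lemma smooth_on_vec_nth: "smooth_on S f \<Longrightarrow> smooth_on S (\<lambda>x. f x $ i)"
  by (rule smooth_on_bounded_linear_compose[OF bounded_linear_vec_nth])

lemma smooth_on_tucker:
  assumes e: "smooth_on S e" and w: "\<And>\<mu> k. smooth_on S (w \<mu> k)"
  shows "smooth_on S (\<lambda>x. tucker idx (e x) (\<lambda>\<mu> k. w \<mu> k x))"
  unfolding tucker_def
  by (intro smooth_on_sum smooth_on_scaleR smooth_on_vec_nth smooth_on_elementary_tensor e w smooth_on_open[OF e])

lemma has_vector_derivative_tucker:
  assumes e: "(e has_vector_derivative e') (at t)"
    and w: "\<And>\<mu> k. (w \<mu> k has_vector_derivative w' \<mu> k) (at t)"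
  shows "((\<lambda>t. tucker idx (e t) (\<lambda>\<mu> k. w \<mu> k t)) has_vector_derivative
    (tucker idx e' (\<lambda>\<mu> k. w \<mu> k t) + (\<Sum>\<mu>\<in>UNIV. tucker idx (e t) ((\<lambda>\<mu> k. w \<mu> k t)(\<mu> := w' \<mu>))))) (at t)"
proof -
  have "((\<lambda>t. \<Sum>i\<in>UNIV. e t $ i *\<^sub>R elementary_tensor (\<lambda>\<mu>. w \<mu> (idx i \<mu>) t)) has_vector_derivative
    (\<Sum>i\<in>UNIV. e t $ i *\<^sub>R (\<Sum>\<mu>\<in>UNIV. elementary_tensor ((\<lambda>\<nu>. w \<nu> (idx i \<nu>) t)(\<mu> := w' \<mu> (idx i \<mu>)))) +
      e' $ i *\<^sub>R elementary_tensor (\<lambda>\<mu>. w \<mu> (idx i \<mu>) t))) (at t)"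
    by (intro has_vector_derivative_sum
        bounded_bilinear.has_vector_derivative[OF bounded_bilinear_scaleR]
        bounded_linear.has_vector_derivative[OF bounded_linear_vec_nth e]
        has_vector_derivative_elementary_tensor w)
  moreover have "(\<Sum>i\<in>UNIV. e t $ i *\<^sub>R (\<Sum>\<mu>\<in>UNIV. elementary_tensor ((\<lambda>\<nu>. w \<nu> (idx i \<nu>) t)(\<mu> := w' \<mu> (idx i \<mu>)))) +
      e' $ i *\<^sub>R elementary_tensor (\<lambda>\<mu>. w \<mu> (idx i \<mu>) t)) =
    tucker idx e' (\<lambda>\<mu> k. w \<mu> k t) + (\<Sum>\<mu>\<in>UNIV. tucker idx (e t) ((\<lambda>\<mu> k. w \<mu> k t)(\<mu> := w' \<mu>)))"
  proof -
    have upd: "(\<lambda>\<nu>. ((\<lambda>\<mu> k. w \<mu> k t)(\<mu> := w' \<mu>)) \<nu> (idx i \<nu>)) = (\<lambda>\<nu>. w \<nu> (idx i \<nu>) t)(\<mu> := w' \<mu> (idx i \<mu>))" for i \<mu>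
      by (simp add: fun_eq_iff)
    show ?thesis
      unfolding tucker_def upd sum.distrib scaleR_sum_right
      by (subst add.commute, rule arg_cong2[where f = "(+)", OF refl sum.swap])
  qed
  ultimately show ?thesis by (simp only: tucker_def)
qed

lemma unital_product_matrix: "unital_product (matrix_matrix_mult :: real ^ 'i::finite ^ 'i \<Rightarrow> _) (mat 1)"
proof -
  have "bilinear (matrix_matrix_mult :: real ^ 'i ^ 'i \<Rightarrow> real ^ 'i ^ 'i \<Rightarrow> real ^ 'i ^ 'i)"
    by (auto simp: bilinear_def linear_iff matrix_add_ldistrib matrix_matrix_mult_def vec_eq_iff
        distrib_right distrib_left sum.distrib sum_distrib_left mult_ac)
  then interpret bounded_bilinear "matrix_matrix_mult :: real ^ 'i ^ 'i \<Rightarrow> real ^ 'i ^ 'i \<Rightarrow> real ^ 'i ^ 'i"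
    by (simp add: bilinear_conv_bounded_bilinear)
  show ?thesis by unfold_locales (auto simp: matrix_mul_assoc matrix_mul_lid matrix_mul_rid)
qed

context tucker_chart
begin

lemma linear_matricization: "linear (matricization idx \<mu>)"
  by (rule linearI) (auto simp: matricization_def entry_def vec_eq_iff)

text \<open>
  Affine dependence on the core yields both openness of the regular cores and smoothness of \<open>block\<close>.
\<close>

lemma block_affine: "\<exists>L. bounded_linear L \<and> block \<mu> = (\<lambda>e. L e + off_block \<mu>)"
proof -
  interpret unital_product "matrix_matrix_mult :: real ^ 'i ^ 'i \<Rightarrow> _" "mat 1" by (rule unital_product_matrix)
  have "bounded_linear (\<lambda>e. matricization idx \<mu> e ** B \<mu>)"
    by (rule bounded_linear_compose[OF bounded_linear_left])
      (simp add: linear_conv_bounded_linear[symmetric] linear_matricization)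
  then show ?thesis by (auto simp: block_def[abs_def])
qed

lemma open_regular: "open regular"
proof -
  have "open {e. det (block \<mu> e) \<noteq> 0}" for \<mu>
  proof -
    obtain L where L: "bounded_linear L" "block \<mu> = (\<lambda>e. L e + off_block \<mu>)" using block_affine by blast
    have "continuous_on UNIV (block \<mu>)"
      unfolding L(2) by (intro continuous_intros linear_continuous_on L(1))
    then have "continuous_on UNIV (\<lambda>e. det (block \<mu> e))"
      unfolding det_def by (intro continuous_intros)
    then show ?thesis by (intro open_Collect_neq continuous_on_const)
  qed
  then have "open (\<Inter>\<mu>. {e. det (block \<mu> e) \<noteq> 0})" by (intro open_INT) auto
  moreover have "regular = (\<Inter>\<mu>. {e. det (block \<mu> e) \<noteq> 0})" by (auto simp: regular_def)
  ultimately show ?thesis by simp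
qed

lemma smooth_on_K:
  assumes e: "smooth_on S e" "\<And>Y. Y \<in> S \<Longrightarrow> e Y \<in> regular"
  shows "smooth_on S (\<lambda>Y. K (e Y) Y \<mu> k)"
proof -
  have S: "open S" using e(1) by (rule smooth_on_open)
  obtain L where L: "bounded_linear L" "block \<mu> = (\<lambda>e. L e + off_block \<mu>)" using block_affine by blast
  have "smooth_on S (\<lambda>Y. block \<mu> (e Y))"
    unfolding L(2) by (intro smooth_on_add smooth_on_const S smooth_on_bounded_linear_compose[OF L(1)] e(1))
  then have "smooth_on S (\<lambda>Y. matrix_inv (block \<mu> (e Y)))"
    by (rule unital_product.smooth_on_inverse[OF unital_product_matrix]) (auto simp: matrix_inv_block e(2))
  then show ?thesis
    unfolding K_def
    by (intro smooth_on_sum S smooth_on_scaleR smooth_on_vec_nth smooth_on_bounded_linear[OF bounded_linear_W])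
qed

lemma smooth_on_param:
  assumes e: "smooth_on S e" "\<And>Y. Y \<in> S \<Longrightarrow> e Y \<in> regular"
  shows "smooth_on S (\<lambda>Y. param (e Y) Y)"
  unfolding param_def
  by (intro smooth_on_tucker smooth_on_add smooth_on_const smooth_on_K e smooth_on_open[OF e(1)])

lemma bounded_linear_tucker_U: "bounded_linear (\<lambda>e. tucker idx e U)"
  unfolding tucker_def
  by (intro bounded_linear_sum bounded_linear_compose[OF bounded_linear_scaleR_left] bounded_linear_vec_nth)

lemma bounded_linear_lift: "bounded_linear lift"
proof -
  have upd: "(\<lambda>\<nu>. (U(\<mu> := f)) \<nu> (idx i \<nu>)) = (\<lambda>\<nu>. U \<nu> (idx i \<nu>))(\<mu> := f (idx i \<mu>))" for i \<mu> f
    by (simp add: fun_eq_iff)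
  show ?thesis
    unfolding lift_def[abs_def] tucker_def upd
    by (intro bounded_linear_sum bounded_linear_compose[OF bounded_linear_scaleR_right]
        bounded_linear_compose[OF bounded_linear_elementary_tensor_slot] bounded_linear_W)
qed

section \<open>Straightening the tensor manifold\<close>

context
  fixes f :: "real ^ 'i \<Rightarrow> real ^ 'i" and Q Mc :: "(real ^ 'i) set" and P :: "real ^ 'i \<Rightarrow> real ^ 'i"
    and M :: "('d \<Rightarrow> nat) ell2 set"
  assumes Q: "Q \<subseteq> regular" and f: "smooth_diffeo_on Q f"
    and P: "bounded_linear P" "\<And>z. P (P z) = P z"
    and fMc: "\<And>e. e \<in> Q \<Longrightarrow> e \<in> Mc \<longleftrightarrow> P (f e) = f e"
    and invariant: "\<And>C' T. C' \<in> Mc \<Longrightarrow> (\<forall>\<mu>. invertible_upto (r \<mu>) (T \<mu>)) \<Longrightarrow> core_mult idx C' T \<in> Mc"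
    and M: "M = tensor_manifold r idx Mc"
begin

text \<open>
  The graph property. Invariance of \<open>Mc\<close> under changes of basis is used to see that the normalized
  core, and not just some core of the tensor, belongs to \<open>Mc\<close>.
\<close>

lemma M_param_iff:
  assumes Y: "core Y \<in> Q"
  shows "Y \<in> M \<longleftrightarrow> core Y \<in> Mc \<and> Y = param (core Y) Y"
proof
  assume "Y \<in> M"
  then obtain e w where e: "e \<in> Mc" and Yw: "Y = tucker idx e w" by (auto simp: M tensor_manifold_def)
  have reg: "core (tucker idx e w) \<in> regular" using Y Q by (auto simp: Yw)
  have "core Y \<in> Mc"
    unfolding Yw core_tucker using e param_of_regular_core(2)[OF reg] by (intro invariant) auto
  then show "core Y \<in> Mc \<and> Y = param (core Y) Y"
    using param_of_regular_core(1)[OF reg] by (simp add: Yw)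
next
  assume *: "core Y \<in> Mc \<and> Y = param (core Y) Y"
  then show "Y \<in> M"
    unfolding M tensor_manifold_def param_def using gram_invertible[OF dual_frame_K] by blast
qed

definition chart_domain where "chart_domain = {Y. core Y \<in> Q}"

text \<open>
  Subtracting \<open>param\<close> annihilates \<open>M\<close> but also its coordinates. The coordinate \<open>W\<close> is put
  back by \<open>lift\<close>, and the core by its image under the chart \<open>f\<close> of \<open>Mc\<close>. As \<open>param\<close> and \<open>lift\<close> see only
  the coordinates, which are known from the image, the inverse is explicit.
\<close>

definition chart where "chart Y = Y - param (core Y) Y + lift Y + tucker idx (f (core Y)) U"

definition chart_inv where
  "chart_inv Z = Z + param (the_inv_into Q f (core Z)) Z - lift Z - tucker idx (core Z) U"

definition proj where "proj Z = lift Z + tucker idx (P (core Z)) U"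

interpretation core: bounded_linear core by (rule bounded_linear_core)
interpretation W: bounded_linear "W \<mu> k" for \<mu> k by (rule bounded_linear_W)
interpretation U: bounded_linear "\<lambda>e. tucker idx e U" by (rule bounded_linear_tucker_U)
interpretation P: bounded_linear P by (rule P)

lemma inj_f: "inj_on f Q" and smooth_f: "smooth_on Q f" and smooth_f_inv: "smooth_on (f ` Q) (the_inv_into Q f)"
  using f by (simp_all add: smooth_diffeo_on_def)

lemma f_inv_f: "e \<in> Q \<Longrightarrow> the_inv_into Q f (f e) = e"
  and f_f_inv: "e \<in> f ` Q \<Longrightarrow> f (the_inv_into Q f e) = e"
  and f_inv_mem: "e \<in> f ` Q \<Longrightarrow> the_inv_into Q f e \<in> Q"
  using inj_f by (auto simp: the_inv_into_f_f f_the_inv_into_f)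

lemma core_chart: "core (chart Y) = f (core Y)"
  by (simp add: chart_def core.add core.diff core_param core_lift core_U)

lemma W_chart: "core Y \<in> Q \<Longrightarrow> W \<mu> k (chart Y) = W \<mu> k Y"
  using Q by (subst chart_def) (auto simp: W.add W.diff W_param W_lift W_U)

lemma core_chart_inv: "core (chart_inv Z) = the_inv_into Q f (core Z)"
  by (simp add: chart_inv_def core.add core.diff core_param core_lift core_U)

lemma W_chart_inv: "core Z \<in> f ` Q \<Longrightarrow> W \<mu> k (chart_inv Z) = W \<mu> k Z"
proof -
  assume "core Z \<in> f ` Q"
  then have "the_inv_into Q f (core Z) \<in> regular" using f_inv_mem Q by blast
  then show ?thesis by (simp add: chart_inv_def W.add W.diff W_param W_lift W_U)
qed

text \<open>
  The chart preserves \<open>W\<close>, so \<open>param\<close> and \<open>lift\<close> have the same values before and after.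
\<close>

lemma chart_inv_chart:
  assumes Y: "core Y \<in> Q"
  shows "chart_inv (chart Y) = Y"
proof -
  have "param e (chart Y) = param e Y" "lift (chart Y) = lift Y" for e
    by (rule param_cong lift_cong; rule W_chart[OF Y])+
  then have "chart_inv (chart Y) = chart Y + param (core Y) Y - lift Y - tucker idx (f (core Y)) U"
    by (simp add: chart_inv_def core_chart f_inv_f[OF Y])
  then show ?thesis by (simp add: chart_def)
qed

lemma chart_chart_inv:
  assumes Z: "core Z \<in> f ` Q"
  shows "chart (chart_inv Z) = Z"
proof -
  have "param e (chart_inv Z) = param e Z" "lift (chart_inv Z) = lift Z" for e
    by (rule param_cong lift_cong; rule W_chart_inv[OF Z])+
  then have "chart (chart_inv Z) = chart_inv Z - param (the_inv_into Q f (core Z)) Z + lift Z + tucker idx (core Z) U"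
    by (simp add: chart_def core_chart_inv f_f_inv[OF Z])
  then show ?thesis by (simp add: chart_inv_def)
qed

lemma chart_image: "chart ` chart_domain = {Z. core Z \<in> f ` Q}"
proof (intro set_eqI iffI)
  fix Z assume "Z \<in> {Z. core Z \<in> f ` Q}"
  then have "Z = chart (chart_inv Z)" "chart_inv Z \<in> chart_domain"
    by (auto simp: chart_chart_inv chart_domain_def core_chart_inv f_inv_f)
  then show "Z \<in> chart ` chart_domain" by blast
qed (auto simp: chart_domain_def core_chart)

lemma chart_diffeo: "smooth_diffeo_on chart_domain chart"
proof -
  have D: "open chart_domain"
    unfolding chart_domain_def using smooth_on_open[OF smooth_f]
      smooth_on_compose_bounded_linear[OF bounded_linear_core smooth_f] smooth_on_open by blast
  have D': "open {Z. core Z \<in> f ` Q}"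
    using smooth_on_compose_bounded_linear[OF bounded_linear_core smooth_f_inv] smooth_on_open by blast
  have 1: "smooth_on chart_domain (\<lambda>Y. tucker idx (f (core Y)) U)"
    unfolding chart_domain_def
    by (rule smooth_on_bounded_linear_compose[OF bounded_linear_tucker_U
          smooth_on_compose_bounded_linear[OF bounded_linear_core smooth_f]])
  have smooth: "smooth_on chart_domain chart"
    unfolding chart_def[abs_def]
    using Q by (intro smooth_on_add smooth_on_diff smooth_on_ident smooth_on_param
        smooth_on_bounded_linear[OF bounded_linear_core] smooth_on_bounded_linear[OF bounded_linear_lift] D 1)
      (auto simp: chart_domain_def)
  have inj: "inj_on chart chart_domain"
    by (rule inj_on_inverseI[of _ chart_inv]) (simp add: chart_domain_def chart_inv_chart)
  have "smooth_on {Z. core Z \<in> f ` Q} chart_inv"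
    unfolding chart_inv_def[abs_def]
    using Q f_inv_mem by (intro smooth_on_add smooth_on_diff smooth_on_ident smooth_on_param
        smooth_on_bounded_linear[OF bounded_linear_lift] D'
        smooth_on_compose_bounded_linear[OF bounded_linear_core smooth_f_inv]
        smooth_on_bounded_linear[OF bounded_linear_compose[OF bounded_linear_tucker_U bounded_linear_core]])
      blast
  moreover have "the_inv_into chart_domain chart Z = chart_inv Z" if "Z \<in> chart ` chart_domain" for Z
  proof -
    from that obtain Y where Y: "Y \<in> chart_domain" "Z = chart Y" by blast
    then show ?thesis using the_inv_into_f_f[OF inj Y(1)] chart_inv_chart[of Y] by (simp add: chart_domain_def)
  qed
  ultimately have "smooth_on (chart ` chart_domain) (the_inv_into chart_domain chart)"
    using smooth_on_cong[of "chart ` chart_domain" "the_inv_into chart_domain chart" chart_inv] chart_image by simp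
  with smooth inj show ?thesis by (simp add: smooth_diffeo_on_def)
qed

text \<open>
  Applying \<open>core\<close> to the fixed point equation separates it into a condition on the core, which says
  that \<open>f (core Y)\<close> lies in the model space of \<open>Mc\<close>, and \<open>Y = param (core Y) Y\<close>.
\<close>

lemma straightened_chart: "straightened M chart_domain chart proj"
proof (rule straightened.intro)
  show "smooth_diffeo_on chart_domain chart" by (rule chart_diffeo)
  show "bounded_linear proj"
    unfolding proj_def[abs_def]
    by (intro bounded_linear_add bounded_linear_lift bounded_linear_compose[OF bounded_linear_tucker_U]
        bounded_linear_compose[OF P(1)] bounded_linear_core)
  show "proj (proj z) = proj z" for z
  proof -
    have c: "core (proj z) = P (core z)" by (simp add: proj_def core.add core_lift core_U)
    have "W \<mu> k (proj z) = W \<mu> k z" for \<mu> k by (simp add: proj_def W.add W_lift W_U)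
    then have "lift (proj z) = lift z" by (rule lift_cong)
    with c show ?thesis by (simp add: proj_def[of "proj z"] P(2)) (simp add: proj_def)
  qed
  show "M \<inter> chart_domain = {Y \<in> chart_domain. proj (chart Y) = chart Y}"
  proof -
    have "Y \<in> M \<longleftrightarrow> proj (chart Y) = chart Y" if Y: "core Y \<in> Q" for Y
    proof -
      have l: "lift (chart Y) = lift Y" by (rule lift_cong) (rule W_chart[OF Y])
      have iff: "proj (chart Y) = chart Y \<longleftrightarrow>
          Y = param (core Y) Y + tucker idx (P (f (core Y)) - f (core Y)) U"
      proof -
        have "proj (chart Y) = lift Y + tucker idx (P (f (core Y))) U"
          by (simp only: proj_def[of "chart Y"] l core_chart)
        then show ?thesis by (auto simp: chart_def[of Y] U.diff algebra_simps)
      qed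
      show ?thesis
      proof
        assume "Y \<in> M"
        then have "core Y \<in> Mc" "Y = param (core Y) Y" using M_param_iff[OF Y] by auto
        then show "proj (chart Y) = chart Y" using fMc[OF Y] by (simp add: iff U.zero)
      next
        assume "proj (chart Y) = chart Y"
        then have Yeq: "Y = param (core Y) Y + tucker idx (P (f (core Y)) - f (core Y)) U" by (simp only: iff)
        then have "core Y = core (param (core Y) Y + tucker idx (P (f (core Y)) - f (core Y)) U)" by (rule arg_cong)
        then have Pf: "P (f (core Y)) = f (core Y)" by (simp add: core.add core_param core_U)
        with Yeq have "Y = param (core Y) Y" by (simp add: U.zero)
        then show "Y \<in> M" using M_param_iff[OF Y] fMc[OF Y] Pf by blast
      qed
    qed
    then show ?thesis by (auto simp: chart_domain_def)
  qed
qed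

section \<open>The tangent space of the tensor manifold\<close>

text \<open>
  A curve in \<open>M\<close> through \<open>X\<close> equals \<open>param\<close> of itself, so it is given by curves of cores in \<open>Mc\<close> and of
  normalized factors starting at \<open>U\<close>, and the product rule exhibits its velocity as an element of the set. Conversely, for
  such a \<open>U'\<close> the factors \<open>U + t U'\<close> remain normalized and thus linearly independent. The
  set is a subspace because the straightening of \<open>M\<close> shows that the tangent space is one.
\<close>

theorem tangent_space_param:
  assumes X: "X = tucker idx C U" and C: "C \<in> Mc" "C \<in> Q"
  shows "tangent_space M X =
    span {tucker idx C' U + (\<Sum>\<mu>\<in>UNIV. tucker idx C (U(\<mu> := U' \<mu>))) | C' U'.
      C' \<in> tangent_space Mc C \<and> (\<forall>\<mu>. \<forall>k<r \<mu>. \<forall>l<r \<mu>. inner (V \<mu> k) (U' \<mu> l) = 0)}"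
    (is "_ = span ?S")
proof -
  interpret straightened M chart_domain chart proj by (rule straightened_chart)
  have cX: "core X = C" by (simp add: X core_U)
  have WX: "W \<mu> k X = 0" for \<mu> k by (simp add: X W_U)
  have XN: "X \<in> chart_domain" using C by (simp add: chart_domain_def cX)
  have "X \<in> M"
    unfolding X M tensor_manifold_def using C gram_invertible[OF dual_frame_U] by blast
  with XN have XMN: "X \<in> M \<inter> chart_domain" by simp
  have "tangent_space M X \<subseteq> ?S"
  proof
    fix v assume "v \<in> tangent_space M X"
    from this open_N XN obtain \<epsilon> \<gamma> where \<gamma>: "\<epsilon> > 0" "\<gamma> 0 = X" "\<And>t. \<bar>t\<bar> < \<epsilon> \<Longrightarrow> \<gamma> t \<in> M \<inter> chart_domain"
      "\<And>t. \<bar>t\<bar> < \<epsilon> \<Longrightarrow> \<gamma> differentiable (at t)" "(\<gamma> has_vector_derivative v) (at (0::real))"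
      by (rule tangent_spaceE) blast
    have \<gamma>M: "core (\<gamma> t) \<in> Mc" "\<gamma> t = param (core (\<gamma> t)) (\<gamma> t)" if "\<bar>t\<bar> < \<epsilon>" for t
      using \<gamma>(3)[OF that] M_param_iff[of "\<gamma> t"] by (auto simp: chart_domain_def)
    have sm: "smooth_on chart_domain (\<lambda>Y. K (core Y) Y \<mu> k)" for \<mu> k
      using Q by (intro smooth_on_K smooth_on_bounded_linear[OF bounded_linear_core] open_N) (auto simp: chart_domain_def)
    define D where "D \<mu> k = frechet_derivative (\<lambda>Y. K (core Y) Y \<mu> k) (at X)" for \<mu> k
    have D: "((\<lambda>Y. K (core Y) Y \<mu> k) has_derivative D \<mu> k) (at X)" for \<mu> k
    proof -
      obtain D' where "((\<lambda>Y. K (core Y) Y \<mu> k) has_derivative D') (at X)"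
        using smooth_on_derivative[OF sm] XN by blast
      then have "(\<lambda>Y. K (core Y) Y \<mu> k) differentiable (at X)" by (rule differentiableI)
      then show ?thesis unfolding D_def by (rule frechet_derivative_works[THEN iffD1])
    qed
    define U' where "U' \<mu> k = D \<mu> k v" for \<mu> k
    have dK: "((\<lambda>t. K (core (\<gamma> t)) (\<gamma> t) \<mu> k) has_vector_derivative U' \<mu> k) (at 0)" for \<mu> k
    proof -
      have "((\<lambda>t. K (core (\<gamma> t)) (\<gamma> t) \<mu> k) has_derivative (\<lambda>s. D \<mu> k (s *\<^sub>R v))) (at 0)"
        by (rule has_derivative_compose[OF \<gamma>(5)[unfolded has_vector_derivative_def]]) (simp only: \<gamma>(2) D)
      then show ?thesis
        by (simp only: has_vector_derivative_def U'_def linear_cmul[OF bounded_linear.linear[OF has_derivative_bounded_linear[OF D]]])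
    qed
    have K0: "K C X \<mu> k = 0" for \<mu> k by (simp add: K_def WX)
    have dc: "((\<lambda>t. core (\<gamma> t)) has_vector_derivative core v) (at 0)"
      by (rule core.has_vector_derivative[OF \<gamma>(5)])
    have "((\<lambda>t. tucker idx (core (\<gamma> t)) (\<lambda>\<mu> k. U \<mu> k + K (core (\<gamma> t)) (\<gamma> t) \<mu> k)) has_vector_derivative
      tucker idx (core v) U + (\<Sum>\<mu>\<in>UNIV. tucker idx C (U(\<mu> := U' \<mu>)))) (at 0)"
    proof -
      have "((\<lambda>t. U \<mu> k + K (core (\<gamma> t)) (\<gamma> t) \<mu> k) has_vector_derivative U' \<mu> k) (at 0)" for \<mu> k
        using has_vector_derivative_add[OF has_vector_derivative_const dK] by simp
      from has_vector_derivative_tucker[where w = "\<lambda>\<mu> k t. U \<mu> k + K (core (\<gamma> t)) (\<gamma> t) \<mu> k" and w' = U' and idx = idx, OF dc this]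
      show ?thesis
        by (simp only: K0 add_0_right \<gamma>(2) cX)
    qed
    then have "(\<gamma> has_vector_derivative
      tucker idx (core v) U + (\<Sum>\<mu>\<in>UNIV. tucker idx C (U(\<mu> := U' \<mu>)))) (at 0)"
      by (rule has_vector_derivative_transform_within_open[where S = "{-\<epsilon><..<\<epsilon>}"])
        (use \<gamma>(1) \<gamma>M(2) in \<open>auto simp: param_def[symmetric] abs_less_iff\<close>)
    then have v: "v = tucker idx (core v) U + (\<Sum>\<mu>\<in>UNIV. tucker idx C (U(\<mu> := U' \<mu>)))"
      using \<gamma>(5) vector_derivative_unique_at by blast
    have "inner (V \<mu> k) (U' \<mu> l) = 0" if "k < r \<mu>" for \<mu> k l
    proof -
      have "((\<lambda>t. inner (V \<mu> k) (K (core (\<gamma> t)) (\<gamma> t) \<mu> l)) has_vector_derivative inner (V \<mu> k) (U' \<mu> l)) (at 0)"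
        by (rule bounded_linear.has_vector_derivative[OF bounded_linear_inner_right dK])
      then have "((\<lambda>t::real. 0::real) has_vector_derivative inner (V \<mu> k) (U' \<mu> l)) (at 0)"
        by (simp only: frame_K[OF that])
      then show ?thesis using vector_derivative_unique_at has_vector_derivative_const by blast
    qed
    moreover have "core v \<in> tangent_space Mc C"
    proof (rule tangent_spaceI[where \<gamma> = "\<lambda>t. core (\<gamma> t)", OF \<gamma>(1)])
      show "(\<lambda>t. core (\<gamma> t)) differentiable at t" if "\<bar>t\<bar> < \<epsilon>" for t
        using \<gamma>(4)[OF that] core.has_derivative unfolding differentiable_def by blast
    qed (use \<gamma>M dc cX \<gamma>(2) in auto)
    ultimately show "v \<in> ?S" using v by blast
  qed
  moreover have "?S \<subseteq> tangent_space M X"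
  proof clarify
    fix C' U' assume C': "C' \<in> tangent_space Mc C"
      and U': "\<forall>\<mu>. \<forall>k<r \<mu>. \<forall>l<r \<mu>. inner (V \<mu> k) (U' \<mu> l) = 0"
    obtain \<epsilon> \<delta> where \<delta>: "\<epsilon> > 0" "\<delta> 0 = C" "\<And>t. \<bar>t\<bar> < \<epsilon> \<Longrightarrow> \<delta> t \<in> Mc"
      "\<And>t. \<bar>t\<bar> < \<epsilon> \<Longrightarrow> \<delta> differentiable (at t)" "(\<delta> has_vector_derivative C') (at (0::real))"
      using C' unfolding tangent_space_def by blast
    let ?w = "\<lambda>t \<mu> k. U \<mu> k + t *\<^sub>R U' \<mu> k"
    have dw: "((\<lambda>t. ?w t \<mu> k) has_vector_derivative U' \<mu> k) (at t)" for \<mu> k t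
      by (auto intro!: derivative_eq_intros)
    show "tucker idx C' U + (\<Sum>\<mu>\<in>UNIV. tucker idx C (U(\<mu> := U' \<mu>))) \<in> tangent_space M X"
    proof (rule tangent_spaceI[where \<gamma> = "\<lambda>t. tucker idx (\<delta> t) (?w t)", OF \<delta>(1)])
      show "tucker idx (\<delta> 0) (?w 0) = X" by (simp add: X \<delta>(2))
      show "((\<lambda>t. tucker idx (\<delta> t) (?w t)) has_vector_derivative
          tucker idx C' U + (\<Sum>\<mu>\<in>UNIV. tucker idx C (U(\<mu> := U' \<mu>)))) (at 0)"
        using has_vector_derivative_tucker[where w = "\<lambda>\<mu> k t. U \<mu> k + t *\<^sub>R U' \<mu> k" and w' = U' and idx = idx, OF \<delta>(5) dw] by (simp only: scaleR_zero_left add_0_right \<delta>(2))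
    next
      fix t :: real assume t: "\<bar>t\<bar> < \<epsilon>"
      have "dual_frame (?w t)" using U' by (intro dual_frame_add) simp
      then show "tucker idx (\<delta> t) (?w t) \<in> M"
        unfolding M tensor_manifold_def using \<delta>(3)[OF t] gram_invertible by blast
      obtain d where "(\<delta> has_vector_derivative d) (at t)"
        using \<delta>(4)[OF t] vector_derivative_works by blast
      from has_vector_derivative_tucker[where w = "\<lambda>\<mu> k t. U \<mu> k + t *\<^sub>R U' \<mu> k" and w' = U' and idx = idx, OF this dw]
      show "(\<lambda>t. tucker idx (\<delta> t) (?w t)) differentiable at t"
        by (rule differentiableI_vector)
    qed
  qed
  ultimately have eq: "tangent_space M X = ?S" by (rule equalityI)
  have "subspace (tangent_space M X)"
    using complemented_preimage_range_of_projection[OF bounded_linear_G'[OF XN] R RR bij_G'[OF XN]]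
    by (simp add: tangent_space_eq[OF XMN] complemented_def)
  then show ?thesis using eq span_eq_iff by metis
qed

end

end

section \<open>Local structure of the tensor manifold\<close>

text \<open>
  The dual basis within the span of \<open>u\<close> has the inverse Gram matrix as its coefficients, so each of the
  two families is a combination of the other and they have the same orthogonal complement.
\<close>

lemma gram_dual_basis:
  fixes u :: "nat \<Rightarrow> 'a::real_inner"
  assumes "invertible_upto n (transpose_mult u u)"
  shows "\<exists>v. (\<forall>k<n. \<forall>l<n. inner (v k) (u l) = (if k = l then 1 else 0)) \<and>
    (\<forall>x. (\<forall>k<n. inner (u k) x = 0) \<longleftrightarrow> (\<forall>k<n. inner (v k) x = 0))"
proof -
  obtain B where B: "\<And>i j. i < n \<Longrightarrow> j < n \<Longrightarrow> (\<Sum>k<n. inner (u i) (u k) * B k j) = (if i = j then 1 else 0)"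
    "\<And>i j. i < n \<Longrightarrow> j < n \<Longrightarrow> (\<Sum>k<n. B i k * inner (u k) (u j)) = (if i = j then 1 else 0)"
    using assms unfolding invertible_upto_def transpose_mult_def by blast
  define v where "v k = (\<Sum>l<n. B k l *\<^sub>R u l)" for k
  have vu: "inner (v k) (u l) = (if k = l then 1 else 0)" if "k < n" "l < n" for k l
    using B(2)[OF that] by (simp add: v_def inner_sum_left)
  have uv: "u l = (\<Sum>k<n. inner (u l) (u k) *\<^sub>R v k)" if "l < n" for l
  proof -
    have "(\<Sum>k<n. inner (u l) (u k) *\<^sub>R v k) = (\<Sum>m<n. (\<Sum>k<n. inner (u l) (u k) * B k m) *\<^sub>R u m)"
      unfolding v_def scaleR_sum_right scaleR_sum_left by (subst sum.swap) simp
    also have "\<dots> = (\<Sum>m<n. if m = l then u m else 0)"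
      using that by (intro sum.cong) (auto simp: B(1))
    finally show ?thesis using that by simp
  qed
  have "(\<forall>k<n. inner (u k) x = 0) \<longleftrightarrow> (\<forall>k<n. inner (v k) x = 0)" for x
  proof
    assume "\<forall>k<n. inner (u k) x = 0"
    then show "\<forall>k<n. inner (v k) x = 0" by (simp add: v_def inner_sum_left)
  next
    assume v: "\<forall>k<n. inner (v k) x = 0"
    show "\<forall>k<n. inner (u k) x = 0"
    proof (intro allI impI)
      fix l assume "l < n"
      from arg_cong[OF uv[OF this], of "\<lambda>y. inner y x"]
      have "inner (u l) x = inner (\<Sum>k<n. inner (u l) (u k) *\<^sub>R v k) x" .
      also have "\<dots> = 0" using v by (simp add: inner_sum_left)
      finally show "inner (u l) x = 0" .
    qed
  qed
  with vu show ?thesis by blast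
qed

lemma subspace_projection:
  fixes E :: "'a::euclidean_space set"
  assumes E: "subspace E"
  shows "\<exists>P. bounded_linear P \<and> (\<forall>z. P (P z) = P z) \<and> (\<forall>z. P z = z \<longleftrightarrow> z \<in> E)"
proof -
  obtain P :: "'a \<Rightarrow> 'a" where P: "range P \<subseteq> E" "linear P" "\<And>v. v \<in> E \<Longrightarrow> P v = v"
    using linear_exists_left_inverse_on[OF linear_id E] by auto
  have PE: "P z \<in> E" for z using P(1) by blast
  have "P (P z) = P z" "P z = z \<longleftrightarrow> z \<in> E" for z
    using P(3)[OF PE[of z]] P(3)[of z] PE[of z] by auto
  moreover have "bounded_linear P" using P(2) by (simp add: linear_conv_bounded_linear)
  ultimately show ?thesis by (intro exI[of _ P]) simp
qed

theorem theorem4p1: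
  fixes r :: "'d::finite \<Rightarrow> nat"
    and idx :: "'i::finite \<Rightarrow> 'd \<Rightarrow> nat"
    and Mc :: "(real ^ 'i) set"
    and M :: "('d \<Rightarrow> nat) ell2 set"
    and C :: "real ^ 'i"
    and U :: "'d \<Rightarrow> nat \<Rightarrow> nat ell2"
    and X :: "('d \<Rightarrow> nat) ell2"
  assumes r_pos: "\<forall>\<mu>. 0 < r \<mu>"
    and idx: "enumerates_box r idx"
    and Mc_rank: "Mc \<subseteq> full_multilinear_rank_tensors r idx"
    and Mc_submanifold: "smooth_submanifold Mc"
    and Mc_invariant: "\<And>C' T. C' \<in> Mc \<Longrightarrow> (\<forall>\<mu>. invertible_upto (r \<mu>) (T \<mu>)) \<Longrightarrow>
      core_mult idx C' T \<in> Mc"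
    and M: "M = tensor_manifold r idx Mc"
    and C: "C \<in> Mc"
    and U: "\<forall>\<mu>. invertible_upto (r \<mu>) (transpose_mult (U \<mu>) (U \<mu>))"
    and X: "X = tucker idx C U"
  shows "(\<exists>N (F :: ('d \<Rightarrow> nat) ell2 set) (g :: ('d \<Rightarrow> nat) ell2 \<Rightarrow> ('d \<Rightarrow> nat) ell2).
      open N \<and> X \<in> N \<and>
      \<comment> \<open>(i)\<close>
      submersion_on N F g \<and>
      M \<inter> N = {Y \<in> N. g Y = 0} \<and>
      smooth_submanifold (M \<inter> N) \<and>
      (\<forall>Y \<in> M \<inter> N. tangent_space M Y = {\<xi>. frechet_derivative g (at Y) \<xi> = 0}) \<and>
      \<comment> \<open>(ii)\<close>
      (\<exists>V \<phi> \<psi>.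
        openin (top_of_set (tangent_space M X)) V \<and> 0 \<in> V \<and>
        homeomorphism V (M \<inter> N) \<phi> \<psi> \<and>
        C1_on (tangent_space M X) V \<phi> \<and>
        \<phi> 0 = X \<and>
        (\<lambda>\<xi>. norm (\<phi> \<xi> - X - \<xi>)) \<in> o[at 0 within V](\<lambda>\<xi>. norm \<xi>) \<and>
        immersion_on (tangent_space M X) V \<phi> \<and>
        embedding_on (tangent_space M X) V \<phi>)) \<and>
    \<comment> \<open>(iii)\<close>
    tangent_space M X =
      span {tucker idx C' U + (\<Sum>\<mu>\<in>UNIV. tucker idx C (U(\<mu> := U' \<mu>))) | C' U'.
        C' \<in> tangent_space Mc C \<and>
        (\<forall>\<mu>. \<forall>k<r \<mu>. \<forall>l<r \<mu>. transpose_mult (U \<mu>) (U' \<mu>) k l = 0)}"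
proof -
  interpret index_box r idx by unfold_locales (rule r_pos[rule_format], rule idx)
  have "\<forall>\<mu>. \<exists>v. (\<forall>k<r \<mu>. \<forall>l<r \<mu>. inner (v k) (U \<mu> l) = (if k = l then 1 else 0)) \<and>
    (\<forall>x. (\<forall>k<r \<mu>. inner (U \<mu> k) x = 0) \<longleftrightarrow> (\<forall>k<r \<mu>. inner (v k) x = 0))"
    by (intro allI gram_dual_basis U[rule_format])
  from choice[OF this] obtain V where V:
    "\<forall>\<mu>. (\<forall>k<r \<mu>. \<forall>l<r \<mu>. inner (V \<mu> k) (U \<mu> l) = (if k = l then 1 else 0)) \<and>
      (\<forall>x. (\<forall>k<r \<mu>. inner (U \<mu> k) x = 0) \<longleftrightarrow> (\<forall>k<r \<mu>. inner (V \<mu> k) x = 0))" ..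
  have VU: "inner (V \<mu> k) (U \<mu> l) = (if k = l then 1 else 0)" if "k < r \<mu>" "l < r \<mu>" for \<mu> k l
    by (rule V[rule_format, THEN conjunct1, rule_format, OF that])
  have UV: "(\<forall>k<r \<mu>. inner (U \<mu> k) x = 0) \<longleftrightarrow> (\<forall>k<r \<mu>. inner (V \<mu> k) x = 0)" for \<mu> x
    by (rule V[THEN spec, THEN conjunct2, THEN spec])
  have "\<forall>\<mu>. \<exists>B :: real ^ 'i ^ 'i. (\<forall>j i. i \<notin> ax \<mu> ` {..<r \<mu>} \<longrightarrow> B $ j $ i = 0) \<and>
    (\<forall>k<r \<mu>. \<forall>l<r \<mu>. (matricization idx \<mu> C ** B) $ ax \<mu> k $ ax \<mu> l = (if k = l then 1 else 0))"
  proof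
    fix \<mu>
    have "rank (matricization idx \<mu> C) = r \<mu>"
      using subsetD[OF Mc_rank C] by (simp add: full_multilinear_rank_tensors_def)
    from full_rank_right_inverse[OF this]
    show "\<exists>B :: real ^ 'i ^ 'i. (\<forall>j i. i \<notin> ax \<mu> ` {..<r \<mu>} \<longrightarrow> B $ j $ i = 0) \<and>
      (\<forall>k<r \<mu>. \<forall>l<r \<mu>. (matricization idx \<mu> C ** B) $ ax \<mu> k $ ax \<mu> l = (if k = l then 1 else 0))" .
  qed
  from choice[OF this] obtain B :: "'d \<Rightarrow> real ^ 'i ^ 'i" where
    B: "\<forall>\<mu>. (\<forall>j i. i \<notin> ax \<mu> ` {..<r \<mu>} \<longrightarrow> B \<mu> $ j $ i = 0) \<and>
      (\<forall>k<r \<mu>. \<forall>l<r \<mu>. (matricization idx \<mu> C ** B \<mu>) $ ax \<mu> k $ ax \<mu> l = (if k = l then 1 else 0))" ..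
  interpret tucker_chart r idx C U V B
  proof (unfold_locales, goal_cases)
    case 1
    then show ?case by (rule VU)
  next
    case 2
    then show ?case by (rule B[rule_format, THEN conjunct1, rule_format])
  next
    case 3
    then show ?case by (rule B[rule_format, THEN conjunct2, rule_format])
  qed
  obtain S f E where S: "open S" "C \<in> S" and f: "smooth_diffeo_on S f" and E: "complemented E"
    and fE: "f ` (Mc \<inter> S) = f ` S \<inter> E"
    using Mc_submanifold[unfolded smooth_submanifold_def, rule_format, OF C] by (elim exE conjE) (rule that)
  have "subspace E" using E by (simp add: complemented_def)
  from subspace_projection[OF this] obtain P
    where P: "bounded_linear P" and PP: "\<forall>z. P (P z) = P z" and PE: "\<forall>z. P z = z \<longleftrightarrow> z \<in> E"
    by blast
  define Q where "Q = S \<inter> regular"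
  have Q: "open Q" "Q \<subseteq> regular" "Q \<subseteq> S" "C \<in> Q"
    using S open_regular C_regular by (auto simp: Q_def)
  have fQ: "smooth_diffeo_on Q f" using f Q(1,3) by (rule smooth_diffeo_on_subset)
  have inj: "inj_on f S" using f by (simp add: smooth_diffeo_on_def)
  have fMc: "e \<in> Mc \<longleftrightarrow> P (f e) = f e" if e: "e \<in> Q" for e
  proof -
    have eS: "e \<in> S" using e Q(3) by blast
    have "e \<in> Mc \<longleftrightarrow> f e \<in> f ` (Mc \<inter> S)"
      using inj_on_image_mem_iff[OF inj eS, of "Mc \<inter> S"] eS by simp
    also have "\<dots> \<longleftrightarrow> f e \<in> E" using eS fE by blast
    finally show ?thesis by (simp add: PE)
  qed
  note chart = Q(2) fQ P PP[rule_format] fMc Mc_invariant M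
  interpret straightened M "chart_domain Q" "chart f" "proj P"
    by (rule straightened_chart[OF chart])
  have XM: "X \<in> M" unfolding M X tensor_manifold_def 
    by (rule CollectI, intro exI conjI, rule refl, rule C, rule U)
  have XN: "X \<in> chart_domain Q" by (simp add: chart_domain_def[OF chart] X core_U Q(4))
  let ?g = "\<lambda>Y. chart f Y - proj P (chart f Y)"
  have tangent: "tangent_space M X =
      span {tucker idx C' U + (\<Sum>\<mu>\<in>UNIV. tucker idx C (U(\<mu> := U' \<mu>))) | C' U'.
        C' \<in> tangent_space Mc C \<and>
        (\<forall>\<mu>. \<forall>k<r \<mu>. \<forall>l<r \<mu>. transpose_mult (U \<mu>) (U' \<mu>) k l = 0)}"
  proof -
    have frame: "(\<forall>k<r \<mu>. \<forall>l<r \<mu>. transpose_mult (U \<mu>) (U' \<mu>) k l = 0) \<longleftrightarrow>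
        (\<forall>k<r \<mu>. \<forall>l<r \<mu>. inner (V \<mu> k) (U' \<mu> l) = 0)" for \<mu> U'
    proof -
      have "(\<forall>k<r \<mu>. \<forall>l<r \<mu>. inner (a k) (U' \<mu> l) = 0) \<longleftrightarrow> (\<forall>l<r \<mu>. \<forall>k<r \<mu>. inner (a k) (U' \<mu> l) = 0)"
        for a by blast
      then show ?thesis unfolding transpose_mult_def by (simp only: UV)
    qed
    show ?thesis unfolding frame by (rule tangent_space_param[OF chart X C Q(4)])
  qed
  show ?thesis
    by (rule conjI[OF _ tangent], rule exI[of _ "chart_domain Q"], rule exI[of _ "{z. proj P z = 0}"], rule exI[of _ ?g])
      (intro conjI ballI open_N XN defining_submersion smooth_submanifold_straightened
        tangential_parametrization[OF IntI[OF XM XN]])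
qed

end
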